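(* Let $(\mathcal{H},[\cdot,\cdot])$ be a Krein space with fundamental symmetry $J$ and fundamental decomposition $\mathcal{H}=\mathcal{H}_+\dotplus\mathcal{H}_-$. Let $\mathcal{F}=\{f_i\}_{i\in I}$ be a $J$-frame for $\mathcal{H}$ with synthesis operator $T\in L(\ell_2(I),\mathcal{H})$, and let $T_\pm=TP_\pm$. Then its $J$-frame operator $S\in L(\mathcal{H})$ satisfies: 1. $S=TT^{\#}$; 2. $S=S_+-S_-$, where $S_+:=T_+T_+^{\#}$ and $S_-:=-T_-T_-^{\#}$ are $J$-positive operators; 3. $S$ is an invertible $J$-selfadjoint operator; 4. $\mathrm{ind}_\pm(S)=\dim\mathcal{H}_\pm$.
   Context: Krein space setting: $(\mathcal{H},[\cdot,\cdot])$ is a complex separable Krein space with a fixed fundamental decomposition $\mathcal{H}=\mathcal{H}_+\dotplus\mathcal{H}_-$ (the summands are $[\cdot,\cdot]$-orthogonal and $(\mathcal{H}_\pm,\pm[\cdot,\cdot])$ are Hilbert spaces). $\langle\cdot,\cdot\rangle$ is the inner product making $\mathcal{H}$ the orthogonal direct sum of these Hilbert spaces, $\|\cdot\|$ its norm, and the fundamental symmetry $J$ (a selfadjoint unitary) satisfies $[x,y]=\langle Jx,y\rangle$. $L(\cdot,\cdot)$ denotes bounded linear operators and $*$ Hilbert space adjoints. For $T\in L(\mathcal{H}_1,\mathcal{H}_2)$ between Krein spaces with fundamental symmetries $J_1,J_2$, the $J$-adjoint is $T^{\#}=J_1T^*J_2$. $A\in L(\mathcal{H})$ is $J$-selfadjoint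 if $A^{\#}=A$, and $J$-positive if $[Af,f]\ge 0$ for all $f\in\mathcal{H}$. A subspace $\mathcal{S}$ is uniformly $J$-positive (resp. uniformly $J$-negative) if there is $\alpha>0$ with $[x,x]\ge\alpha\|x\|^2$ (resp. $[x,x]\le-\alpha\|x\|^2$) for all $x\in\mathcal{S}$. "Maximal" means maximal with respect to inclusion among such subspaces. A Bessel family is a family $\mathcal{F}=\{f_i\}_{i\in I}$ in $\mathcal{H}$ with $\sum_i|\langle f,f_i\rangle|^2\le B\|f\|^2$ for all $f$ and some $B<\infty$. Its synthesis operator is $T\in L(\ell_2(I),\mathcal{H})$, $Te_i=f_i$, with $\{e_i\}$ the standard orthonormal basis. Let $I_+=\{i:[f_i,f_i]\ge0\}$, $I_-=\{i:[f_i,f_i]<0\}$, $P_\pm$ the orthogonal projection of $\ell_2(I)$ onto $\ell_2(I_\pm)$, and $T_\pm=TP_\pm$. The Bessel family $\mathcal{F}$ is a $J$-frame for $\mathcal{H}$ if the range $R(T_+)$ is a maximal uniformly $J$-positive subspace and $R(T_-)$ is a maximal uniformly $J$-negative subspace of $\mathcal{H}$. Let $\sigma_i=1$ for $i\in I_+$ and $\sigma_i=-1$ for $i\in I_-$. The $J$-frame operator of a $J$-frame is $Sf=\sum_{i\in I}\sigma_i[f,f_i]f_i$. The space $\ell_2(I)$ is regarded as a Krein space with fundamental symmetry $J_2e_i=\sigma_ie_i$, so $T^{\#}=J_2T^*J$ and $T_\pm^{\#}=J_2T_\pm^*J$. Indices: for a $J$-selfadjoint $A\in L(\mathcal{H})$,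 $\mathrm{ind}_+(A)\in\{0,1,2,\dots,\infty\}$ is the supremum of all positive integers $r$ for which there are $x_1,\dots,x_r\in\mathcal{H}$ such that the matrix $([Ax_j,x_k])_{j,k=1}^r$ is positive and invertible ($0$ if no such $r$ exists), and $\mathrm{ind}_-(A)=\mathrm{ind}_+(-A)$. The dimension $\dim\mathcal{H}_\pm$ is likewise taken in $\{0,1,2,\dots,\infty\}$. *)

theory Defs
  imports
    "HOL-Library.Function_Algebras"
    "HOL-Library.Extended_Nat"
    "HOL-Library.Countable_Set"
    "HOL-Library.Nonpos_Ints"
    "HOL-Analysis.Infinite_Sum"
    "Jordan_Normal_Form.Matrix"
begin

section \<open>Complex vector spaces\<close>

class scaleC =
  fixes scaleC :: "complex \<Rightarrow> 'a \<Rightarrow> 'a"  (infixr "*\<^sub>C" 75)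

class complex_vector = scaleC + ab_group_add +
  assumes scaleC_add_right: "a *\<^sub>C (x + y) = a *\<^sub>C x + a *\<^sub>C y"
    and scaleC_add_left: "(a + b) *\<^sub>C x = a *\<^sub>C x + b *\<^sub>C x"
    and scaleC_scaleC: "a *\<^sub>C b *\<^sub>C x = (a * b) *\<^sub>C x"
    and scaleC_one: "1 *\<^sub>C x = x"

global_interpretation complex_vector:
  vector_space "scaleC :: complex \<Rightarrow> 'a \<Rightarrow> 'a::complex_vector"
  by unfold_locales (rule scaleC_add_right scaleC_add_left scaleC_scaleC scaleC_one)+

instantiation complex :: complex_vector
begin
definition scaleC_complex :: "complex \<Rightarrow> complex \<Rightarrow> complex"
  where "scaleC_complex a x = a * x"
instance
  by standard (simp_all add: scaleC_complex_def algebra_simps)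
end

instantiation "fun" :: (type, complex_vector) complex_vector
begin
definition scaleC_fun :: "complex \<Rightarrow> ('a \<Rightarrow> 'b) \<Rightarrow> ('a \<Rightarrow> 'b)"
  where "scaleC_fun a g = (\<lambda>i. a *\<^sub>C g i)"
instance
  by standard
    (simp_all add: scaleC_fun_def fun_eq_iff scaleC_add_right scaleC_add_left
      scaleC_scaleC scaleC_one)
end

definition cdim :: "'a::complex_vector set \<Rightarrow> enat"
  where "cdim V = (if \<exists>B. finite B \<and> V \<subseteq> complex_vector.span B
                   then enat (complex_vector.dim V) else \<infinity>)"

section \<open>Hilbert spaces\<close>

text \<open>Spaces are carrier sets inside a complex vector space, so that the summands of a fundamental
  decomposition and sequence spaces over an arbitrary index set are Hilbert spaces in the same sense.
  Operators are functions on the ambient type of which only the values on the carrier matter.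
  Forms are linear in the first argument.\<close>

definition hermitian_form :: "'a::complex_vector set \<Rightarrow> ('a \<Rightarrow> 'a \<Rightarrow> complex) \<Rightarrow> bool"
  where "hermitian_form V h \<longleftrightarrow>
    (\<forall>x\<in>V. \<forall>y\<in>V. \<forall>z\<in>V. h (x + y) z = h x z + h y z) \<and>
    (\<forall>a. \<forall>x\<in>V. \<forall>z\<in>V. h (a *\<^sub>C x) z = a * h x z) \<and>
    (\<forall>x\<in>V. \<forall>y\<in>V. h y x = cnj (h x y))"

record 'a hilbert =
  hcarrier :: "'a set"
  hinner :: "'a \<Rightarrow> 'a \<Rightarrow> complex"

definition hnorm :: "'a hilbert \<Rightarrow> 'a \<Rightarrow> real"
  where "hnorm X x = sqrt (Re (hinner X x x))"

definition hilbert_space :: "'a::complex_vector hilbert \<Rightarrow> bool"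
  where "hilbert_space X \<longleftrightarrow>
    complex_vector.subspace (hcarrier X) \<and>
    hermitian_form (hcarrier X) (hinner X) \<and>
    (\<forall>x\<in>hcarrier X. x \<noteq> 0 \<longrightarrow> 0 < Re (hinner X x x)) \<and>
    (\<forall>u :: nat \<Rightarrow> 'a. range u \<subseteq> hcarrier X \<longrightarrow>
       (\<forall>e>0. \<exists>N. \<forall>m\<ge>N. \<forall>n\<ge>N. hnorm X (u m - u n) < e) \<longrightarrow>
       (\<exists>l\<in>hcarrier X. (\<lambda>n. hnorm X (u n - l)) \<longlonglongrightarrow> 0))"

definition separable_space :: "'a::complex_vector hilbert \<Rightarrow> bool"
  where "separable_space X \<longleftrightarrow>
    (\<exists>D\<subseteq>hcarrier X. countable D \<and>
       (\<forall>x\<in>hcarrier X. \<forall>e>0. \<exists>d\<in>D. hnorm X (x - d) < e))"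

definition bounded_op ::
    "'a::complex_vector hilbert \<Rightarrow> 'b::complex_vector hilbert \<Rightarrow> ('a \<Rightarrow> 'b) \<Rightarrow> bool"
  where "bounded_op X Y A \<longleftrightarrow>
    (\<forall>x\<in>hcarrier X. A x \<in> hcarrier Y) \<and>
    (\<forall>x\<in>hcarrier X. \<forall>y\<in>hcarrier X. A (x + y) = A x + A y) \<and>
    (\<forall>a. \<forall>x\<in>hcarrier X. A (a *\<^sub>C x) = a *\<^sub>C A x) \<and>
    (\<exists>C. \<forall>x\<in>hcarrier X. hnorm Y (A x) \<le> C * hnorm X x)"

definition invertible_op :: "'a::complex_vector hilbert \<Rightarrow> ('a \<Rightarrow> 'a) \<Rightarrow> bool"
  where "invertible_op X A \<longleftrightarrow>
    bounded_op X X A \<and>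
    (\<exists>R. bounded_op X X R \<and> (\<forall>x\<in>hcarrier X. R (A x) = x \<and> A (R x) = x))"

text \<open>\<open>hadjoint X Y A\<close> is the Hilbert space adjoint of \<open>A\<close> as an operator from \<open>X\<close> to \<open>Y\<close>.\<close>

definition hadjoint :: "'a hilbert \<Rightarrow> 'b hilbert \<Rightarrow> ('a \<Rightarrow> 'b) \<Rightarrow> 'b \<Rightarrow> 'a"
  where "hadjoint X Y A y =
    (THE x. x \<in> hcarrier X \<and> (\<forall>z\<in>hcarrier X. hinner Y (A z) y = hinner X z x))"

definition orth_proj :: "'a::complex_vector hilbert \<Rightarrow> 'a set \<Rightarrow> 'a \<Rightarrow> 'a"
  where "orth_proj X M x = (THE y. y \<in> M \<and> (\<forall>z\<in>M. hinner X (x - y) z = 0))"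

text \<open>Unconditional norm convergence of \<open>\<Sum>i\<in>I. g i\<close> to \<open>s\<close>.\<close>

definition has_hsum ::
    "'a::complex_vector hilbert \<Rightarrow> ('i \<Rightarrow> 'a) \<Rightarrow> 'i set \<Rightarrow> 'a \<Rightarrow> bool"
  where "has_hsum X g I s \<longleftrightarrow>
    s \<in> hcarrier X \<and> ((\<lambda>F. hnorm X (sum g F - s)) \<longlongrightarrow> 0) (finite_subsets_at_top I)"

definition hsum :: "'a::complex_vector hilbert \<Rightarrow> ('i \<Rightarrow> 'a) \<Rightarrow> 'i set \<Rightarrow> 'a"
  where "hsum X g I = (THE s. has_hsum X g I s)"

definition ell2 :: "'i set \<Rightarrow> ('i \<Rightarrow> complex) hilbert"
  where "ell2 I =
    \<lparr>hcarrier = {c. (\<forall>i. i \<notin> I \<longrightarrow> c i = 0) \<and> (\<lambda>i. (cmod (c i))\<^sup>2) summable_on I},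
     hinner = (\<lambda>c d. \<Sum>\<^sub>\<infinity>i\<in>I. c i * cnj (d i))\<rparr>"

definition unit_seq :: "'i \<Rightarrow> 'i \<Rightarrow> complex"
  where "unit_seq i = (\<lambda>j. if j = i then 1 else 0)"

section \<open>Krein spaces\<close>

text \<open>A Krein space together with the chosen fundamental decomposition.\<close>

record 'a krein =
  kcarrier :: "'a set"
  kform :: "'a \<Rightarrow> 'a \<Rightarrow> complex"
  kpos :: "'a set"
  kneg :: "'a set"

definition kproj_pos :: "'a::complex_vector krein \<Rightarrow> 'a \<Rightarrow> 'a"
  where "kproj_pos K x = (THE y. y \<in> kpos K \<and> x - y \<in> kneg K)"

definition kproj_neg :: "'a::complex_vector krein \<Rightarrow> 'a \<Rightarrow> 'a"
  where "kproj_neg K x = (THE y. y \<in> kneg K \<and> x - y \<in> kpos K)"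

definition ksym :: "'a::complex_vector krein \<Rightarrow> 'a \<Rightarrow> 'a"
  where "ksym K x = kproj_pos K x - kproj_neg K x"

definition kinner :: "'a::complex_vector krein \<Rightarrow> 'a \<Rightarrow> 'a \<Rightarrow> complex"
  where "kinner K x y =
    kform K (kproj_pos K x) (kproj_pos K y) - kform K (kproj_neg K x) (kproj_neg K y)"

definition khilbert :: "'a::complex_vector krein \<Rightarrow> 'a hilbert"
  where "khilbert K = \<lparr>hcarrier = kcarrier K, hinner = kinner K\<rparr>"

definition krein_space :: "'a::complex_vector krein \<Rightarrow> bool"
  where "krein_space K \<longleftrightarrow>
    complex_vector.subspace (kcarrier K) \<and>
    hermitian_form (kcarrier K) (kform K) \<and>
    kcarrier K = {x + y |x y. x \<in> kpos K \<and> y \<in> kneg K} \<and>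
    kpos K \<inter> kneg K = {0} \<and>
    (\<forall>x\<in>kpos K. \<forall>y\<in>kneg K. kform K x y = 0) \<and>
    hilbert_space \<lparr>hcarrier = kpos K, hinner = kform K\<rparr> \<and>
    hilbert_space \<lparr>hcarrier = kneg K, hinner = (\<lambda>x y. - kform K x y)\<rparr>"

text \<open>\<open>jadjoint X J\<^sub>1 Y J\<^sub>2 A\<close> is the \<open>J\<close>-adjoint of \<open>A\<close> as an operator from \<open>X\<close> with fundamental
  symmetry \<open>J\<^sub>1\<close> to \<open>Y\<close> with fundamental symmetry \<open>J\<^sub>2\<close>.\<close>

definition jadjoint ::
    "'a hilbert \<Rightarrow> ('a \<Rightarrow> 'a) \<Rightarrow> 'b hilbert \<Rightarrow> ('b \<Rightarrow> 'b) \<Rightarrow> ('a \<Rightarrow> 'b) \<Rightarrow> 'b \<Rightarrow> 'a"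
  where "jadjoint X J\<^sub>1 Y J\<^sub>2 A = J\<^sub>1 \<circ> hadjoint X Y A \<circ> J\<^sub>2"

definition j_selfadjoint :: "'a::complex_vector krein \<Rightarrow> ('a \<Rightarrow> 'a) \<Rightarrow> bool"
  where "j_selfadjoint K A \<longleftrightarrow>
    bounded_op (khilbert K) (khilbert K) A \<and>
    (\<forall>x\<in>kcarrier K. jadjoint (khilbert K) (ksym K) (khilbert K) (ksym K) A x = A x)"

definition j_positive :: "'a::complex_vector krein \<Rightarrow> ('a \<Rightarrow> 'a) \<Rightarrow> bool"
  where "j_positive K A \<longleftrightarrow>
    bounded_op (khilbert K) (khilbert K) A \<and>
    (\<forall>x\<in>kcarrier K. kform K (A x) x \<in> \<real>\<^sub>\<ge>\<^sub>0)"

definition unif_j_positive :: "'a::complex_vector krein \<Rightarrow> 'a set \<Rightarrow> bool"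
  where "unif_j_positive K V \<longleftrightarrow>
    complex_vector.subspace V \<and> V \<subseteq> kcarrier K \<and>
    (\<exists>\<alpha>>0. \<forall>x\<in>V. Re (kform K x x) \<ge> \<alpha> * (hnorm (khilbert K) x)\<^sup>2)"

definition unif_j_negative :: "'a::complex_vector krein \<Rightarrow> 'a set \<Rightarrow> bool"
  where "unif_j_negative K V \<longleftrightarrow>
    complex_vector.subspace V \<and> V \<subseteq> kcarrier K \<and>
    (\<exists>\<alpha>>0. \<forall>x\<in>V. Re (kform K x x) \<le> - \<alpha> * (hnorm (khilbert K) x)\<^sup>2)"

definition maximal_wrt :: "('a set \<Rightarrow> bool) \<Rightarrow> 'a set \<Rightarrow> bool"
  where "maximal_wrt P V \<longleftrightarrow> P V \<and> (\<forall>W. P W \<and> V \<subseteq> W \<longrightarrow> W = V)"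

definition positive_mat :: "complex mat \<Rightarrow> bool"
  where "positive_mat M \<longleftrightarrow>
    square_mat M \<and> (\<forall>v\<in>carrier_vec (dim_row M). (M *\<^sub>v v) \<bullet>c v \<in> \<real>\<^sub>\<ge>\<^sub>0)"

definition ind_pos :: "'a krein \<Rightarrow> ('a \<Rightarrow> 'a) \<Rightarrow> enat"
  where "ind_pos K A = Sup {enat r |r. r \<ge> 1 \<and>
    (\<exists>x :: nat \<Rightarrow> 'a. (\<forall>j<r. x j \<in> kcarrier K) \<and>
       (let M = mat r r (\<lambda>(j, k). kform K (A (x j)) (x k))
        in positive_mat M \<and> invertible_mat M))}"

definition ind_neg :: "'a::complex_vector krein \<Rightarrow> ('a \<Rightarrow> 'a) \<Rightarrow> enat"
  where "ind_neg K A = ind_pos K (\<lambda>x. - A x)"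

section \<open>\<open>J\<close>-frames\<close>

text \<open>A family \<open>{f i}\<close> with \<open>i \<in> I\<close> is a function \<open>f\<close> on the index type together with the set \<open>I\<close>.\<close>

definition bessel_family :: "'a::complex_vector krein \<Rightarrow> 'i set \<Rightarrow> ('i \<Rightarrow> 'a) \<Rightarrow> bool"
  where "bessel_family K I f \<longleftrightarrow>
    (\<forall>i\<in>I. f i \<in> kcarrier K) \<and>
    (\<exists>B. \<forall>g\<in>kcarrier K. (\<lambda>i. (cmod (kinner K g (f i)))\<^sup>2) summable_on I \<and>
       (\<Sum>\<^sub>\<infinity>i\<in>I. (cmod (kinner K g (f i)))\<^sup>2) \<le> B * (hnorm (khilbert K) g)\<^sup>2)"

text \<open>The synthesis operator is determined by its values on the unit sequences up to its irrelevant
  values outside the carrier of \<open>ell2 I\<close>, hence a predicate.\<close>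

definition synthesis_op ::
    "'a::complex_vector krein \<Rightarrow> 'i set \<Rightarrow> ('i \<Rightarrow> 'a) \<Rightarrow> (('i \<Rightarrow> complex) \<Rightarrow> 'a) \<Rightarrow> bool"
  where "synthesis_op K I f T \<longleftrightarrow>
    bounded_op (ell2 I) (khilbert K) T \<and> (\<forall>i\<in>I. T (unit_seq i) = f i)"

definition idx_pos :: "'a krein \<Rightarrow> 'i set \<Rightarrow> ('i \<Rightarrow> 'a) \<Rightarrow> 'i set"
  where "idx_pos K I f = {i \<in> I. Re (kform K (f i) (f i)) \<ge> 0}"

definition idx_neg :: "'a krein \<Rightarrow> 'i set \<Rightarrow> ('i \<Rightarrow> 'a) \<Rightarrow> 'i set"
  where "idx_neg K I f = {i \<in> I. Re (kform K (f i) (f i)) < 0}"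

definition synth_pos ::
    "'a krein \<Rightarrow> 'i set \<Rightarrow> ('i \<Rightarrow> 'a) \<Rightarrow> (('i \<Rightarrow> complex) \<Rightarrow> 'a) \<Rightarrow> ('i \<Rightarrow> complex) \<Rightarrow> 'a"
  where "synth_pos K I f T = T \<circ> orth_proj (ell2 I) (hcarrier (ell2 (idx_pos K I f)))"

definition synth_neg ::
    "'a krein \<Rightarrow> 'i set \<Rightarrow> ('i \<Rightarrow> 'a) \<Rightarrow> (('i \<Rightarrow> complex) \<Rightarrow> 'a) \<Rightarrow> ('i \<Rightarrow> complex) \<Rightarrow> 'a"
  where "synth_neg K I f T = T \<circ> orth_proj (ell2 I) (hcarrier (ell2 (idx_neg K I f)))"

definition j_frame :: "'a::complex_vector krein \<Rightarrow> 'i set \<Rightarrow> ('i \<Rightarrow> 'a) \<Rightarrow> bool"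
  where "j_frame K I f \<longleftrightarrow>
    bessel_family K I f \<and>
    (\<exists>T. synthesis_op K I f T \<and>
       maximal_wrt (unif_j_positive K) (synth_pos K I f T ` hcarrier (ell2 I)) \<and>
       maximal_wrt (unif_j_negative K) (synth_neg K I f T ` hcarrier (ell2 I)))"

definition sig :: "'a krein \<Rightarrow> 'i set \<Rightarrow> ('i \<Rightarrow> 'a) \<Rightarrow> 'i \<Rightarrow> complex"
  where "sig K I f i = (if i \<in> idx_pos K I f then 1 else - 1)"

definition j_frame_op :: "'a::complex_vector krein \<Rightarrow> 'i set \<Rightarrow> ('i \<Rightarrow> 'a) \<Rightarrow> 'a \<Rightarrow> 'a"
  where "j_frame_op K I f g =
    hsum (khilbert K) (\<lambda>i. (sig K I f i * kform K g (f i)) *\<^sub>C f i) I"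

definition ell2_sym :: "'a krein \<Rightarrow> 'i set \<Rightarrow> ('i \<Rightarrow> 'a) \<Rightarrow> ('i \<Rightarrow> complex) \<Rightarrow> 'i \<Rightarrow> complex"
  where "ell2_sym K I f c = (\<lambda>i. sig K I f i * c i)"

text \<open>The \<open>J\<close>-adjoint of an operator \<open>U\<close> from \<open>ell2 I\<close>, with the fundamental symmetry induced by
  \<open>f\<close>, to \<open>K\<close>.\<close>

definition ell2_jadjoint ::
    "'a::complex_vector krein \<Rightarrow> 'i set \<Rightarrow> ('i \<Rightarrow> 'a) \<Rightarrow> (('i \<Rightarrow> complex) \<Rightarrow> 'a)
      \<Rightarrow> 'a \<Rightarrow> 'i \<Rightarrow> complex"
  where "ell2_jadjoint K I f U =
    jadjoint (ell2 I) (ell2_sym K I f) (khilbert K) (ksym K) U"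

end

theory Submission
  imports Defs "Jordan_Normal_Form.Determinant"
begin

text \<open>Only the ranges \<open>M\<^sub>\<plusminus>\<close> of \<open>T\<^sub>\<plusminus>\<close> and the symmetric nonnegative operators \<open>S\<^sub>\<plusminus>\<close> with ranges in
  them matter. A vector orthogonal to a maximal uniformly positive subspace and not negative is zero,
  so \<open>M\<^sub>+ + M\<^sub>-\<close> has trivial orthogonal complement; as \<open>Re [m + k, m - k] = [m, m] - [k, k]\<close> bounds the
  angle between \<open>M\<^sub>+\<close> and \<open>M\<^sub>-\<close>, their sum is direct, closed, and hence the whole space.
  Since \<open>\<bar>[T\<^sub>\<plusminus> c, x]\<bar>\<close> is controlled by \<open>\<parallel>c\<parallel>\<close> and \<open>[S\<^sub>\<plusminus> x, x] \<le> C \<parallel>S x\<parallel> \<parallel>x\<parallel>\<close>, the vectors with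
  \<open>\<parallel>S x\<parallel> \<parallel>x\<parallel> \<le> 1\<close> are weakly bounded, hence bounded: \<open>S\<close> is bounded below, and being symmetric it
  is onto. A subspace on which \<open>[S x, x]\<close> is positive is mapped injectively into \<open>H\<^sub>+\<close> by \<open>P\<^sub>+ S\<^sub>+\<close>, and
  \<open>[S x, x]\<close> is positive on \<open>S\<^sup>-\<^sup>1 M\<^sub>+\<close>, into which \<open>H\<^sub>+\<close> embeds along \<open>M\<^sub>-\<close>; this gives
  \<open>ind\<^sub>+ S = dim H\<^sub>+\<close>. Exchanging the roles of the two summands, with \<open>-[\<cdot>, \<cdot>]\<close> in place of \<open>[\<cdot>, \<cdot>]\<close>, leaves
  \<open>S\<close> unchanged and gives \<open>ind\<^sub>- S\<close>.\<close>

section \<open>Hermitian forms\<close>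

text \<open>The obstacle is that \<open>[S x, x] = [S+ x, x] - [S- x, x]\<close> is indefinite, so
  no lower bound for \<open>S\<close> can be read off it. The angle bound repairs this: it gives
  ||S+ x|| + ||S- x|| <= C ||S x||, so that the sum of the two nonnegative quantities, and not only
  their difference, is at most C ||S x|| ||x||. The link to the frame is |c_i [f_i, x]| <= |c_i|^2 +
  |[x, f_i]|^2: summed over the positive or the negative indices, the last term is exactly the
  quadratic form of S+ or S-. Hence a functional [y, .] with y in M+ + M- stays bounded where both
  quadratic forms do. Maximality enters here: every functional on the space is of this kind only
  because M+ + M- is everything. Spaces are carriers inside an ambient vector space, so completeness
  is used through Cauchy sequences and convergence means that norms of differences tend to
  0.\<close>

lemma hermitian_form_subset: "hermitian_form V h \<Longrightarrow> W \<subseteq> V \<Longrightarrow> hermitian_form W h"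
  unfolding hermitian_form_def by blast

text \<open>Positivity is left out so that the same algebra serves \<open>[.,.]\<close>, the Hilbert
  inner products and the forms \<open>[A x, y]\<close> of symmetric operators.\<close>

locale hermitian_space =
  fixes V :: "'a::complex_vector set" and h :: "'a \<Rightarrow> 'a \<Rightarrow> complex"
  assumes sub: "complex_vector.subspace V"
    and herm: "hermitian_form V h"
begin

lemma add_mem: "x \<in> V \<Longrightarrow> y \<in> V \<Longrightarrow> x + y \<in> V"
  using sub by (rule complex_vector.subspace_add)

lemma diff_mem: "x \<in> V \<Longrightarrow> y \<in> V \<Longrightarrow> x - y \<in> V"
  using sub by (rule complex_vector.subspace_diff)

lemma scale_mem: "x \<in> V \<Longrightarrow> a *\<^sub>C x \<in> V"
  using sub by (rule complex_vector.subspace_scale)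

lemma neg_mem: "x \<in> V \<Longrightarrow> - x \<in> V"
  using sub by (rule complex_vector.subspace_neg)

lemma zero_mem: "0 \<in> V"
  using sub by (rule complex_vector.subspace_0)

lemma sum_mem: "(\<And>i. i \<in> F \<Longrightarrow> g i \<in> V) \<Longrightarrow> sum g F \<in> V"
  using sub by (rule complex_vector.subspace_sum)

lemmas mem = add_mem diff_mem scale_mem neg_mem zero_mem

lemma add_left: "x \<in> V \<Longrightarrow> y \<in> V \<Longrightarrow> z \<in> V \<Longrightarrow> h (x + y) z = h x z + h y z"
  using herm unfolding hermitian_form_def by blast

lemma scale_left: "x \<in> V \<Longrightarrow> z \<in> V \<Longrightarrow> h (a *\<^sub>C x) z = a * h x z"
  using herm unfolding hermitian_form_def by blast

lemma sym: "x \<in> V \<Longrightarrow> y \<in> V \<Longrightarrow> h y x = cnj (h x y)"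
  using herm unfolding hermitian_form_def by blast

lemma add_right: "x \<in> V \<Longrightarrow> y \<in> V \<Longrightarrow> z \<in> V \<Longrightarrow> h z (x + y) = h z x + h z y"
  by (metis add_left add_mem complex_cnj_add sym)

lemma scale_right: "x \<in> V \<Longrightarrow> z \<in> V \<Longrightarrow> h z (a *\<^sub>C x) = cnj a * h z x"
  by (metis scale_left scale_mem complex_cnj_mult sym)

lemma zero_left: "z \<in> V \<Longrightarrow> h 0 z = 0"
  using scale_left[of 0 z 0] zero_mem by simp

lemma zero_right: "z \<in> V \<Longrightarrow> h z 0 = 0"
  using scale_right[of 0 z 0] zero_mem by simp

lemma neg_left: "x \<in> V \<Longrightarrow> z \<in> V \<Longrightarrow> h (- x) z = - h x z"
  using scale_left[of x z "-1"] by simp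

lemma neg_right: "x \<in> V \<Longrightarrow> z \<in> V \<Longrightarrow> h z (- x) = - h z x"
  using scale_right[of x z "-1"] by simp

lemma diff_left: "x \<in> V \<Longrightarrow> y \<in> V \<Longrightarrow> z \<in> V \<Longrightarrow> h (x - y) z = h x z - h y z"
  using add_left[of x "- y" z] neg_left[of y z] by (simp add: neg_mem)

lemma diff_right: "x \<in> V \<Longrightarrow> y \<in> V \<Longrightarrow> z \<in> V \<Longrightarrow> h z (x - y) = h z x - h z y"
  using add_right[of x "- y" z] neg_right[of y z] by (simp add: neg_mem)

lemmas expand = add_left add_right diff_left diff_right neg_left neg_right
  scale_left scale_right zero_left zero_right

lemma sum_left:
  assumes "\<And>i. i \<in> F \<Longrightarrow> g i \<in> V" "z \<in> V"
  shows "h (sum g F) z = (\<Sum>i\<in>F. h (g i) z)"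
  using assms
  by (induction F rule: infinite_finite_induct) (auto simp: zero_left add_left sum_mem)

lemma sum_right:
  assumes "\<And>i. i \<in> F \<Longrightarrow> g i \<in> V" "z \<in> V"
  shows "h z (sum g F) = (\<Sum>i\<in>F. h z (g i))"
  using assms
  by (induction F rule: infinite_finite_induct) (auto simp: zero_right add_right sum_mem)

lemma diag_real: "x \<in> V \<Longrightarrow> h x x = of_real (Re (h x x))"
  using sym[of x x] by (simp add: complex_eq_iff)

end

section \<open>Hilbert spaces\<close>

locale hilbert =
  fixes X :: "'a::complex_vector hilbert"
  assumes hilbert: "hilbert_space X"
begin

sublocale hermitian_space "hcarrier X" "hinner X"
  using hilbert by unfold_locales (auto simp: hilbert_space_def)

abbreviation "V \<equiv> hcarrier X"
abbreviation "ip \<equiv> hinner X"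
abbreviation "nm \<equiv> hnorm X"

lemma pos: "x \<in> V \<Longrightarrow> x \<noteq> 0 \<Longrightarrow> 0 < Re (ip x x)"
  using hilbert by (auto simp: hilbert_space_def)

lemma nonneg: "x \<in> V \<Longrightarrow> 0 \<le> Re (ip x x)"
  using pos[of x] by (cases "x = 0") (auto simp: zero_left zero_mem)

lemma complete:
  assumes "\<And>n. u n \<in> V" "\<And>e. e > 0 \<Longrightarrow> \<exists>N::nat. \<forall>m\<ge>N. \<forall>n\<ge>N. nm (u m - u n) < e"
  obtains l where "l \<in> V" "(\<lambda>n. nm (u n - l)) \<longlonglongrightarrow> 0"
proof -
  have "range u \<subseteq> V" using assms(1) by auto
  moreover have "\<forall>e>0. \<exists>N. \<forall>m\<ge>N. \<forall>n\<ge>N. nm (u m - u n) < e" using assms(2) by simp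
  ultimately have "\<exists>l\<in>V. (\<lambda>n. nm (u n - l)) \<longlonglongrightarrow> 0"
    using hilbert by (simp add: hilbert_space_def)
  then show ?thesis using that by blast
qed

lemma norm_ge_0: "x \<in> V \<Longrightarrow> 0 \<le> nm x"
  by (simp add: hnorm_def nonneg)

lemma norm_sq: "x \<in> V \<Longrightarrow> (nm x)\<^sup>2 = Re (ip x x)"
  by (simp add: hnorm_def nonneg)

lemma ip_self: "x \<in> V \<Longrightarrow> ip x x = of_real ((nm x)\<^sup>2)"
  using diag_real[of x] norm_sq[of x] by simp

lemma norm_zero [simp]: "nm 0 = 0"
  by (simp add: hnorm_def zero_left zero_mem)

lemma norm_eq_0: "x \<in> V \<Longrightarrow> nm x = 0 \<longleftrightarrow> x = 0"
  using pos[of x] by (cases "x = 0") (auto simp: hnorm_def zero_left zero_mem)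

lemma norm_scale: "x \<in> V \<Longrightarrow> nm (a *\<^sub>C x) = cmod a * nm x"
proof -
  assume x: "x \<in> V"
  have "ip (a *\<^sub>C x) (a *\<^sub>C x) = (a * cnj a) * ip x x"
    using x by (simp add: expand mem)
  also have "\<dots> = of_real ((cmod a)\<^sup>2 * (nm x)\<^sup>2)"
    using ip_self[OF x] complex_norm_square[of a] by simp
  finally have "ip (a *\<^sub>C x) (a *\<^sub>C x) = of_real ((cmod a)\<^sup>2 * (nm x)\<^sup>2)" .
  then have "nm (a *\<^sub>C x) = sqrt ((cmod a * nm x)\<^sup>2)"
    by (simp add: hnorm_def power_mult_distrib)
  then show ?thesis
    using norm_ge_0[OF x] by simp
qed

lemma norm_uminus: "x \<in> V \<Longrightarrow> nm (- x) = nm x"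
  using norm_scale[of x "-1"] by simp

lemma norm_minus_commute: "x \<in> V \<Longrightarrow> y \<in> V \<Longrightarrow> nm (x - y) = nm (y - x)"
  using norm_uminus[of "x - y"] by (simp add: mem)

lemma norm_add_sq: "x \<in> V \<Longrightarrow> y \<in> V \<Longrightarrow> (nm (x + y))\<^sup>2 = (nm x)\<^sup>2 + (nm y)\<^sup>2 + 2 * Re (ip x y)"
  using sym[of x y] by (simp add: norm_sq mem expand)

lemma norm_diff_sq: "x \<in> V \<Longrightarrow> y \<in> V \<Longrightarrow> (nm (x - y))\<^sup>2 = (nm x)\<^sup>2 + (nm y)\<^sup>2 - 2 * Re (ip x y)"
  using sym[of x y] by (simp add: norm_sq mem expand)

text \<open>Pythagoras for \<open>x\<close> minus its component along \<open>y\<close>.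
  Nonnegativity of the right side is Cauchy-Schwarz, and its drop below the squared norm of
  \<open>x\<close> is what makes a nearest point orthogonal in \<open>projection\<close>.\<close>

lemma norm_diff_component_sq:
  assumes x: "x \<in> V" and y: "y \<in> V" "y \<noteq> 0"
  shows "(nm (x - (ip x y / of_real ((nm y)\<^sup>2)) *\<^sub>C y))\<^sup>2
    = (nm x)\<^sup>2 - (cmod (ip x y))\<^sup>2 / (nm y)\<^sup>2"
proof -
  define a where "a = ip x y / of_real ((nm y)\<^sup>2)"
  have ny: "nm y > 0" using norm_eq_0[OF y(1)] norm_ge_0[OF y(1)] y(2) by auto
  have "(nm (x - a *\<^sub>C y))\<^sup>2 = (nm x)\<^sup>2 + (cmod a * nm y)\<^sup>2 - 2 * Re (cnj a * ip x y)"
    using x y by (simp add: norm_diff_sq mem norm_scale scale_right)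
  also have "cnj a * ip x y = of_real ((cmod (ip x y))\<^sup>2 / (nm y)\<^sup>2)"
    using complex_norm_square[of "ip x y"] by (simp add: a_def mult.commute)
  also have "cmod a = cmod (ip x y) / (nm y)\<^sup>2"
    by (simp add: a_def norm_divide norm_power)
  also have "(cmod (ip x y) / (nm y)\<^sup>2 * nm y)\<^sup>2 = (cmod (ip x y))\<^sup>2 / (nm y)\<^sup>2"
    using ny by (simp add: power2_eq_square)
  finally show ?thesis by (simp add: a_def)
qed

lemma Cauchy_Schwarz:
  assumes x: "x \<in> V" and y: "y \<in> V"
  shows "cmod (ip x y) \<le> nm x * nm y"
proof (cases "y = 0")
  case True
  then show ?thesis using x by (simp add: zero_right)
next
  case False
  then have ny: "nm y > 0" using norm_eq_0[OF y] norm_ge_0[OF y] by auto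
  have "0 \<le> (nm x)\<^sup>2 - (cmod (ip x y))\<^sup>2 / (nm y)\<^sup>2"
    unfolding norm_diff_component_sq[OF x y False, symmetric] by simp
  then have "(cmod (ip x y))\<^sup>2 \<le> (nm x * nm y)\<^sup>2"
    using ny by (simp add: field_simps power_mult_distrib)
  then show ?thesis
    using norm_ge_0[OF x] norm_ge_0[OF y] by (meson mult_nonneg_nonneg power2_le_imp_le)
qed

lemma norm_triangle:
  assumes x: "x \<in> V" and y: "y \<in> V"
  shows "nm (x + y) \<le> nm x + nm y"
proof (rule power2_le_imp_le)
  have "Re (ip x y) \<le> nm x * nm y"
    using Cauchy_Schwarz[OF x y] complex_Re_le_cmod order_trans by blast
  then show "(nm (x + y))\<^sup>2 \<le> (nm x + nm y)\<^sup>2"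
    using x y by (simp add: norm_add_sq power2_sum)
qed (use x y norm_ge_0 in auto)

lemma norm_triangle4: "x \<in> V \<Longrightarrow> y \<in> V \<Longrightarrow> nm (x - y) \<le> nm x + nm y"
  using norm_triangle[of x "- y"] by (simp add: mem norm_uminus)

lemma norm_triangle_via: "x \<in> V \<Longrightarrow> y \<in> V \<Longrightarrow> z \<in> V \<Longrightarrow> nm (x - z) \<le> nm (x - y) + nm (y - z)"
  using norm_triangle[of "x - y" "y - z"] by (simp add: mem)

lemma norm_triangle_back: "x \<in> V \<Longrightarrow> y \<in> V \<Longrightarrow> nm x \<le> nm (x - y) + nm y"
  using norm_triangle[of "x - y" "y"] by (simp add: mem)

lemma eqI: "x \<in> V \<Longrightarrow> y \<in> V \<Longrightarrow> (\<And>z. z \<in> V \<Longrightarrow> ip z x = ip z y) \<Longrightarrow> x = y"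
  using norm_eq_0[of "x - y"] ip_self[of "x - y"]
  by (metis diff_mem diff_right diff_self eq_iff_diff_eq_0 norm_zero of_real_0 of_real_eq_iff power_zero_numeral zero_eq_power2)

lemma tendsto_unique:
  assumes "x \<in> V" "y \<in> V" "eventually (\<lambda>i. u i \<in> V) F" "F \<noteq> bot"
    and "((\<lambda>i. nm (u i - x)) \<longlongrightarrow> 0) F" "((\<lambda>i. nm (u i - y)) \<longlongrightarrow> 0) F"
  shows "x = y"
proof -
  have "((\<lambda>i. nm (u i - x) + nm (u i - y)) \<longlongrightarrow> 0 + 0) F"
    using assms(5,6) by (rule tendsto_add)
  moreover have "eventually (\<lambda>i. nm (x - y) \<le> nm (u i - x) + nm (u i - y)) F"
    using assms(3) by eventually_elim (use assms(1,2) in \<open>metis norm_triangle_via norm_minus_commute\<close>)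
  ultimately have "nm (x - y) \<le> 0"
    using tendsto_lowerbound[of "\<lambda>i. nm (u i - x) + nm (u i - y)" "0 + 0" F "nm (x - y)"] assms(4) by simp
  then show ?thesis
    using norm_eq_0[of "x - y"] norm_ge_0[of "x - y"] assms by (auto simp: mem)
qed

lemma tendsto_norm:
  assumes "x \<in> V" "\<And>i. u i \<in> V" "((\<lambda>i. nm (u i - x)) \<longlongrightarrow> 0) F"
  shows "((\<lambda>i. nm (u i)) \<longlongrightarrow> nm x) F"
proof -
  have "\<bar>nm (u i) - nm x\<bar> \<le> nm (u i - x)" for i
    using norm_triangle_back[of "u i" x] norm_triangle_back[of x "u i"] assms(1,2)
      norm_minus_commute[of x "u i"] by auto
  then have "((\<lambda>i. nm (u i) - nm x) \<longlongrightarrow> 0) F"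
    by (intro tendsto_0_le[where K = 1, OF assms(3)]) (auto intro!: always_eventually
      intro: order_trans[OF _ abs_ge_self])
  then show ?thesis by (simp add: LIM_zero_cancel)
qed

lemma convergent_Cauchy:
  assumes "x \<in> V" "\<And>n. u n \<in> V" "(\<lambda>n::nat. nm (u n - x)) \<longlonglongrightarrow> 0" "e > 0"
  shows "\<exists>N. \<forall>m\<ge>N. \<forall>n\<ge>N. nm (u m - u n) < e"
proof -
  obtain N where N: "\<And>n. n \<ge> N \<Longrightarrow> \<bar>nm (u n - x)\<bar> < e / 2"
    using LIMSEQ_D[OF assms(3), of "e / 2"] assms(4) by auto
  have "nm (u m - u n) < e" if "m \<ge> N" "n \<ge> N" for m n
    using N[OF that(1)] N[OF that(2)] norm_triangle_via[of "u m" x "u n"]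
      norm_minus_commute[of x "u n"] assms(1,2) by fastforce
  then show ?thesis by blast
qed

section \<open>Orthogonal projection and uniform boundedness\<close>

text \<open>A minimizing sequence is Cauchy by the parallelogram law; completeness and the
  sequential closedness \<open>cl\<close> place its limit in \<open>W\<close>, and minimality forces
  orthogonality.\<close>

lemma projection:
  assumes W: "complex_vector.subspace W" "W \<subseteq> V"
    and cl: "\<And>u l. \<lbrakk>\<And>n::nat. u n \<in> W; l \<in> V; (\<lambda>n. nm (u n - l)) \<longlonglongrightarrow> 0\<rbrakk> \<Longrightarrow> l \<in> W"
    and x: "x \<in> V"
  obtains p where "p \<in> W" "\<And>w. w \<in> W \<Longrightarrow> ip (x - p) w = 0"
proof -
  interpret W: hermitian_space W ip
    using W herm by unfold_locales (auto intro: hermitian_form_subset)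
  define d where "d = (INF w\<in>W. nm (x - w))"
  have WV: "w \<in> V" if "w \<in> W" for w using W that by auto
  have bdd: "bdd_below ((\<lambda>w. nm (x - w)) ` W)"
    using x WV by (intro bdd_belowI2[where m = 0]) (auto simp: mem norm_ge_0)
  have d_le: "d \<le> nm (x - w)" if "w \<in> W" for w
    unfolding d_def using bdd that by (rule cINF_lower)
  have d0: "d \<ge> 0"
    unfolding d_def using W.zero_mem x WV by (intro cINF_greatest) (auto simp: mem norm_ge_0)
  have "\<exists>w\<in>W. nm (x - w) < d + 1 / Suc n" for n
  proof -
    have "(INF w\<in>W. nm (x - w)) < d + 1 / Suc n" by (simp add: d_def[symmetric])
    then show ?thesis
      using W.zero_mem bdd by (subst (asm) cINF_less_iff) auto
  qed
  then obtain w where w: "\<And>n. w n \<in> W" "\<And>n. nm (x - w n) < d + 1 / Suc n"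
    by metis
  have wV: "w n \<in> V" for n using w WV by auto
  \<comment> \<open>The midpoint of \<open>w m\<close> and \<open>w n\<close> is again in
    \<open>W\<close>, hence at distance at least \<open>d\<close> from \<open>x\<close>, so the
    \<open>d^2\<close> terms cancel in the parallelogram identity. Each squared distance exceeds
    \<open>d^2\<close> by at most \<open>(2 * d + 1) / Suc k\<close>; doubling gives
    \<open>4 * d + 2\<close>.\<close>
  have par: "(nm (w m - w n))\<^sup>2 \<le> (4 * d + 2) * (1 / Suc m + 1 / Suc n)" for m n
  proof -
    let ?a = "x - w m" and ?b = "x - w n"
    have mid: "(1/2) *\<^sub>C (w m + w n) \<in> W" using w by (simp add: W.mem)
    have "?a + ?b = 2 *\<^sub>C (x - (1/2) *\<^sub>C (w m + w n))"
    proof -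
      have "2 *\<^sub>C x = x + x"
        using scaleC_add_left[of 1 1 x] by (simp add: scaleC_one)
      then show ?thesis
        by (simp add: complex_vector.scale_right_diff_distrib algebra_simps)
    qed
    then have "nm (?a + ?b) = 2 * nm (x - (1/2) *\<^sub>C (w m + w n))"
      using x wV by (simp add: norm_scale mem)
    then have ge: "(nm (?a + ?b))\<^sup>2 \<ge> 4 * d\<^sup>2"
      using d_le[OF mid] d0 by (simp add: power_mult_distrib power_mono)
    have eq: "(nm (w m - w n))\<^sup>2 = 2 * (nm ?a)\<^sup>2 + 2 * (nm ?b)\<^sup>2 - (nm (?a + ?b))\<^sup>2"
    proof -
      have "w m - w n = ?b - ?a" by simp
      then have "(nm (w m - w n))\<^sup>2 = (nm ?b)\<^sup>2 + (nm ?a)\<^sup>2 - 2 * Re (ip ?b ?a)"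
        using x wV by (simp only: norm_diff_sq mem)
      moreover have "(nm (?b + ?a))\<^sup>2 = (nm ?b)\<^sup>2 + (nm ?a)\<^sup>2 + 2 * Re (ip ?b ?a)"
        using x wV by (simp only: norm_add_sq mem)
      ultimately show ?thesis by (simp add: add.commute)
    qed
    have sq: "(nm (x - w k))\<^sup>2 \<le> d\<^sup>2 + (2 * d + 1) * (1 / Suc k)" for k
    proof -
      have "(nm (x - w k))\<^sup>2 \<le> (d + 1 / Suc k)\<^sup>2"
        using w(2)[of k] x wV by (intro power_mono) (auto simp: mem norm_ge_0)
      also have "\<dots> = d\<^sup>2 + 2 * d * (1 / Suc k) + (1 / Suc k) * (1 / Suc k)"
        by (simp only: power2_sum) (simp add: power2_eq_square)
      also have "(1 / Suc k) * (1 / Suc k) \<le> 1 * (1 / Suc k)"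
        by (intro mult_right_mono) auto
      finally show ?thesis by (simp add: algebra_simps)
    qed
    define s where "s k = (2 * d + 1) * (1 / Suc k)" for k
    have "(nm (w m - w n))\<^sup>2 \<le> 2 * s m + 2 * s n"
      using sq[of m] sq[of n] ge eq unfolding s_def[symmetric] by linarith
    also have "\<dots> = (4 * d + 2) * (1 / Suc m + 1 / Suc n)"
      unfolding s_def by (simp add: algebra_simps)
    finally show ?thesis .
  qed
  have lim0: "(\<lambda>n. 1 / real (Suc n)) \<longlonglongrightarrow> 0"
    using LIMSEQ_inverse_real_of_nat by (simp add: inverse_eq_divide)
  have "\<exists>N. \<forall>m\<ge>N. \<forall>n\<ge>N. nm (w m - w n) < e" if e: "e > 0" for e
  proof -
    have c: "0 < 2 * (4 * d + 2)" using d0 by simp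
    then have "e\<^sup>2 / (2 * (4 * d + 2)) > 0" using e by simp
    then obtain N where N: "1 / real (Suc N) < e\<^sup>2 / (2 * (4 * d + 2))"
      using nat_approx_posE by blast
    have "nm (w m - w n) < e" if "m \<ge> N" "n \<ge> N" for m n
    proof -
      have "1 / real (Suc m) \<le> 1 / real (Suc N)" "1 / real (Suc n) \<le> 1 / real (Suc N)"
        using that by (auto intro!: divide_left_mono)
      then have "(4 * d + 2) * (1 / Suc m + 1 / Suc n) \<le> (4 * d + 2) * (2 * (1 / Suc N))"
        using d0 by (intro mult_left_mono) auto
      also have "\<dots> < e\<^sup>2"
        using N[unfolded pos_less_divide_eq[OF c]] by (simp add: mult_ac)
      finally have "(nm (w m - w n))\<^sup>2 < e\<^sup>2"
        using par[of m n] by linarith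
      then show ?thesis using e by (simp add: power2_less_imp_less)
    qed
    then show ?thesis by blast
  qed
  then obtain p where p: "p \<in> V" "(\<lambda>n. nm (w n - p)) \<longlonglongrightarrow> 0"
    using complete[of w] wV by blast
  have pW: "p \<in> W" using cl[of w p] w p by blast
  have "nm (x - p) \<le> d"
  proof (rule LIMSEQ_le_const)
    show "(\<lambda>n. (d + 1 / Suc n) + nm (w n - p)) \<longlonglongrightarrow> d"
      using tendsto_add[OF tendsto_add[OF tendsto_const[of d] lim0] p(2)] by simp
    show "\<exists>N. \<forall>n\<ge>N. nm (x - p) \<le> (d + 1 / Suc n) + nm (w n - p)"
      using norm_triangle_via[OF x wV p(1)] w(2) by (meson add_right_mono less_imp_le order_trans)
  qed
  then have min: "nm (x - p) \<le> nm (x - v)" if "v \<in> W" for v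
    using d_le[OF that] by linarith
  have "ip (x - p) v = 0" if v: "v \<in> W" for v
  proof (rule ccontr)
    assume ne: "ip (x - p) v \<noteq> 0"
    have vV: "v \<in> V" using v WV by auto
    have xp: "x - p \<in> V" using x p by (simp add: mem)
    have v0: "v \<noteq> 0" using ne zero_right[OF xp] by auto
    then have nv: "nm v > 0" using norm_eq_0[OF vV] norm_ge_0[OF vV] by auto
    \<comment> \<open>Adding \<open>a\<close> times \<open>v\<close> to \<open>p\<close> removes the
      component of \<open>x - p\<close> along \<open>v\<close> and would come strictly closer to
      \<open>x\<close>.\<close>
    define a where "a = ip (x - p) v / of_real ((nm v)\<^sup>2)"
    have "(nm (x - p))\<^sup>2 \<le> (nm ((x - p) - a *\<^sub>C v))\<^sup>2"
      using min[of "p + a *\<^sub>C v"] pW v x p vV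
      by (intro power_mono) (auto simp: W.mem mem norm_ge_0 diff_diff_eq)
    then have "(cmod (ip (x - p) v))\<^sup>2 / (nm v)\<^sup>2 \<le> 0"
      unfolding a_def norm_diff_component_sq[OF xp vV v0] by simp
    then show False using ne nv by (simp add: field_simps)
  qed
  with pW show ?thesis using that by blast
qed

text \<open>Turns density into equality. It is applied to \<open>Mp + Mm\<close> and to the range of
  \<open>S\<close>, where the orthogonal complement is accessible and closedness comes from a lower
  norm bound.\<close>

lemma closed_subspace_eq_carrier:
  assumes W: "complex_vector.subspace W" "W \<subseteq> V"
    and cl: "\<And>u l. \<lbrakk>\<And>n::nat. u n \<in> W; l \<in> V; (\<lambda>n. nm (u n - l)) \<longlonglongrightarrow> 0\<rbrakk> \<Longrightarrow> l \<in> W"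
    and perp: "\<And>z. \<lbrakk>z \<in> V; \<And>w. w \<in> W \<Longrightarrow> ip z w = 0\<rbrakk> \<Longrightarrow> z = 0"
  shows "W = V"
proof (intro equalityI W subsetI)
  fix x assume x: "x \<in> V"
  obtain p where p: "p \<in> W" "\<And>w. w \<in> W \<Longrightarrow> ip (x - p) w = 0"
    using projection[OF W _ x] cl by blast
  then have "x - p = 0" using perp[of "x - p"] x W by (auto simp: mem subset_iff)
  then show "x \<in> W" using p by simp
qed

text \<open>The gliding hump: \<open>x\<close> is the limit of partial sums of \<open>\<plusminus> 3\<^sup>-\<^sup>n y n / \<parallel>y n\<parallel>\<close>, the sign being
  chosen so that the pairing with \<open>y n\<close> does not decrease below the size of the new term; the tail
  contributes at most half as much.\<close>

lemma weakly_bounded_imp_bounded: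
  assumes Y: "Y \<subseteq> V" and wb: "\<And>x. x \<in> V \<Longrightarrow> \<exists>C. \<forall>y\<in>Y. cmod (ip x y) \<le> C"
  shows "\<exists>C. \<forall>y\<in>Y. nm y \<le> C"
proof (rule ccontr)
  assume "\<nexists>C. \<forall>y\<in>Y. nm y \<le> C"
  \<comment> \<open>Growth \<open>4 ^ n\<close> against weights \<open>3 ^ n\<close>: the pairing of
    the limit with \<open>y n\<close> ends up at least \<open>(1/2) * (4/3) ^ n\<close>, which is
    unbounded.\<close>
  then have "\<exists>y\<in>Y. nm y > 4 ^ n" for n :: nat
    by (meson not_less)
  then obtain y where y: "\<And>n. y n \<in> Y" "\<And>n::nat. nm (y n) > 4 ^ n" by metis
  have yV: "y n \<in> V" for n using y Y by auto
  have y0: "nm (y n) > 0" for n using y(2)[of n] by (meson less_trans zero_less_numeral zero_less_power)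
  define b where "b n = complex_of_real (1 / (3 ^ n * nm (y n))) *\<^sub>C y n" for n
  have bV: "b n \<in> V" for n unfolding b_def using yV by (simp add: mem)
  have nb: "nm (b n) = 1 / 3 ^ n" for n
    unfolding b_def using yV y0[of n] by (simp add: norm_scale norm_divide norm_mult norm_power)
  have bb: "ip (b n) (y n) = of_real (nm (y n) / 3 ^ n)" for n
    unfolding b_def using yV y0[of n] by (simp add: scale_left ip_self power2_eq_square)
  define step where "step x n = (if cmod (ip (x + b n) (y n)) \<ge> nm (y n) / 3 ^ n then x + b n else x - b n)" for x n
  define u where "u = rec_nat 0 (\<lambda>n x. step x n)"
  have u0: "u 0 = 0" and uS: "u (Suc n) = step (u n) n" for n by (simp_all add: u_def)
  have uV: "u n \<in> V" for n
    by (induction n) (auto simp: u0 uS step_def mem bV)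
  have hump: "cmod (ip (u (Suc n)) (y n)) \<ge> nm (y n) / 3 ^ n" for n
  proof (cases "cmod (ip (u n + b n) (y n)) \<ge> nm (y n) / 3 ^ n")
    case True
    then show ?thesis by (simp add: uS step_def)
  next
    case False
    let ?p = "ip (u n) (y n)" and ?q = "ip (b n) (y n)"
    have q: "cmod ?q = nm (y n) / 3 ^ n"
      using y0[of n] by (simp add: bb norm_divide norm_power)
    \<comment> \<open>\<open>2 * ?q\<close> is the difference of the two candidates
      \<open>?p + ?q\<close> and \<open>?p - ?q\<close>, so if the first is too small the second is
      large enough.\<close>
    have "2 * cmod ?q \<le> cmod (?p + ?q) + cmod (?p - ?q)"
      using norm_triangle_ineq4[of "?p + ?q" "?p - ?q"] by (simp add: norm_mult[symmetric])
    then show ?thesis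
      using False q by (simp add: uS step_def add_left diff_left uV bV yV)
  qed
  have inc: "nm (u (Suc n) - u n) = 1 / 3 ^ n" for n
    using nb[of n] norm_uminus[OF bV, of n] by (simp add: uS step_def)
  \<comment> \<open>Geometric series with ratio 1/3; at \<open>m = Suc n\<close> the bound is half
    of \<open>1 / 3 ^ n\<close>, too little to cancel the hump at \<open>n\<close>.\<close>
  have tail: "nm (u (m + k) - u m) \<le> (3/2) * (1 / 3 ^ m)" for m k
  proof -
    have "nm (u (m + k) - u m) \<le> (3/2) * (1 / 3 ^ m - 1 / 3 ^ (m + k))"
    proof (induction k)
      case (Suc k)
      have "nm (u (m + Suc k) - u m) \<le> nm (u (Suc (m + k)) - u (m + k)) + nm (u (m + k) - u m)"
        using norm_triangle_via[OF uV uV uV] by simp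
      also have "\<dots> \<le> 1 / 3 ^ (m + k) + (3/2) * (1 / 3 ^ m - 1 / 3 ^ (m + k))"
        using Suc inc by simp
      also have "\<dots> = (3/2) * (1 / 3 ^ m - 1 / 3 ^ (m + Suc k))"
        by (simp add: field_simps)
      finally show ?case .
    qed simp
    also have "\<dots> \<le> (3/2) * (1 / 3 ^ m)" by simp
    finally show ?thesis .
  qed
  have "\<exists>N. \<forall>m\<ge>N. \<forall>n\<ge>N. nm (u m - u n) < e" if "e > 0" for e
  proof -
    have "\<exists>N. (1 / 3 :: real) ^ N < e / 3"
      using that by (intro real_arch_pow_inv) auto
    then obtain N where N: "3 * (1 / 3 ^ N) < e"
      by (auto simp: power_one_over field_simps)
    have "nm (u m - u n) < e" if "m \<ge> N" "n \<ge> N" for m n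
    proof -
      have "nm (u m - u N) \<le> (3/2) * (1 / 3 ^ N)" "nm (u n - u N) \<le> (3/2) * (1 / 3 ^ N)"
        using tail[of N "m - N"] tail[of N "n - N"] that by auto
      then show ?thesis
        using N norm_triangle_via[OF uV[of m] uV[of N] uV[of n]] norm_minus_commute[OF uV uV, of n N] by linarith
    qed
    then show ?thesis by blast
  qed
  then obtain x where x: "x \<in> V" "(\<lambda>n. nm (u n - x)) \<longlonglongrightarrow> 0"
    using complete[of u] uV by blast
  have tail': "nm (x - u m) \<le> (3/2) * (1 / 3 ^ m)" for m
  proof (rule LIMSEQ_le_const)
    show "(\<lambda>n. nm (u n - x) + (3/2) * (1 / 3 ^ m)) \<longlonglongrightarrow> (3/2) * (1 / 3 ^ m)"
      using tendsto_add[OF x(2) tendsto_const] by simp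
    show "\<exists>N. \<forall>n\<ge>N. nm (x - u m) \<le> nm (u n - x) + (3/2) * (1 / 3 ^ m)"
    proof (intro exI allI impI)
      fix n assume "n \<ge> m"
      then show "nm (x - u m) \<le> nm (u n - x) + (3/2) * (1 / 3 ^ m)"
        using tail[of m "n - m"] norm_triangle_via[OF x(1) uV[of n] uV[of m]]
          norm_minus_commute[OF x(1) uV, of n] by simp
    qed
  qed
  have low: "cmod (ip x (y n)) \<ge> (1/2) * (4/3) ^ n" for n
  proof -
    have "cmod (ip (x - u (Suc n)) (y n)) \<le> (3/2) * (1 / 3 ^ Suc n) * nm (y n)"
      using Cauchy_Schwarz[of "x - u (Suc n)" "y n"] tail'[of "Suc n"] x uV yV y0[of n]
      by (meson diff_mem less_imp_le mult_right_mono order_trans)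
    moreover have "cmod (ip (u (Suc n)) (y n)) \<le> cmod (ip x (y n)) + cmod (ip (x - u (Suc n)) (y n))"
      using norm_triangle_ineq4[of "ip x (y n)" "ip (x - u (Suc n)) (y n)"] x uV yV
      by (simp add: diff_left)
    moreover have "(3/2) * (1 / 3 ^ Suc n) * nm (y n) = (1/2) * (nm (y n) / 3 ^ n)"
      by simp
    ultimately have "cmod (ip x (y n)) \<ge> (1/2) * (nm (y n) / 3 ^ n)"
      using hump[of n] by linarith
    moreover have "nm (y n) / 3 ^ n \<ge> 4 ^ n / 3 ^ n"
      using y(2)[of n] by (intro divide_right_mono) auto
    ultimately show ?thesis by (simp add: power_divide)
  qed
  obtain C where C: "\<And>n. cmod (ip x (y n)) \<le> C" using wb[OF x(1)] y by blast
  obtain n where "2 * C < (4/3) ^ n" using real_arch_pow[of "4/3" "2 * C"] by auto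
  then show False using low[of n] C[of n] by linarith
qed

end

section \<open>Krein spaces\<close>

lemma carrier_khilbert [simp]: "hcarrier (khilbert K) = kcarrier K"
  and inner_khilbert [simp]: "hinner (khilbert K) = kinner K"
  by (simp_all add: khilbert_def)

locale krein =
  fixes K :: "'a::complex_vector krein"
  assumes krein: "krein_space K"
begin

abbreviation "V \<equiv> kcarrier K"
abbreviation "form \<equiv> kform K"
abbreviation "pp \<equiv> kproj_pos K"
abbreviation "pn \<equiv> kproj_neg K"
abbreviation "J \<equiv> ksym K"
abbreviation "nrm \<equiv> hnorm (khilbert K)"

sublocale F: hermitian_space V form
  using krein by unfold_locales (auto simp: krein_space_def)

lemma hilbert_pos: "hilbert_space \<lparr>hcarrier = kpos K, hinner = form\<rparr>"
  and hilbert_neg: "hilbert_space \<lparr>hcarrier = kneg K, hinner = (\<lambda>x y. - form x y)\<rparr>"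
  using krein by (auto simp: krein_space_def)

sublocale P: hilbert "\<lparr>hcarrier = kpos K, hinner = form\<rparr>"
  rewrites "hcarrier \<lparr>hcarrier = kpos K, hinner = form\<rparr> = kpos K"
    and "hinner \<lparr>hcarrier = kpos K, hinner = form\<rparr> = form"
  using hilbert_pos by unfold_locales simp_all

sublocale N: hilbert "\<lparr>hcarrier = kneg K, hinner = (\<lambda>x y. - form x y)\<rparr>"
  rewrites "hcarrier \<lparr>hcarrier = kneg K, hinner = (\<lambda>x y. - form x y)\<rparr> = kneg K"
    and "hinner \<lparr>hcarrier = kneg K, hinner = (\<lambda>x y. - form x y)\<rparr> = (\<lambda>x y. - form x y)"
  using hilbert_neg by unfold_locales simp_all

lemma carrier_eq: "V = {x + y |x y. x \<in> kpos K \<and> y \<in> kneg K}"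
  using krein by (simp add: krein_space_def)

lemma kpos_mem: "x \<in> kpos K \<Longrightarrow> x \<in> V"
  unfolding carrier_eq using N.zero_mem by force

lemma kneg_mem: "x \<in> kneg K \<Longrightarrow> x \<in> V"
  unfolding carrier_eq using P.zero_mem by force

lemma kpos_kneg_eq_0: "x \<in> kpos K \<Longrightarrow> x \<in> kneg K \<Longrightarrow> x = 0"
  using krein by (auto simp: krein_space_def)

lemma orth_pn: "x \<in> kpos K \<Longrightarrow> y \<in> kneg K \<Longrightarrow> form x y = 0"
  using krein by (auto simp: krein_space_def)

lemma orth_np: "x \<in> kpos K \<Longrightarrow> y \<in> kneg K \<Longrightarrow> form y x = 0"
  using F.sym[of x y] orth_pn[of x y] by (simp add: kpos_mem kneg_mem)

lemma proj_unique:
  assumes "p \<in> kpos K" "n \<in> kneg K"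
  shows "pp (p + n) = p" "pn (p + n) = n"
proof -
  have *: "p' = p \<and> n' = n"
    if "p' \<in> kpos K" "n' \<in> kneg K" "p + n = p' + n'" for p' n'
  proof -
    have "p' - p = n - n'" using that(3) by (simp add: algebra_simps)
    moreover have "p' - p \<in> kpos K" "n - n' \<in> kneg K"
      using that assms by (simp_all add: P.diff_mem N.diff_mem)
    ultimately have "p' - p = 0" by (metis kpos_kneg_eq_0)
    then show ?thesis using that(3) by simp
  qed
  show "pp (p + n) = p"
    unfolding kproj_pos_def
  proof (rule the_equality)
    show "p \<in> kpos K \<and> p + n - p \<in> kneg K" using assms by simp
    show "y = p" if "y \<in> kpos K \<and> p + n - y \<in> kneg K" for y
    proof -
      have "p + n = y + (p + n - y)" by simp
      with that show ?thesis using * by blast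
    qed
  qed
  show "pn (p + n) = n"
    unfolding kproj_neg_def
  proof (rule the_equality)
    show "n \<in> kneg K \<and> p + n - n \<in> kpos K" using assms by simp
    show "y = n" if "y \<in> kneg K \<and> p + n - y \<in> kpos K" for y
    proof -
      have "p + n = (p + n - y) + y" by simp
      with that show ?thesis using * by blast
    qed
  qed
qed

lemma pp_mem: "x \<in> V \<Longrightarrow> pp x \<in> kpos K"
  and pn_mem: "x \<in> V \<Longrightarrow> pn x \<in> kneg K"
  and proj_sum: "x \<in> V \<Longrightarrow> pp x + pn x = x"
  using proj_unique by (auto simp: carrier_eq)

lemma pp_mem': "x \<in> V \<Longrightarrow> pp x \<in> V" and pn_mem': "x \<in> V \<Longrightarrow> pn x \<in> V"
  by (simp_all add: pp_mem pn_mem kpos_mem kneg_mem)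

lemma pp_add: "x \<in> V \<Longrightarrow> y \<in> V \<Longrightarrow> pp (x + y) = pp x + pp y"
  and pn_add: "x \<in> V \<Longrightarrow> y \<in> V \<Longrightarrow> pn (x + y) = pn x + pn y"
proof -
  assume xy: "x \<in> V" "y \<in> V"
  have "(pp x + pp y) + (pn x + pn y) = (pp x + pn x) + (pp y + pn y)"
    by (simp add: algebra_simps)
  then have "x + y = (pp x + pp y) + (pn x + pn y)"
    using xy by (simp add: proj_sum)
  moreover have *: "pp x + pp y \<in> kpos K" "pn x + pn y \<in> kneg K"
    using xy by (simp_all add: pp_mem pn_mem P.add_mem N.add_mem)
  ultimately show "pp (x + y) = pp x + pp y" "pn (x + y) = pn x + pn y"
    using proj_unique[OF *] by simp_all
qed

lemma pp_scale: "x \<in> V \<Longrightarrow> pp (a *\<^sub>C x) = a *\<^sub>C pp x"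
  and pn_scale: "x \<in> V \<Longrightarrow> pn (a *\<^sub>C x) = a *\<^sub>C pn x"
proof -
  assume "x \<in> V"
  then have "a *\<^sub>C x = a *\<^sub>C pp x + a *\<^sub>C pn x"
    and *: "a *\<^sub>C pp x \<in> kpos K" "a *\<^sub>C pn x \<in> kneg K"
    using proj_sum[of x] scaleC_add_right[of a "pp x" "pn x"]
    by (simp_all add: pp_mem pn_mem P.scale_mem N.scale_mem)
  then show "pp (a *\<^sub>C x) = a *\<^sub>C pp x" "pn (a *\<^sub>C x) = a *\<^sub>C pn x"
    using proj_unique[OF *] by simp_all
qed

lemma J_mem: "x \<in> V \<Longrightarrow> J x \<in> V"
  by (simp add: ksym_def F.mem pp_mem' pn_mem')

lemma pp_J: "x \<in> V \<Longrightarrow> pp (J x) = pp x" and pn_J: "x \<in> V \<Longrightarrow> pn (J x) = - pn x"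
  using proj_unique[of "pp x" "- pn x"] by (simp_all add: ksym_def pp_mem pn_mem N.neg_mem)

lemma J_J: "x \<in> V \<Longrightarrow> J (J x) = x"
  unfolding ksym_def[of K "J x"] by (simp add: pp_J pn_J proj_sum)

lemma form_split:
  assumes "x \<in> V" "y \<in> V"
  shows "form x y = form (pp x) (pp y) + form (pn x) (pn y)"
proof -
  have "form x y = form (pp x + pn x) (pp y + pn y)" using assms by (simp add: proj_sum)
  also have "\<dots> = form (pp x) (pp y) + form (pn x) (pn y)"
    using assms by (simp add: F.expand F.mem pp_mem' pn_mem' orth_pn orth_np pp_mem pn_mem)
  finally show ?thesis .
qed

lemma kinner_J_left: "x \<in> V \<Longrightarrow> y \<in> V \<Longrightarrow> kinner K (J x) y = form x y"
  by (simp add: kinner_def form_split[of x y] pp_J pn_J F.expand pn_mem')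

lemma kinner_J_right: "x \<in> V \<Longrightarrow> y \<in> V \<Longrightarrow> kinner K x (J y) = form x y"
  by (simp add: kinner_def form_split[of x y] pp_J pn_J F.expand pn_mem')

lemma form_J_right: "x \<in> V \<Longrightarrow> y \<in> V \<Longrightarrow> form x (J y) = kinner K x y"
  using kinner_J_right[of x "J y"] by (simp add: J_mem J_J)

lemma form_J_left: "x \<in> V \<Longrightarrow> y \<in> V \<Longrightarrow> form (J x) y = kinner K x y"
  using kinner_J_left[of "J x" y] by (simp add: J_mem J_J)

lemma hermitian_kinner: "hermitian_form V (kinner K)"
  unfolding hermitian_form_def
proof (intro conjI ballI allI)
  fix x y assume "x \<in> V" "y \<in> V"
  then show "kinner K y x = cnj (kinner K x y)"
    using F.sym[of "pp x" "pp y"] F.sym[of "pn x" "pn y"] by (simp add: kinner_def pp_mem' pn_mem')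
qed (simp_all add: kinner_def pp_add pn_add pp_scale pn_scale F.expand F.mem pp_mem' pn_mem'
    right_diff_distrib)

lemma kinner_self: "x \<in> V \<Longrightarrow> Re (kinner K x x) =
    (hnorm \<lparr>hcarrier = kpos K, hinner = form\<rparr> (pp x))\<^sup>2 +
    (hnorm \<lparr>hcarrier = kneg K, hinner = (\<lambda>x y. - form x y)\<rparr> (pn x))\<^sup>2"
  using P.norm_sq[of "pp x"] N.norm_sq[of "pn x"] by (simp add: kinner_def pp_mem pn_mem)

text \<open>The squared norm is the sum of the squared norms of the two components, so a Cauchy
  sequence has Cauchy components, whose limits in \<open>kpos K\<close> and \<open>kneg K\<close>
  add up to its limit.\<close>

lemma hilbert_khilbert: "hilbert_space (khilbert K)"
  unfolding hilbert_space_def carrier_khilbert inner_khilbert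
proof (intro conjI ballI impI allI)
  show "complex_vector.subspace V" by (rule F.sub)
  show "hermitian_form V (kinner K)" by (rule hermitian_kinner)
  let ?np = "hnorm \<lparr>hcarrier = kpos K, hinner = form\<rparr>"
  let ?nn = "hnorm \<lparr>hcarrier = kneg K, hinner = (\<lambda>x y. - form x y)\<rparr>"
  have nrm: "nrm x = sqrt ((?np (pp x))\<^sup>2 + (?nn (pn x))\<^sup>2)" if "x \<in> V" for x
    using kinner_self[OF that] by (simp add: hnorm_def[of "khilbert K"])
  show "0 < Re (kinner K x x)" if "x \<in> V" "x \<noteq> 0" for x
  proof -
    have "pp x \<noteq> 0 \<or> pn x \<noteq> 0" using proj_sum[OF that(1)] that(2) by auto
    then have "?np (pp x) \<noteq> 0 \<or> ?nn (pn x) \<noteq> 0"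
      using P.norm_eq_0 N.norm_eq_0 pp_mem pn_mem that(1) by blast
    then show ?thesis
      unfolding kinner_self[OF that(1)] by (simp add: sum_power2_gt_zero_iff)
  qed
  fix u :: "nat \<Rightarrow> 'a"
  assume u: "range u \<subseteq> V" and Cauchy: "\<forall>e>0. \<exists>N. \<forall>m\<ge>N. \<forall>n\<ge>N. nrm (u m - u n) < e"
  have uV: "u n \<in> V" for n using u by auto
  have sub: "pp (x - y) = pp x - pp y" "pn (x - y) = pn x - pn y" if "x \<in> V" "y \<in> V" for x y
    using that pp_add[of x "- y"] pp_scale[of y "-1"] pn_add[of x "- y"] pn_scale[of y "-1"]
    by (simp_all add: F.mem)
  have le: "?np (pp x) \<le> nrm x" "?nn (pn x) \<le> nrm x" if "x \<in> V" for x
    using P.norm_ge_0[of "pp x"] N.norm_ge_0[of "pn x"] pp_mem[OF that] pn_mem[OF that]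
    by (auto simp: nrm[OF that] intro!: real_le_rsqrt)
  have "\<exists>N. \<forall>m\<ge>N. \<forall>n\<ge>N. ?np (pp (u m) - pp (u n)) < e" if e: "e > 0" for e
  proof -
    obtain N where "\<And>m n. m \<ge> N \<Longrightarrow> n \<ge> N \<Longrightarrow> nrm (u m - u n) < e"
      using Cauchy[rule_format, OF e] by blast
    moreover have "?np (pp (u m) - pp (u n)) \<le> nrm (u m - u n)" for m n
      using le(1)[of "u m - u n"] uV by (simp add: sub F.diff_mem)
    ultimately show ?thesis by (meson order_le_less_trans)
  qed
  then obtain p where p: "p \<in> kpos K" "(\<lambda>n. ?np (pp (u n) - p)) \<longlonglongrightarrow> 0"
    using P.complete[of "\<lambda>n. pp (u n)"] uV pp_mem by blast
  have "\<exists>N. \<forall>m\<ge>N. \<forall>n\<ge>N. ?nn (pn (u m) - pn (u n)) < e" if e: "e > 0" for e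
  proof -
    obtain N where "\<And>m n. m \<ge> N \<Longrightarrow> n \<ge> N \<Longrightarrow> nrm (u m - u n) < e"
      using Cauchy[rule_format, OF e] by blast
    moreover have "?nn (pn (u m) - pn (u n)) \<le> nrm (u m - u n)" for m n
      using le(2)[of "u m - u n"] uV by (simp add: sub F.diff_mem)
    ultimately show ?thesis by (meson order_le_less_trans)
  qed
  then obtain q where q: "q \<in> kneg K" "(\<lambda>n. ?nn (pn (u n) - q)) \<longlonglongrightarrow> 0"
    using N.complete[of "\<lambda>n. pn (u n)"] uV pn_mem by blast
  have pq: "p + q \<in> V" using p q by (simp add: F.mem kpos_mem kneg_mem)
  have "nrm (u n - (p + q)) = sqrt ((?np (pp (u n) - p))\<^sup>2 + (?nn (pn (u n) - q))\<^sup>2)" for n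
    using nrm[of "u n - (p + q)"] sub[OF uV pq, of n] proj_unique[OF p(1) q(1)] uV[of n] pq
    by (simp add: F.mem)
  moreover have "(\<lambda>n. sqrt ((?np (pp (u n) - p))\<^sup>2 + (?nn (pn (u n) - q))\<^sup>2)) \<longlonglongrightarrow> sqrt (0\<^sup>2 + 0\<^sup>2)"
    by (intro tendsto_intros p q)
  ultimately have "(\<lambda>n. nrm (u n - (p + q))) \<longlonglongrightarrow> 0" by simp
  then show "\<exists>l\<in>V. (\<lambda>n. nrm (u n - l)) \<longlonglongrightarrow> 0" using pq by blast
qed

sublocale H: hilbert "khilbert K"
  rewrites "hcarrier (khilbert K) = V" and "hinner (khilbert K) = kinner K"
  using hilbert_khilbert by unfold_locales simp_all

lemma nrm_J: "x \<in> V \<Longrightarrow> nrm (J x) = nrm x"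
  using F.neg_left F.neg_right
  by (simp add: hnorm_def kinner_def pp_J pn_J pn_mem' F.neg_mem)

text \<open>\<open>J\<close> is isometric and turns \<open>form\<close> into \<open>kinner\<close>,
  so this is Cauchy-Schwarz.\<close>

lemma form_le: "x \<in> V \<Longrightarrow> y \<in> V \<Longrightarrow> cmod (form x y) \<le> nrm x * nrm y"
  using H.Cauchy_Schwarz[of "J x" y] by (simp add: kinner_J_left J_mem nrm_J)

text \<open>Nondegeneracy: the test vector \<open>J x\<close> returns the squared norm of
  \<open>x\<close>.\<close>

lemma eq_0I:
  assumes "x \<in> V" "\<And>y. y \<in> V \<Longrightarrow> form x y = 0"
  shows "x = 0"
  using assms(2)[of "J x"] assms(1) H.norm_eq_0[of x]
  by (simp add: J_mem form_J_right hnorm_def)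

lemma form_tendsto:
  assumes "x \<in> V" "\<And>n. u n \<in> V" "(\<lambda>n::nat. nrm (u n - x)) \<longlonglongrightarrow> 0"
  shows "(\<lambda>n. form (u n) (u n)) \<longlonglongrightarrow> form x x"
proof -
  have "(\<lambda>n. nrm (u n - x) * (nrm (u n) + nrm x)) \<longlonglongrightarrow> 0 * (nrm x + nrm x)"
    using H.tendsto_norm[OF assms] by (intro tendsto_intros assms(3))
  then have lim: "(\<lambda>n. nrm (u n - x) * (nrm (u n) + nrm x)) \<longlonglongrightarrow> 0" by simp
  have "cmod (form (u n) (u n) - form x x) \<le> nrm (u n - x) * (nrm (u n) + nrm x)" for n
  proof -
    have "form (u n) (u n) - form x x = form (u n) (u n - x) + form (u n - x) x"
      using assms by (simp add: F.expand)
    also have "cmod \<dots> \<le> nrm (u n) * nrm (u n - x) + nrm (u n - x) * nrm x"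
      using assms form_le by (intro norm_triangle_mono) (auto simp: F.mem)
    finally show ?thesis by (simp add: algebra_simps)
  qed
  then have "(\<lambda>n. form (u n) (u n) - form x x) \<longlonglongrightarrow> 0"
    by (intro tendsto_0_le[where K = 1, OF lim]) (auto intro!: always_eventually
        intro: order_trans[OF _ abs_ge_self])
  then show ?thesis by (simp add: LIM_zero_cancel)
qed

section \<open>Maximal uniformly positive subspaces\<close>

text \<open>Maximality in usable form: only extensions of \<open>M\<close> by one vector have to be
  tested. The constant \<open>\<beta>\<close> may be smaller than the one that belongs to
  \<open>M\<close>.\<close>

lemma maximal_pos_extend:
  assumes M: "maximal_wrt (unif_j_positive K) M" and x: "x \<in> V" and \<beta>: "\<beta> > 0"
    and pos: "\<And>m a. m \<in> M \<Longrightarrow> Re (form (m + a *\<^sub>C x) (m + a *\<^sub>C x)) \<ge> \<beta> * (nrm (m + a *\<^sub>C x))\<^sup>2"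
  shows "x \<in> M"
proof -
  let ?W = "{m + a *\<^sub>C x |m a. m \<in> M}"
  have M': "complex_vector.subspace M" "M \<subseteq> V"
    using M by (auto simp: maximal_wrt_def unif_j_positive_def)
  interpret M: hermitian_space M form
    using M' F.herm by unfold_locales (auto intro: hermitian_form_subset)
  have "complex_vector.subspace ?W"
  proof (rule complex_vector.subspaceI)
    show "0 \<in> ?W" using M.zero_mem by (force intro: exI[of _ 0])
    show "y + z \<in> ?W" if yz: "y \<in> ?W" "z \<in> ?W" for y z
    proof -
      obtain m a n b where "y = m + a *\<^sub>C x" "z = n + b *\<^sub>C x" "m \<in> M" "n \<in> M" using yz by blast
      then have "y + z = (m + n) + (a + b) *\<^sub>C x" "m + n \<in> M"
        by (simp_all add: scaleC_add_left M.mem algebra_simps)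
      then show ?thesis by blast
    qed
    show "c *\<^sub>C y \<in> ?W" if y: "y \<in> ?W" for c y
    proof -
      obtain m a where "y = m + a *\<^sub>C x" "m \<in> M" using y by blast
      then have "c *\<^sub>C y = c *\<^sub>C m + (c * a) *\<^sub>C x" "c *\<^sub>C m \<in> M"
        by (simp_all add: scaleC_add_right scaleC_scaleC M.mem)
      then show ?thesis by blast
    qed
  qed
  moreover have "?W \<subseteq> V" using M' x by (auto simp: F.mem)
  ultimately have "unif_j_positive K ?W"
    unfolding unif_j_positive_def using \<beta> pos by blast
  moreover have "M \<subseteq> ?W" by (force intro: exI[of _ 0])
  ultimately have "?W = M" using M by (auto simp: maximal_wrt_def)
  moreover have "x \<in> ?W" using M.zero_mem scaleC_one[of x] by (force intro: exI[of _ 1])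
  ultimately show ?thesis by simp
qed

text \<open>A limit \<open>l\<close> can be adjoined with the constant of \<open>M\<close> itself:
  \<open>m + a l\<close> is the limit of the vectors \<open>m + a u n\<close> of \<open>M\<close>,
  and both sides of the bound are continuous.\<close>

lemma maximal_pos_closed:
  assumes M: "maximal_wrt (unif_j_positive K) M"
    and u: "\<And>n::nat. u n \<in> M" and l: "l \<in> V" "(\<lambda>n. nrm (u n - l)) \<longlonglongrightarrow> 0"
  shows "l \<in> M"
proof -
  have M': "complex_vector.subspace M" "M \<subseteq> V"
    using M by (auto simp: maximal_wrt_def unif_j_positive_def)
  obtain \<alpha> where \<alpha>: "\<alpha> > 0" "\<And>x. x \<in> M \<Longrightarrow> Re (form x x) \<ge> \<alpha> * (nrm x)\<^sup>2"
    using M by (auto simp: maximal_wrt_def unif_j_positive_def)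
  interpret M: hermitian_space M form
    using M' F.herm by unfold_locales (auto intro: hermitian_form_subset)
  show ?thesis
  proof (rule maximal_pos_extend[OF M l(1) \<alpha>(1)])
    fix m a assume m: "m \<in> M"
    define v where "v n = m + a *\<^sub>C u n" for n
    let ?w = "m + a *\<^sub>C l"
    have uV: "u n \<in> V" and mV: "m \<in> V" for n using u m M' by auto
    have v: "v n \<in> M" for n unfolding v_def using m u by (simp add: M.mem)
    then have vV: "v n \<in> V" for n using M' by auto
    have w: "?w \<in> V" using mV l by (simp add: F.mem)
    have "nrm (v n - ?w) = cmod a * nrm (u n - l)" for n
    proof -
      have "v n - ?w = a *\<^sub>C (u n - l)"
        by (simp add: v_def complex_vector.scale_right_diff_distrib)
      then show ?thesis using uV l by (simp add: H.norm_scale F.mem)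
    qed
    moreover have "(\<lambda>n. cmod a * nrm (u n - l)) \<longlonglongrightarrow> cmod a * 0"
      by (intro tendsto_intros l)
    ultimately have lim: "(\<lambda>n. nrm (v n - ?w)) \<longlonglongrightarrow> 0" by simp
    show "Re (form ?w ?w) \<ge> \<alpha> * (nrm ?w)\<^sup>2"
    proof (rule LIMSEQ_le)
      show "(\<lambda>n. Re (form (v n) (v n))) \<longlonglongrightarrow> Re (form ?w ?w)"
        by (intro tendsto_intros form_tendsto w vV lim)
      show "(\<lambda>n. \<alpha> * (nrm (v n))\<^sup>2) \<longlonglongrightarrow> \<alpha> * (nrm ?w)\<^sup>2"
        by (intro tendsto_intros H.tendsto_norm w vV lim)
      show "\<exists>N. \<forall>n\<ge>N. \<alpha> * (nrm (v n))\<^sup>2 \<le> Re (form (v n) (v n))"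
        using \<alpha>(2)[OF v] by blast
    qed
  qed
qed

text \<open>If \<open>\<alpha>\<close> is the constant of \<open>M\<close>, then \<open>z + \<alpha> J z\<close> can be added to \<open>M\<close>, so by maximality it lies in
  \<open>M\<close> and is orthogonal to \<open>z\<close>.\<close>

lemma maximal_pos_orthogonal:
  assumes M: "maximal_wrt (unif_j_positive K) M"
    and z: "z \<in> V" "\<And>m. m \<in> M \<Longrightarrow> form m z = 0" "Re (form z z) \<ge> 0"
  shows "z = 0"
proof -
  have M': "complex_vector.subspace M" "M \<subseteq> V"
    using M by (auto simp: maximal_wrt_def unif_j_positive_def)
  obtain \<alpha> where \<alpha>: "\<alpha> > 0" "\<And>x. x \<in> M \<Longrightarrow> Re (form x x) \<ge> \<alpha> * (nrm x)\<^sup>2"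
    using M by (auto simp: maximal_wrt_def unif_j_positive_def)
  \<comment> \<open>With \<open>s = ||m||\<close> and \<open>t = |a| ||z||\<close>, the coefficient
    \<alpha> makes the cross term at most \<open>2 \<alpha> s t\<close>, against
    \<open>\<alpha> s^2\<close> from \<open>m\<close> and \<open>2 \<alpha> t^2\<close> from
    \<open>y\<close>. The resulting form \<open>s^2 - 2 s t + 2 t^2\<close> is positive
    definite.\<close>
  define y where "y = z + of_real \<alpha> *\<^sub>C J z"
  have Jz: "J z \<in> V" using z by (simp add: J_mem)
  have y: "y \<in> V" unfolding y_def using z Jz by (simp add: F.mem)
  have zz: "form z (J z) = of_real ((nrm z)\<^sup>2)" "form (J z) z = of_real ((nrm z)\<^sup>2)"
    "form (J z) (J z) = form z z"
    using z Jz H.ip_self[of z] by (simp_all add: form_J_right form_J_left kinner_J_left)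
  have yy: "Re (form y y) \<ge> 2 * \<alpha> * (nrm z)\<^sup>2"
  proof -
    have "Re (form y y) = (1 + \<alpha>\<^sup>2) * Re (form z z) + 2 * \<alpha> * (nrm z)\<^sup>2"
      unfolding y_def using z Jz
      by (simp add: F.expand F.mem zz power2_eq_square algebra_simps)
    then show ?thesis using z(3) by simp
  qed
  have ny: "nrm y \<le> (1 + \<alpha>) * nrm z"
    using H.norm_triangle[of z "of_real \<alpha> *\<^sub>C J z"] z Jz \<alpha>(1)
    unfolding y_def by (simp add: F.mem H.norm_scale nrm_J algebra_simps)
  have "y \<in> M"
  proof (rule maximal_pos_extend[OF M y])
    \<comment> \<open>The form at \<open>m + a y\<close> is at least
      \<open>\<alpha> (s^2 + t^2) / 4\<close>, and the squared norm is at most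
      \<open>2 (1 + \<alpha>)^2 (s^2 + t^2)\<close>; the constant is the quotient.\<close>
    show "\<alpha> / (8 * (1 + \<alpha>)\<^sup>2) > 0" using \<alpha>(1) by simp
    fix m a assume m: "m \<in> M"
    have mV: "m \<in> V" using m M' by auto
    let ?w = "m + a *\<^sub>C y"
    define s where "s = nrm m"
    define t where "t = cmod a * nrm z"
    have s0: "s \<ge> 0" using mV by (simp add: s_def H.norm_ge_0)
    have my: "form m y = of_real \<alpha> * kinner K m z"
      unfolding y_def using mV z m Jz by (simp add: F.expand F.mem form_J_right)
    have cross: "cmod (cnj a * form m y) \<le> \<alpha> * (s * t)"
    proof -
      have "cmod (cnj a * form m y) = \<alpha> * cmod a * cmod (kinner K m z)"
        using \<alpha>(1) by (simp add: my norm_mult)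
      also have "\<dots> \<le> \<alpha> * cmod a * (nrm m * nrm z)"
        using H.Cauchy_Schwarz[OF mV z(1)] \<alpha>(1) by (intro mult_left_mono) auto
      finally show ?thesis by (simp add: s_def t_def mult_ac)
    qed
    have "Re (form ?w ?w) = Re (form m m) + 2 * Re (cnj a * form m y) + (cmod a)\<^sup>2 * Re (form y y)"
    proof -
      have "form ?w ?w = form m m + (cnj a * form m y + cnj (cnj a * form m y)) + (a * cnj a) * form y y"
        using mV y F.sym[OF mV y] by (simp add: F.expand F.mem algebra_simps)
      then show ?thesis
        by (simp only: complex_norm_square[symmetric] complex_add_cnj) simp
    qed
    moreover have "Re (form m m) \<ge> \<alpha> * s\<^sup>2" using \<alpha>(2)[OF m] by (simp add: s_def)
    moreover have "Re (cnj a * form m y) \<ge> - (\<alpha> * (s * t))"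
      using cross abs_Re_le_cmod[of "cnj a * form m y"] by linarith
    moreover have "(cmod a)\<^sup>2 * Re (form y y) \<ge> (cmod a)\<^sup>2 * (2 * \<alpha> * (nrm z)\<^sup>2)"
      using yy by (intro mult_left_mono) auto
    ultimately have "Re (form ?w ?w) \<ge> \<alpha> * s\<^sup>2 - 2 * (\<alpha> * (s * t)) + \<alpha> * (2 * t\<^sup>2)"
      by (simp add: t_def power_mult_distrib mult_ac)
    also have "\<alpha> * s\<^sup>2 - 2 * (\<alpha> * (s * t)) + \<alpha> * (2 * t\<^sup>2) = \<alpha> * (s\<^sup>2 - 2 * (s * t) + 2 * t\<^sup>2)"
      by (simp add: algebra_simps)
    finally have 1: "Re (form ?w ?w) \<ge> \<alpha> * (s\<^sup>2 - 2 * (s * t) + 2 * t\<^sup>2)" .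
    \<comment> \<open>Completing the square shows that a quarter of \<open>s^2 + t^2\<close> can be
      spared.\<close>
    have "s\<^sup>2 - 2 * (s * t) + 2 * t\<^sup>2 - (s\<^sup>2 + t\<^sup>2) / 4 = 3/4 * (s - 4/3 * t)\<^sup>2 + 5/12 * t\<^sup>2"
      by (simp add: power2_eq_square field_simps)
    also have "\<dots> \<ge> 0" by (intro add_nonneg_nonneg mult_nonneg_nonneg) auto
    finally have 2: "s\<^sup>2 - 2 * (s * t) + 2 * t\<^sup>2 \<ge> (s\<^sup>2 + t\<^sup>2) / 4" by simp
    have "nrm ?w \<le> s + cmod a * nrm y"
      using H.norm_triangle[of m "a *\<^sub>C y"] mV y by (simp add: H.norm_scale F.mem s_def)
    also have "cmod a * nrm y \<le> cmod a * ((1 + \<alpha>) * nrm z)"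
      using ny by (intro mult_left_mono) auto
    also have "s + cmod a * ((1 + \<alpha>) * nrm z) \<le> (1 + \<alpha>) * (s + t)"
      using s0 \<alpha>(1) by (simp add: t_def algebra_simps)
    finally have "(nrm ?w)\<^sup>2 \<le> ((1 + \<alpha>) * (s + t))\<^sup>2"
      using mV y by (intro power_mono) (auto simp: H.norm_ge_0 F.mem)
    also have "\<dots> \<le> (1 + \<alpha>)\<^sup>2 * (2 * (s\<^sup>2 + t\<^sup>2))"
      unfolding power_mult_distrib
      using sum_squares_bound[of s t] by (intro mult_left_mono zero_le_power2) (simp add: power2_sum)
    finally have 3: "(nrm ?w)\<^sup>2 \<le> (1 + \<alpha>)\<^sup>2 * (2 * (s\<^sup>2 + t\<^sup>2))" .
    have "\<alpha> / (8 * (1 + \<alpha>)\<^sup>2) * (nrm ?w)\<^sup>2 \<le> \<alpha> / (8 * (1 + \<alpha>)\<^sup>2) * ((1 + \<alpha>)\<^sup>2 * (2 * (s\<^sup>2 + t\<^sup>2)))"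
      using 3 \<alpha>(1) by (intro mult_left_mono) auto
    also have "\<dots> = \<alpha> * ((s\<^sup>2 + t\<^sup>2) / 4)"
      using \<alpha>(1) by (simp add: field_simps)
    also have "\<dots> \<le> \<alpha> * (s\<^sup>2 - 2 * (s * t) + 2 * t\<^sup>2)"
      using 2 \<alpha>(1) by (intro mult_left_mono) auto
    finally show "\<alpha> / (8 * (1 + \<alpha>)\<^sup>2) * (nrm ?w)\<^sup>2 \<le> Re (form ?w ?w)"
      using 1 by linarith
  qed
  then have "form y z = 0" by (rule z(2))
  then have "Re (form z z + of_real (\<alpha> * (nrm z)\<^sup>2)) = 0"
    unfolding y_def using z Jz zz by (simp add: F.expand F.mem)
  then have "Re (form z z) + \<alpha> * (nrm z)\<^sup>2 = 0"
    by (simp only: plus_complex.sel Re_complex_of_real)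
  moreover have "\<alpha> * (nrm z)\<^sup>2 \<ge> 0" using \<alpha>(1) by simp
  ultimately have "\<alpha> * (nrm z)\<^sup>2 = 0" using z(3) by linarith
  then show ?thesis using \<alpha>(1) z(1) by (simp add: H.norm_eq_0)
qed

end

section \<open>The anti-space\<close>

text \<open>Its Hilbert space structure, and with it every norm, limit and bound, is that of
  \<open>K\<close>, while uniformly negative subspaces become uniformly positive. Results about
  \<open>Mp\<close> thus apply verbatim to \<open>Mm\<close>.\<close>

definition anti_krein :: "'a krein \<Rightarrow> 'a::complex_vector krein"
  where "anti_krein K =
    \<lparr>kcarrier = kcarrier K, kform = (\<lambda>x y. - kform K x y), kpos = kneg K, kneg = kpos K\<rparr>"

lemma anti_krein_simps [simp]:
  "kcarrier (anti_krein K) = kcarrier K" "kform (anti_krein K) = (\<lambda>x y. - kform K x y)"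
  "kpos (anti_krein K) = kneg K" "kneg (anti_krein K) = kpos K"
  by (simp_all add: anti_krein_def)

lemma anti_anti_krein [simp]: "anti_krein (anti_krein K) = K"
  by (cases K) (simp add: anti_krein_def)

lemma khilbert_anti_krein [simp]: "khilbert (anti_krein K) = khilbert K"
  by (auto simp: khilbert_def kinner_def kproj_pos_def kproj_neg_def fun_eq_iff)

lemma krein_anti_krein: "krein K \<Longrightarrow> krein (anti_krein K)"
proof -
  assume "krein K"
  then interpret krein K .
  have "hermitian_form V (\<lambda>x y. - form x y)"
    unfolding hermitian_form_def
    by (intro conjI ballI allI) (simp_all add: F.expand F.mem, metis F.sym)
  moreover have "V = {x + y |x y. x \<in> kneg K \<and> y \<in> kpos K}"
    unfolding carrier_eq by (force simp: add.commute)
  ultimately show ?thesis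
    using krein hilbert_pos hilbert_neg
    by unfold_locales (auto simp: krein_space_def orth_np Int_commute)
qed

lemma unif_j_positive_anti_krein: "unif_j_positive (anti_krein K) = unif_j_negative K"
proof -
  have "\<alpha> * (hnorm (khilbert K) x)\<^sup>2 \<le> - Re (kform K x x) \<longleftrightarrow>
    Re (kform K x x) \<le> - \<alpha> * (hnorm (khilbert K) x)\<^sup>2" for \<alpha> x by auto
  then show ?thesis
    by (simp only: fun_eq_iff unif_j_positive_def unif_j_negative_def anti_krein_simps
        khilbert_anti_krein uminus_complex.sel) simp
qed

section \<open>Square summable sequences\<close>

lemma ell2_mem: "c \<in> hcarrier (ell2 I) \<longleftrightarrow>
    (\<forall>i. i \<notin> I \<longrightarrow> c i = 0) \<and> (\<lambda>i. (cmod (c i))\<^sup>2) summable_on I"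
  by (simp add: ell2_def)

lemma ell2_inner: "hinner (ell2 I) c d = (\<Sum>\<^sub>\<infinity>i\<in>I. c i * cnj (d i))"
  by (simp add: ell2_def)

lemma ell2_norm: "hnorm (ell2 I) c = sqrt (\<Sum>\<^sub>\<infinity>i\<in>I. (cmod (c i))\<^sup>2)"
proof -
  have "(\<Sum>\<^sub>\<infinity>i\<in>I. c i * cnj (c i)) = (\<Sum>\<^sub>\<infinity>i\<in>I. of_real ((cmod (c i))\<^sup>2))"
    by (simp only: complex_norm_square)
  also have "\<dots> = of_real (\<Sum>\<^sub>\<infinity>i\<in>I. (cmod (c i))\<^sup>2)"
  proof (cases "(\<lambda>i. (cmod (c i))\<^sup>2) summable_on I")
    case True
    then show ?thesis by (intro infsumI has_sum_of_real has_sum_infsum)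
  next
    case False
    \<comment> \<open>Without summability both infinite sums take the default value 0, so the
      formula holds for every \<open>c\<close>.\<close>
    then have "\<not> (\<lambda>i. complex_of_real ((cmod (c i))\<^sup>2)) summable_on I"
      using summable_on_def has_sum_of_real_iff has_sum_Re Re_complex_of_real
      by (metis (mono_tags, lifting) has_sum_cong)
    with False show ?thesis by (simp add: infsum_not_exists)
  qed
  finally show ?thesis by (simp add: hnorm_def ell2_inner)
qed

lemma ell2_add:
  assumes "c \<in> hcarrier (ell2 I)" "d \<in> hcarrier (ell2 I)"
  shows "c + d \<in> hcarrier (ell2 I)"
proof -
  have "(\<lambda>i. 2 * (cmod (c i))\<^sup>2 + 2 * (cmod (d i))\<^sup>2) summable_on I"
    using assms by (intro summable_on_add summable_on_cmult_right) (auto simp: ell2_mem)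
  moreover have "(cmod (c i + d i))\<^sup>2 \<le> 2 * (cmod (c i))\<^sup>2 + 2 * (cmod (d i))\<^sup>2" for i
  proof -
    have "(cmod (c i + d i))\<^sup>2 \<le> (cmod (c i) + cmod (d i))\<^sup>2"
      by (intro power_mono norm_triangle_ineq) simp
    also have "\<dots> \<le> 2 * (cmod (c i))\<^sup>2 + 2 * (cmod (d i))\<^sup>2"
      using sum_squares_bound[of "cmod (c i)" "cmod (d i)"] by (simp add: power2_sum)
    finally show ?thesis .
  qed
  ultimately have "(\<lambda>i. (cmod (c i + d i))\<^sup>2) summable_on I"
    by (rule summable_on_comparison_test) auto
  then show ?thesis using assms by (auto simp: ell2_mem)
qed

lemma ell2_scale: "c \<in> hcarrier (ell2 I) \<Longrightarrow> a *\<^sub>C c \<in> hcarrier (ell2 I)"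
  by (auto simp: ell2_mem scaleC_fun_def scaleC_complex_def norm_mult power_mult_distrib
      intro: summable_on_cmult_right)

text \<open>Explicit form of the orthogonal projection of \<open>ell2 I\<close> onto
  \<open>ell2 D\<close>, as \<open>orth_proj_ell2\<close> confirms.\<close>

definition restr :: "'i set \<Rightarrow> ('i \<Rightarrow> complex) \<Rightarrow> 'i \<Rightarrow> complex"
  where "restr D c = (\<lambda>i. if i \<in> D then c i else 0)"

lemma ell2_dominated:
  assumes "c \<in> hcarrier (ell2 I)" "\<And>i. cmod (d i) \<le> cmod (c i)"
  shows "d \<in> hcarrier (ell2 I)"
proof -
  have "(\<lambda>i. (cmod (d i))\<^sup>2) summable_on I"
    by (rule summable_on_comparison_test[of "\<lambda>i. (cmod (c i))\<^sup>2"])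
      (use assms in \<open>auto simp: ell2_mem intro: power_mono\<close>)
  moreover have "d i = 0" if "i \<notin> I" for i using assms(1) assms(2)[of i] that by (auto simp: ell2_mem)
  ultimately show ?thesis by (simp add: ell2_mem)
qed

lemma restr_mem: "c \<in> hcarrier (ell2 I) \<Longrightarrow> restr D c \<in> hcarrier (ell2 I)"
  by (rule ell2_dominated) (auto simp: restr_def)

lemma ell2_subset_iff:
  assumes "D \<subseteq> I"
  shows "c \<in> hcarrier (ell2 D) \<longleftrightarrow> c \<in> hcarrier (ell2 I) \<and> (\<forall>i. i \<notin> D \<longrightarrow> c i = 0)"
proof -
  have "(\<lambda>i. (cmod (c i))\<^sup>2) summable_on D \<longleftrightarrow> (\<lambda>i. (cmod (c i))\<^sup>2) summable_on I"
    if "\<forall>i. i \<notin> D \<longrightarrow> c i = 0"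
    using assms that by (intro summable_on_cong_neutral) auto
  then show ?thesis using assms by (auto simp: ell2_mem)
qed

lemma unit_seq_mem: "i \<in> I \<Longrightarrow> unit_seq i \<in> hcarrier (ell2 I)"
proof -
  assume i: "i \<in> I"
  have "(\<lambda>j. (cmod (unit_seq i j))\<^sup>2) summable_on {i}" by simp
  then have "(\<lambda>j. (cmod (unit_seq i j))\<^sup>2) summable_on I"
    using i by (subst summable_on_cong_neutral[of "{i}"]) (auto simp: unit_seq_def)
  then show ?thesis using i by (auto simp: ell2_mem unit_seq_def)
qed

lemma ell2_inner_unit_left:
  assumes "i \<in> I"
  shows "hinner (ell2 I) (unit_seq i) d = cnj (d i)"
proof -
  have "(\<Sum>\<^sub>\<infinity>j\<in>I. unit_seq i j * cnj (d j)) = (\<Sum>\<^sub>\<infinity>j\<in>{i}. unit_seq i j * cnj (d j))"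
    using assms by (intro infsum_cong_neutral) (auto simp: unit_seq_def)
  then show ?thesis by (simp add: ell2_inner unit_seq_def)
qed

lemma ell2_inner_unit_right:
  assumes "i \<in> I"
  shows "hinner (ell2 I) d (unit_seq i) = d i"
proof -
  have "(\<Sum>\<^sub>\<infinity>j\<in>I. d j * cnj (unit_seq i j)) = (\<Sum>\<^sub>\<infinity>j\<in>{i}. d j * cnj (unit_seq i j))"
    using assms by (intro infsum_cong_neutral) (auto simp: unit_seq_def)
  then show ?thesis by (simp add: ell2_inner unit_seq_def)
qed

text \<open>Testing orthogonality against unit sequences recovers every coordinate in
  \<open>D\<close>, which settles the uniqueness behind the definite description.\<close>

lemma orth_proj_ell2:
  assumes D: "D \<subseteq> I" and c: "c \<in> hcarrier (ell2 I)"
  shows "orth_proj (ell2 I) (hcarrier (ell2 D)) c = restr D c"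
  unfolding orth_proj_def
proof (rule the_equality)
  have "hinner (ell2 I) (c - restr D c) z = 0" if "z \<in> hcarrier (ell2 D)" for z
  proof -
    have "(c - restr D c) i * cnj (z i) = 0" for i using that by (auto simp: ell2_mem restr_def)
    then show ?thesis unfolding ell2_inner by (intro infsum_0)
  qed
  moreover have "restr D c \<in> hcarrier (ell2 D)"
    unfolding ell2_subset_iff[OF D] using restr_mem[OF c] by (simp add: restr_def)
  ultimately show "restr D c \<in> hcarrier (ell2 D) \<and>
      (\<forall>z\<in>hcarrier (ell2 D). hinner (ell2 I) (c - restr D c) z = 0)" by blast
next
  fix y assume y: "y \<in> hcarrier (ell2 D) \<and> (\<forall>z\<in>hcarrier (ell2 D). hinner (ell2 I) (c - y) z = 0)"
  show "y = restr D c"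
  proof
    fix i
    show "y i = restr D c i"
    proof (cases "i \<in> D")
      case True
      then have "hinner (ell2 I) (c - y) (unit_seq i) = 0"
        using y unit_seq_mem[of i D] by blast
      then show ?thesis using True D by (auto simp: ell2_inner_unit_right restr_def)
    next
      case False
      then show ?thesis using y by (simp add: ell2_mem restr_def)
    qed
  qed
qed

text \<open>Reduces an adjoint to exhibiting one vector that represents the functional: unit
  sequences determine its coordinates, so \<open>d\<close> is the only candidate.\<close>

lemma hadjoint_ell2:
  assumes d: "d \<in> hcarrier (ell2 I)"
    and adj: "\<And>z. z \<in> hcarrier (ell2 I) \<Longrightarrow> hinner Y (A z) y = hinner (ell2 I) z d"
  shows "hadjoint (ell2 I) Y A y = d"
  unfolding hadjoint_def
proof (rule the_equality)
  show "d \<in> hcarrier (ell2 I) \<and> (\<forall>z\<in>hcarrier (ell2 I). hinner Y (A z) y = hinner (ell2 I) z d)"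
    using d adj by blast
  fix x assume x: "x \<in> hcarrier (ell2 I) \<and> (\<forall>z\<in>hcarrier (ell2 I). hinner Y (A z) y = hinner (ell2 I) z x)"
  show "x = d"
  proof
    fix i
    show "x i = d i"
    proof (cases "i \<in> I")
      case True
      then have "hinner (ell2 I) (unit_seq i) x = hinner (ell2 I) (unit_seq i) d"
        using x adj unit_seq_mem[OF True] by metis
      then show ?thesis using True by (simp add: ell2_inner_unit_left)
    next
      case False
      then show ?thesis using x d by (auto simp: ell2_mem)
    qed
  qed
qed

lemma (in hilbert) hsum_eqI:
  assumes "has_hsum X g I s" "\<And>i. i \<in> I \<Longrightarrow> g i \<in> V"
  shows "hsum X g I = s"
  unfolding hsum_def
proof (rule the_equality)
  have ev: "eventually (\<lambda>F. sum g F \<in> V) (finite_subsets_at_top I)"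
    using assms(2) by (intro eventually_finite_subsets_at_top_weakI sum_mem) auto
  fix t assume "has_hsum X g I t"
  then show "t = s"
    using assms(1) unfolding has_hsum_def by (intro tendsto_unique[OF _ _ ev]) auto
qed (fact assms(1))

section \<open>Gram matrices and the index\<close>

text \<open>Indexed by \<open>j < r\<close> like the rows of a Gram matrix; a repeated vector
  already counts as a dependence, so injectivity need not be carried along.\<close>

definition lin_indep_family :: "nat \<Rightarrow> (nat \<Rightarrow> 'a::complex_vector) \<Rightarrow> bool"
  where "lin_indep_family r w \<longleftrightarrow> (\<forall>c. (\<Sum>j<r. c j *\<^sub>C w j) = 0 \<longrightarrow> (\<forall>j<r. c j = 0))"

lemma lin_indep_familyD:
  assumes w: "lin_indep_family r w"
  shows "inj_on w {..<r}" "complex_vector.independent (w ` {..<r})"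
proof -
  show inj: "inj_on w {..<r}"
  proof (rule inj_onI, rule ccontr)
    fix i j assume ij: "i \<in> {..<r}" "j \<in> {..<r}" "w i = w j" "i \<noteq> j"
    define c :: "nat \<Rightarrow> complex" where "c k = (if k = i then 1 else 0) - (if k = j then 1 else 0)" for k
    have "(\<Sum>k<r. c k *\<^sub>C w k) = (\<Sum>k<r. if k = i then w k else 0) - (\<Sum>k<r. if k = j then w k else 0)"
      unfolding sum_subtractf[symmetric]
      by (rule sum.cong) (auto simp: c_def complex_vector.scale_left_diff_distrib)
    also have "\<dots> = 0" using ij by (simp add: sum.delta)
    finally have "c i = 0" using w ij(1) unfolding lin_indep_family_def by blast
    then show False using ij(4) by (simp add: c_def)
  qed
  show "complex_vector.independent (w ` {..<r})"
  proof
    assume "complex_vector.dependent (w ` {..<r})"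
    then obtain u where u: "\<exists>v\<in>w ` {..<r}. u v \<noteq> 0" "(\<Sum>v\<in>w ` {..<r}. u v *\<^sub>C v) = 0"
      by (auto simp: complex_vector.dependent_finite)
    have "(\<Sum>j<r. u (w j) *\<^sub>C w j) = 0"
      using u(2) inj by (simp add: sum.reindex)
    then have "\<forall>j<r. u (w j) = 0"
      using w unfolding lin_indep_family_def by (meson lessThan_iff)
    then show False using u(1) by auto
  qed
qed

lemma lin_indep_family_exists:
  assumes "finite B" "complex_vector.independent B"
  obtains w where "lin_indep_family (card B) w" "\<And>j. j < card B \<Longrightarrow> w j \<in> B"
proof -
  obtain w where w: "bij_betw w {0..<card B} B" using ex_bij_betw_nat_finite[OF assms(1)] by blast
  then have inj: "inj_on w {..<card B}" and im: "w ` {..<card B} = B"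
    by (auto simp: bij_betw_def atLeast0LessThan)
  have "lin_indep_family (card B) w"
    unfolding lin_indep_family_def
  proof (intro allI impI)
    fix c j assume c: "(\<Sum>j<card B. c j *\<^sub>C w j) = 0" and j: "j < card B"
    define u where "u b = c (the_inv_into {..<card B} w b)" for b
    have u: "u (w j) = c j" if "j < card B" for j
      using the_inv_into_f_f[OF inj] that by (simp add: u_def)
    have "(\<Sum>b\<in>B. u b *\<^sub>C b) = (\<Sum>j<card B. u (w j) *\<^sub>C w j)"
      using sum.reindex[OF inj, of "\<lambda>b. u b *\<^sub>C b"] im by simp
    also have "\<dots> = 0" using c by (simp add: u)
    finally have "(\<Sum>b\<in>B. u b *\<^sub>C b) = 0" .
    then have "u (w j) = 0"
      using complex_vector.independentD[OF assms(2,1) subset_refl] im j by blast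
    then show "c j = 0" using u[OF j] by simp
  qed
  moreover have "w j \<in> B" if "j < card B" for j using im that by auto
  ultimately show ?thesis using that by blast
qed

text \<open>Makes \<open>cdim\<close> comparable with \<open>ind_pos\<close>, a supremum over finite
  families, and covers finite and infinite dimension at once.\<close>

lemma enat_le_cdim_iff:
  "enat r \<le> cdim W \<longleftrightarrow> (\<exists>w. (\<forall>j<r. w j \<in> W) \<and> lin_indep_family r w)"
proof
  assume r: "enat r \<le> cdim W"
  obtain B where B: "B \<subseteq> W" "complex_vector.independent B" "W \<subseteq> complex_vector.span B"
    "card B = complex_vector.dim W"
    by (rule complex_vector.basis_exists)
  obtain B0 where B0: "B0 \<subseteq> B" "finite B0" "card B0 = r"
  proof (cases "finite B")
    case True
    then have "cdim W = enat (card B)" using B by (auto simp: cdim_def)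
    then have "r \<le> card B" using r by simp
    then show ?thesis using obtain_subset_with_card_n that by metis
  next
    case False
    then show ?thesis using infinite_arbitrarily_large that by metis
  qed
  have "complex_vector.independent B0"
    using B(2) B0(1) by (rule complex_vector.independent_mono)
  then obtain w where "lin_indep_family r w" "\<And>j. j < r \<Longrightarrow> w j \<in> B0"
    using lin_indep_family_exists[OF B0(2)] B0(3) by metis
  then show "\<exists>w. (\<forall>j<r. w j \<in> W) \<and> lin_indep_family r w" using B0 B by blast
next
  assume "\<exists>w. (\<forall>j<r. w j \<in> W) \<and> lin_indep_family r w"
  then obtain w where w: "\<And>j. j < r \<Longrightarrow> w j \<in> W" "lin_indep_family r w" by blast
  note ind = lin_indep_familyD[OF w(2)]
  show "enat r \<le> cdim W"
  proof (cases "\<exists>B. finite B \<and> W \<subseteq> complex_vector.span B")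
    case True
    then obtain C where C: "finite C" "W \<subseteq> complex_vector.span C" by blast
    obtain B where B: "B \<subseteq> W" "complex_vector.independent B" "W \<subseteq> complex_vector.span B"
      "card B = complex_vector.dim W"
      by (rule complex_vector.basis_exists)
    have fin: "finite B" using complex_vector.independent_span_bound[OF C(1) B(2)] B(1) C(2) by blast
    have "w ` {..<r} \<subseteq> complex_vector.span B" using w(1) B(3) by auto
    then have "card (w ` {..<r}) \<le> card B"
      using complex_vector.independent_span_bound[OF fin ind(2)] by blast
    then show ?thesis using True B(4) card_image[OF ind(1)] by (simp add: cdim_def)
  qed (auto simp: cdim_def)
qed

section \<open>Semidefinite forms and their Gram matrices\<close>

context hermitian_space
begin

text \<open>Along the direction of a null vector \<open>y\<close> the quadratic form is affine in a
  real parameter; being nonnegative on \<open>W\<close>, it cannot have nonzero slope.\<close>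

lemma null_vector_orthogonal:
  assumes W: "complex_vector.subspace W" "W \<subseteq> V"
    and pos: "\<And>x. x \<in> W \<Longrightarrow> Re (h x x) \<ge> 0"
    and y: "y \<in> W" "Re (h y y) = 0" and w: "w \<in> W"
  shows "h w y = 0"
proof (rule ccontr)
  assume ne: "h w y \<noteq> 0"
  define b where "b = h w y"
  have V: "y \<in> V" "w \<in> V" using y w W by auto
  have yy: "h y y = 0" using diag_real[OF V(1)] y(2) by simp
  have ineq: "0 \<le> Re (h w w) + 2 * t * (cmod b)\<^sup>2" for t :: real
  proof -
    have "w + (of_real t * b) *\<^sub>C y \<in> W"
      using W y w by (simp add: complex_vector.subspace_add complex_vector.subspace_scale)
    then have "0 \<le> Re (h (w + (of_real t * b) *\<^sub>C y) (w + (of_real t * b) *\<^sub>C y))"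
      by (rule pos)
    also have "h (w + (of_real t * b) *\<^sub>C y) (w + (of_real t * b) *\<^sub>C y) =
        h w w + of_real t * (b * cnj b) + of_real t * (b * cnj b)"
      using V yy sym[OF V(2,1)] by (simp add: expand mem b_def algebra_simps)
    also have "\<dots> = h w w + of_real (2 * t * (cmod b)\<^sup>2)"
      by (simp add: complex_norm_square[symmetric])
    finally show ?thesis by simp
  qed
  have b: "(cmod b)\<^sup>2 > 0" using ne by (simp add: b_def)
  \<comment> \<open>The parameter at which the affine expression equals -1.\<close>
  have "0 \<le> Re (h w w) + 2 * (- (Re (h w w) + 1) / (2 * (cmod b)\<^sup>2)) * (cmod b)\<^sup>2"
    by (rule ineq)
  also have "\<dots> = -1" using b by (simp add: field_simps)
  finally show False by simp
qed

context
  fixes r :: nat and x :: "nat \<Rightarrow> 'a"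
  assumes xV: "\<And>j. j < r \<Longrightarrow> x j \<in> V"
begin

abbreviation "gram \<equiv> mat r r (\<lambda>(j, k). h (x j) (x k))"
abbreviation "comb c \<equiv> (\<Sum>j<r. c j *\<^sub>C x j)"

lemma comb_mem: "comb c \<in> V"
  using xV by (intro sum_mem scale_mem) auto

text \<open>The form is conjugate linear in its second argument, so the entries of \<open>v\<close>
  reappear conjugated as coefficients.\<close>

lemma gram_mult:
  assumes v: "v \<in> carrier_vec r" and j: "j < r"
  shows "(gram *\<^sub>v v) $ j = h (x j) (comb (\<lambda>k. cnj (v $ k)))"
proof -
  have "(gram *\<^sub>v v) $ j = (\<Sum>k<r. h (x j) (x k) * v $ k)"
    using v j by (simp add: scalar_prod_def atLeast0LessThan)
  also have "\<dots> = h (x j) (comb (\<lambda>k. cnj (v $ k)))"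
    using xV j by (subst sum_right) (auto simp: scale_mem scale_right mult.commute)
  finally show ?thesis .
qed

lemma gram_quadratic:
  assumes v: "v \<in> carrier_vec r"
  shows "(gram *\<^sub>v v) \<bullet>c v = h (comb (\<lambda>k. cnj (v $ k))) (comb (\<lambda>k. cnj (v $ k)))"
proof -
  let ?y = "comb (\<lambda>k. cnj (v $ k))"
  have "(gram *\<^sub>v v) \<bullet>c v = (\<Sum>j<r. (gram *\<^sub>v v) $ j * cnj (v $ j))"
    using v by (simp add: scalar_prod_def atLeast0LessThan conjugate_complex_def)
  also have "\<dots> = (\<Sum>j<r. h (x j) ?y * cnj (v $ j))"
    using gram_mult[OF v] by (intro sum.cong) auto
  also have "\<dots> = (\<Sum>j<r. h (cnj (v $ j) *\<^sub>C x j) ?y)"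
    using xV by (intro sum.cong) (auto simp: scale_left comb_mem)
  also have "\<dots> = h ?y ?y"
    using xV by (intro sum_left[symmetric] comb_mem) (auto simp: scale_mem)
  finally show ?thesis .
qed

text \<open>\<open>positive_mat\<close> is only semidefiniteness. With invertibility it becomes
  definiteness because, by \<open>null_vector_orthogonal\<close> on the span, a null combination
  yields a kernel vector of the Gram matrix. Conversely a definite matrix has no kernel, hence
  nonzero determinant.\<close>

lemma gram_positive_invertible_iff:
  "positive_mat gram \<and> invertible_mat gram \<longleftrightarrow>
    (\<forall>c. (\<exists>j<r. c j \<noteq> 0) \<longrightarrow> 0 < Re (h (comb c) (comb c)))"
  (is "?L \<longleftrightarrow> ?R")
proof
  assume L: ?L
  let ?W = "range comb"
  have W: "complex_vector.subspace ?W"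
  proof (rule complex_vector.subspaceI)
    show "0 \<in> ?W" by (rule range_eqI[of _ _ "\<lambda>_. 0"]) simp
    show "y + z \<in> ?W" if yz: "y \<in> ?W" "z \<in> ?W" for y z
    proof -
      obtain c d where "y = comb c" "z = comb d" using yz by blast
      then show ?thesis
        by (intro range_eqI[of _ _ "\<lambda>j. c j + d j"]) (simp add: scaleC_add_left sum.distrib)
    qed
    show "a *\<^sub>C y \<in> ?W" if y: "y \<in> ?W" for a y
    proof -
      obtain c where "y = comb c" using y by blast
      then show ?thesis
        by (intro range_eqI[of _ _ "\<lambda>j. a * c j"])
          (simp add: complex_vector.scale_sum_right scaleC_scaleC)
    qed
  qed
  have nonneg: "Re (h y y) \<ge> 0" if y: "y \<in> ?W" for y
  proof -
    obtain c where c: "y = comb c" using y by blast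
    let ?v = "vec r (\<lambda>k. cnj (c k))"
    have v: "?v \<in> carrier_vec r" by simp
    have "(gram *\<^sub>v ?v) \<bullet>c ?v \<in> \<real>\<^sub>\<ge>\<^sub>0" using L by (simp add: positive_mat_def)
    then have "h (comb (\<lambda>k. cnj (?v $ k))) (comb (\<lambda>k. cnj (?v $ k))) \<in> \<real>\<^sub>\<ge>\<^sub>0"
      unfolding gram_quadratic[OF v] .
    moreover have "comb (\<lambda>k. cnj (?v $ k)) = y" unfolding c by (rule sum.cong) auto
    ultimately show ?thesis by (auto simp: nonneg_Reals_def)
  qed
  show ?R
  proof (intro allI impI)
    fix c :: "nat \<Rightarrow> complex" assume c: "\<exists>j<r. c j \<noteq> 0"
    let ?v = "vec r (\<lambda>k. cnj (c k))"
    have v: "?v \<in> carrier_vec r" by simp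
    have y: "comb (\<lambda>k. cnj (?v $ k)) = comb c" by (rule sum.cong) auto
    show "0 < Re (h (comb c) (comb c))"
    proof (rule ccontr)
      assume "\<not> 0 < Re (h (comb c) (comb c))"
      then have null: "Re (h (comb c) (comb c)) = 0" using nonneg[of "comb c"] by fastforce
      have null_v: "gram *\<^sub>v ?v = 0\<^sub>v r"
      proof (rule eq_vecI)
        fix j assume "j < dim_vec (0\<^sub>v r)"
        then have j: "j < r" by simp
        have "x j = comb (\<lambda>k. if k = j then 1 else 0)"
        proof -
          have "comb (\<lambda>k. if k = j then 1 else 0) = (\<Sum>k<r. if k = j then x k else 0)"
            by (rule sum.cong) auto
          then show ?thesis using j by simp
        qed
        then have xj: "x j \<in> ?W"
          by (rule range_eqI[of _ comb "\<lambda>k. if k = j then 1 else 0"])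
        have "?W \<subseteq> V" using comb_mem by (rule image_subsetI)
        then have "h (x j) (comb c) = 0"
          by (rule null_vector_orthogonal[OF W _ nonneg rangeI null xj])
        then show "(gram *\<^sub>v ?v) $ j = 0\<^sub>v r $ j" using gram_mult[OF v j] y j by simp
      qed simp
      obtain B where B: "gram * B = 1\<^sub>m r" "B * gram = 1\<^sub>m (dim_row B)"
        using L by (auto simp: invertible_mat_def inverts_mat_def)
      have dims: "dim_row B = r" "dim_col B = r"
        using arg_cong[OF B(2), of dim_col] arg_cong[OF B(1), of dim_col] by simp_all
      then have B': "B \<in> carrier_mat r r" by auto
      have "?v = (B * gram) *\<^sub>v ?v" using B(2) v dims by simp
      also have "\<dots> = B *\<^sub>v (gram *\<^sub>v ?v)"
        by (rule assoc_mult_mat_vec[OF B' mat_carrier v])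
      also have "\<dots> = B *\<^sub>v 0\<^sub>v r" by (simp only: null_v)
      also have "\<dots> = 0\<^sub>v r" using B' by (intro eq_vecI) auto
      finally have v0: "?v = 0\<^sub>v r" .
      obtain j where j: "j < r" "c j \<noteq> 0" using c by blast
      have "cnj (c j) = ?v $ j" using j(1) by simp
      also have "\<dots> = 0" unfolding v0 using j(1) by simp
      finally show False using j(2) by simp
    qed
  qed
next
  assume R: ?R
  have pos: "0 < Re ((gram *\<^sub>v v) \<bullet>c v)" if v: "v \<in> carrier_vec r" "v \<noteq> 0\<^sub>v r" for v
  proof -
    have "\<exists>j<r. v $ j \<noteq> 0" using v by (metis carrier_vecD eq_vecI index_zero_vec)
    then have "\<exists>j<r. cnj (v $ j) \<noteq> 0" by simp
    then show ?thesis
      unfolding gram_quadratic[OF v(1)]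
      by (rule R[THEN spec, of "\<lambda>k. cnj (v $ k)", THEN mp])
  qed
  have "positive_mat gram"
    unfolding positive_mat_def
  proof (intro conjI ballI)
    fix v :: "complex vec" assume v: "v \<in> carrier_vec (dim_row gram)"
    then have v': "v \<in> carrier_vec r" by simp
    let ?y = "comb (\<lambda>k. cnj (v $ k))"
    have "(gram *\<^sub>v v) \<bullet>c v = of_real (Re (h ?y ?y))"
      unfolding gram_quadratic[OF v'] by (rule diag_real[OF comb_mem])
    moreover have "Re (h ?y ?y) \<ge> 0"
    proof (cases "v = 0\<^sub>v r")
      case True
      then have "?y = 0" by simp
      then show ?thesis by (simp add: zero_left zero_mem)
    next
      case False
      then show ?thesis using pos[OF v'] unfolding gram_quadratic[OF v'] by simp
    qed
    ultimately show "(gram *\<^sub>v v) \<bullet>c v \<in> \<real>\<^sub>\<ge>\<^sub>0" by (simp add: nonneg_Reals_of_real_iff)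
  qed simp
  moreover have "invertible_mat gram"
  proof -
    have "det gram \<noteq> 0"
    proof
      assume "det gram = 0"
      then obtain v where v: "v \<in> carrier_vec r" "v \<noteq> 0\<^sub>v r" "gram *\<^sub>v v = 0\<^sub>v r"
        using det_0_iff_vec_prod_zero[of gram r] by auto
      then show False using pos[OF v(1,2)] by (simp add: v(3))
    qed
    then have "gram \<in> Units (ring_mat TYPE(complex) r ())"
      by (intro det_non_zero_imp_unit) auto
    then show ?thesis
      by (auto simp: Units_def ring_mat_def invertible_mat_def inverts_mat_def)
  qed
  ultimately show ?L by blast
qed

end

end

section \<open>The index as a dimension\<close>

text \<open>The index sees an operator only through its form on the carrier. Values elsewhere can
  therefore be ignored, and \<open>- S\<close> in \<open>K\<close> can be read as \<open>S\<close>
  in the anti-space.\<close>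

lemma ind_pos_cong:
  assumes V: "kcarrier K = kcarrier K'"
    and form: "\<And>x y. x \<in> kcarrier K \<Longrightarrow> y \<in> kcarrier K \<Longrightarrow> kform K (A x) y = kform K' (B x) y"
  shows "ind_pos K A = ind_pos K' B"
proof -
  have eq: "mat r r (\<lambda>(j, k). kform K (A (x j)) (x k)) = mat r r (\<lambda>(j, k). kform K' (B (x j)) (x k))"
    if "\<forall>j<r. x j \<in> kcarrier K'" for r and x :: "nat \<Rightarrow> 'a"
    by (rule eq_matI) (use form that V in auto)
  show ?thesis
    unfolding ind_pos_def Let_def V
    by (intro arg_cong[of _ _ Sup] Collect_cong ex_cong1 conj_cong refl;
        (rule arg_cong[where f = positive_mat] | rule arg_cong[where f = invertible_mat]);
        rule eq, assumption)
qed

context krein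
begin

text \<open>Law of inertia: \<open>L\<close> is injective on each subspace where the form of
  \<open>A\<close> is positive, so positive families have at most \<open>cdim W\<close> members,
  while \<open>G\<close> sends independent families of \<open>W\<close> to positive ones.\<close>

lemma ind_pos_eq_cdim:
  fixes L G :: "'a \<Rightarrow> 'a"
  assumes A: "hermitian_form V (\<lambda>x y. form (A x) y)"
    and W: "complex_vector.subspace W"
    and L: "\<And>x. x \<in> V \<Longrightarrow> L x \<in> W" "\<And>x y. x \<in> V \<Longrightarrow> y \<in> V \<Longrightarrow> L (x + y) = L x + L y"
      "\<And>a x. x \<in> V \<Longrightarrow> L (a *\<^sub>C x) = a *\<^sub>C L x"
      "\<And>x. x \<in> V \<Longrightarrow> 0 < Re (form (A x) x) \<Longrightarrow> L x \<noteq> 0"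
    and G: "\<And>x. x \<in> W \<Longrightarrow> G x \<in> V" "\<And>x y. x \<in> W \<Longrightarrow> y \<in> W \<Longrightarrow> G (x + y) = G x + G y"
      "\<And>a x. x \<in> W \<Longrightarrow> G (a *\<^sub>C x) = a *\<^sub>C G x"
      "\<And>x. x \<in> W \<Longrightarrow> x \<noteq> 0 \<Longrightarrow> 0 < Re (form (A (G x)) (G x))"
  shows "ind_pos K A = cdim W"
proof -
  interpret A: hermitian_space V "\<lambda>x y. form (A x) y"
    using A F.sub by unfold_locales
  have lin_sum: "(\<forall>j<r. x j \<in> U) \<longrightarrow> Q (\<Sum>j<r. c j *\<^sub>C x j) = (\<Sum>j<r. c j *\<^sub>C Q (x j))"
    if U: "complex_vector.subspace U" and add: "\<And>x y. x \<in> U \<Longrightarrow> y \<in> U \<Longrightarrow> Q (x + y) = Q x + Q y"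
      and scale: "\<And>a x. x \<in> U \<Longrightarrow> Q (a *\<^sub>C x) = a *\<^sub>C Q x"
    for r and x :: "nat \<Rightarrow> 'a" and c and U and Q :: "'a \<Rightarrow> 'a"
  proof (induction r)
    case 0
    show ?case using scale[of 0 0] complex_vector.subspace_0[OF U] by simp
  next
    case (Suc r)
    show ?case
    proof
      assume x: "\<forall>j<Suc r. x j \<in> U"
      then have "(\<Sum>j<r. c j *\<^sub>C x j) \<in> U" "c r *\<^sub>C x r \<in> U"
        using U by (auto intro!: complex_vector.subspace_sum complex_vector.subspace_scale)
      then show "Q (\<Sum>j<Suc r. c j *\<^sub>C x j) = (\<Sum>j<Suc r. c j *\<^sub>C Q (x j))"
        using Suc x by (simp add: add scale)
    qed
  qed
  have set_eq: "{enat r |r. r \<ge> 1 \<and> (\<exists>x :: nat \<Rightarrow> 'a. (\<forall>j<r. x j \<in> V) \<and>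
       (let M = mat r r (\<lambda>(j, k). form (A (x j)) (x k)) in positive_mat M \<and> invertible_mat M))} =
     {enat r |r. r \<ge> 1 \<and> (\<exists>x. (\<forall>j<r. x j \<in> V) \<and> (\<forall>c. (\<exists>j<r. c j \<noteq> 0) \<longrightarrow>
       0 < Re (form (A (\<Sum>j<r. c j *\<^sub>C x j)) (\<Sum>j<r. c j *\<^sub>C x j))))}" (is "_ = ?S")
    unfolding Let_def using A.gram_positive_invertible_iff
    by (intro Collect_cong ex_cong1 conj_cong refl) blast
  have ind: "ind_pos K A = Sup ?S" unfolding ind_pos_def set_eq ..
  show ?thesis
  proof (rule antisym)
    show "ind_pos K A \<le> cdim W"
      unfolding ind
    proof (rule Sup_least)
      fix s assume "s \<in> ?S"
      then obtain r x where r: "s = enat r" and x: "\<forall>j<r. x j \<in> V"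
        and pos: "\<And>c. (\<exists>j<r. c j \<noteq> 0) \<Longrightarrow>
          0 < Re (form (A (\<Sum>j<r. c j *\<^sub>C x j)) (\<Sum>j<r. c j *\<^sub>C x j))"
        by blast
      have "lin_indep_family r (\<lambda>j. L (x j))"
        unfolding lin_indep_family_def
      proof (intro allI impI, rule ccontr)
        fix c j assume c: "(\<Sum>j<r. c j *\<^sub>C L (x j)) = 0" "j < r" "c j \<noteq> 0"
        have "(\<Sum>j<r. c j *\<^sub>C x j) \<in> V" using x by (auto intro!: F.sum_mem F.scale_mem)
        then have "L (\<Sum>j<r. c j *\<^sub>C x j) \<noteq> 0" using L(4) pos c(2,3) by blast
        then show False using c(1) lin_sum[OF F.sub L(2,3), of r x c] x by simp
      qed
      then show "s \<le> cdim W" unfolding r enat_le_cdim_iff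
        using x L(1) by (intro exI[of _ "\<lambda>j. L (x j)"]) auto
    qed
    \<comment> \<open>Finite \<open>r\<close> suffice also when \<open>cdim W\<close> is infinite,
      since an extended natural above every finite one is infinity.\<close>
    have ge: "enat r \<le> ind_pos K A" if r: "enat r \<le> cdim W" for r
    proof (cases "r = 0")
      case False
      obtain w where w: "\<forall>j<r. w j \<in> W" "lin_indep_family r w"
        using r unfolding enat_le_cdim_iff by blast
      have "0 < Re (form (A (\<Sum>j<r. c j *\<^sub>C G (w j))) (\<Sum>j<r. c j *\<^sub>C G (w j)))"
        if "\<exists>j<r. c j \<noteq> 0" for c
      proof -
        have eq: "G (\<Sum>j<r. c j *\<^sub>C w j) = (\<Sum>j<r. c j *\<^sub>C G (w j))"
          using lin_sum[OF W G(2,3), of r w c] w(1) by (rule mp)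
        have "(\<Sum>j<r. c j *\<^sub>C w j) \<noteq> 0"
          using w(2) that unfolding lin_indep_family_def by blast
        moreover have "(\<Sum>j<r. c j *\<^sub>C w j) \<in> W"
          using w(1) W by (auto intro!: complex_vector.subspace_sum complex_vector.subspace_scale)
        ultimately show ?thesis unfolding eq[symmetric] by (intro G(4))
      qed
      then have "enat r \<in> ?S" using False w(1) G(1) by (intro CollectI exI[of _ r] conjI exI[of _ "\<lambda>j. G (w j)"] allI impI) auto
      then show ?thesis unfolding ind by (rule Sup_upper)
    qed (simp add: zero_enat_def[symmetric])
    show "cdim W \<le> ind_pos K A"
    proof (cases "cdim W")
      case (enat n)
      then show ?thesis using ge[of n] by simp
    next
      case infinity
      then have "enat r \<le> ind_pos K A" for r using ge[of r] by simp
      then have "ind_pos K A \<noteq> enat n" for n by (metis Suc_n_not_le_n enat_ord_simps(1))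
      then show ?thesis by (cases "ind_pos K A") auto
    qed
  qed
qed

end

lemma (in hilbert) tendsto_if_norm_diff_le:
  assumes u: "\<And>n::nat. u n \<in> V" and l: "l \<in> V"
    and le: "\<And>n. nm (u n - l) \<le> b n" and b: "b \<longlonglongrightarrow> 0"
  shows "(\<lambda>n. nm (u n - l)) \<longlonglongrightarrow> 0"
proof (rule tendsto_sandwich[OF _ _ tendsto_const b])
  show "\<forall>\<^sub>F n in sequentially. 0 \<le> nm (u n - l)"
    using u l by (intro always_eventually allI norm_ge_0 diff_mem)
  show "\<forall>\<^sub>F n in sequentially. nm (u n - l) \<le> b n"
    using le by (intro always_eventually allI)
qed

context krein
begin

section \<open>Sums of operators ranging in definite subspaces\<close>

text \<open>The adjoint is evaluated at \<open>J x\<close>, where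
  \<open>kinner K (A z) (J x)\<close> is \<open>form (A z) x\<close>; symmetry identifies the value
  as \<open>J (A x)\<close>, and the outer \<open>J\<close> cancels.\<close>

lemma j_selfadjointI:
  assumes A: "bounded_op (khilbert K) (khilbert K) A"
    and sym: "\<And>x y. x \<in> V \<Longrightarrow> y \<in> V \<Longrightarrow> form (A x) y = form x (A y)"
  shows "j_selfadjoint K A"
proof -
  have AV: "A x \<in> V" if "x \<in> V" for x using A that by (simp add: bounded_op_def)
  have "hadjoint (khilbert K) (khilbert K) A (J x) = J (A x)" if x: "x \<in> V" for x
    unfolding hadjoint_def carrier_khilbert inner_khilbert
  proof (rule the_equality)
    show *: "J (A x) \<in> V \<and> (\<forall>z\<in>V. kinner K (A z) (J x) = kinner K z (J (A x)))"
      using x AV sym by (simp add: J_mem kinner_J_right)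
    fix y assume y: "y \<in> V \<and> (\<forall>z\<in>V. kinner K (A z) (J x) = kinner K z y)"
    show "y = J (A x)"
      by (rule H.eqI) (use y * in auto)
  qed
  then show ?thesis
    using A AV by (simp add: j_selfadjoint_def jadjoint_def J_J)
qed

end

text \<open>What the operator theory needs of a frame. The domination axioms say that a functional
  \<open>[y, .]\<close> with \<open>y\<close> in one of the subspaces is bounded wherever the
  corresponding quadratic form is; \<open>C\<close> may depend on \<open>y\<close>. Phrasing
  negativity of \<open>Mm\<close> through \<open>anti_krein\<close> makes the axioms invariant under
  exchange of the two summands.\<close>

locale krein_splitting = krein K for K :: "'a::complex_vector krein" +
  fixes Mp Mm :: "'a set" and Sp Sm :: "'a \<Rightarrow> 'a"
  assumes Mp: "maximal_wrt (unif_j_positive K) Mp"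
    and Mm: "maximal_wrt (unif_j_positive (anti_krein K)) Mm"
    and bounded_Sp: "bounded_op (khilbert K) (khilbert K) Sp"
    and bounded_Sm: "bounded_op (khilbert K) (khilbert K) Sm"
    and Sp_range: "x \<in> V \<Longrightarrow> Sp x \<in> Mp" and Sm_range: "x \<in> V \<Longrightarrow> Sm x \<in> Mm"
    and Sp_sym: "x \<in> V \<Longrightarrow> y \<in> V \<Longrightarrow> form (Sp x) y = form x (Sp y)"
    and Sm_sym: "x \<in> V \<Longrightarrow> y \<in> V \<Longrightarrow> form (Sm x) y = form x (Sm y)"
    and Sp_pos: "x \<in> V \<Longrightarrow> Re (form (Sp x) x) \<ge> 0"
    and Sm_pos: "x \<in> V \<Longrightarrow> Re (form (Sm x) x) \<ge> 0"
    and Mp_dominated: "y \<in> Mp \<Longrightarrow> \<exists>C. \<forall>x\<in>V. cmod (form y x) \<le> C + Re (form (Sp x) x)"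
    and Mm_dominated: "y \<in> Mm \<Longrightarrow> \<exists>C. \<forall>x\<in>V. cmod (form y x) \<le> C + Re (form (Sm x) x)"
begin

abbreviation "S x \<equiv> Sp x - Sm x"

lemma Mp_subspace: "complex_vector.subspace Mp" and Mm_subspace: "complex_vector.subspace Mm"
  and Mp_subset: "Mp \<subseteq> V" and Mm_subset: "Mm \<subseteq> V"
  using Mp Mm by (auto simp: maximal_wrt_def unif_j_positive_def)

sublocale Mp: hermitian_space Mp form
  using Mp_subspace hermitian_form_subset[OF F.herm Mp_subset] by unfold_locales

sublocale Mm: hermitian_space Mm form
  using Mm_subspace hermitian_form_subset[OF F.herm Mm_subset] by unfold_locales

lemma Mp_mem: "m \<in> Mp \<Longrightarrow> m \<in> V" and Mm_mem: "k \<in> Mm \<Longrightarrow> k \<in> V"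
  using Mp_subset Mm_subset by auto

lemma Sp_mem: "x \<in> V \<Longrightarrow> Sp x \<in> V" and Sm_mem: "x \<in> V \<Longrightarrow> Sm x \<in> V"
  by (simp_all add: Sp_range Sm_range Mp_mem Mm_mem)

lemma S_mem: "x \<in> V \<Longrightarrow> S x \<in> V"
  by (simp add: Sp_mem Sm_mem F.mem)

lemma Sp_add: "x \<in> V \<Longrightarrow> y \<in> V \<Longrightarrow> Sp (x + y) = Sp x + Sp y"
  and Sp_scale: "x \<in> V \<Longrightarrow> Sp (a *\<^sub>C x) = a *\<^sub>C Sp x"
  and Sm_add: "x \<in> V \<Longrightarrow> y \<in> V \<Longrightarrow> Sm (x + y) = Sm x + Sm y"
  and Sm_scale: "x \<in> V \<Longrightarrow> Sm (a *\<^sub>C x) = a *\<^sub>C Sm x"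
  using bounded_Sp bounded_Sm by (simp_all add: bounded_op_def)

lemma S_add: "x \<in> V \<Longrightarrow> y \<in> V \<Longrightarrow> S (x + y) = S x + S y"
  by (simp add: Sp_add Sm_add)

lemma S_scale: "x \<in> V \<Longrightarrow> S (a *\<^sub>C x) = a *\<^sub>C S x"
  by (simp add: Sp_scale Sm_scale complex_vector.scale_right_diff_distrib)

lemma S_diff: "x \<in> V \<Longrightarrow> y \<in> V \<Longrightarrow> S (x - y) = S x - S y"
  using S_add[of x "- y"] S_scale[of y "-1"] by (simp add: F.mem)

lemma S_sym: "x \<in> V \<Longrightarrow> y \<in> V \<Longrightarrow> form (S x) y = form x (S y)"
  using Sp_sym[of x y] Sm_sym[of x y] by (simp add: F.diff_left F.diff_right Sp_mem Sm_mem)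

lemma bounded_S: "bounded_op (khilbert K) (khilbert K) S"
proof -
  obtain C D where C: "\<And>x. x \<in> V \<Longrightarrow> nrm (Sp x) \<le> C * nrm x"
    and D: "\<And>x. x \<in> V \<Longrightarrow> nrm (Sm x) \<le> D * nrm x"
    using bounded_Sp bounded_Sm unfolding bounded_op_def carrier_khilbert by metis
  have "nrm (S x) \<le> (C + D) * nrm x" if "x \<in> V" for x
    using H.norm_triangle4[of "Sp x" "Sm x"] C[OF that] D[OF that] that
    by (simp add: Sp_mem Sm_mem algebra_simps)
  then show ?thesis
    unfolding bounded_op_def carrier_khilbert
    by (intro conjI ballI allI exI[of _ "C + D"]) (simp_all only: S_mem S_add S_scale)
qed

text \<open>Compare \<open>Re [m + k, m - k] = [m, m] - [k, k]\<close> with both bounds.\<close>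

lemma angle:
  obtains C where "C > 0" "\<And>m k. m \<in> Mp \<Longrightarrow> k \<in> Mm \<Longrightarrow> nrm m + nrm k \<le> C * nrm (m + k)"
proof -
  obtain \<alpha> where \<alpha>: "\<alpha> > 0" "\<And>x. x \<in> Mp \<Longrightarrow> Re (form x x) \<ge> \<alpha> * (nrm x)\<^sup>2"
    using Mp by (auto simp: maximal_wrt_def unif_j_positive_def)
  obtain \<beta> where \<beta>: "\<beta> > 0" "\<And>x. x \<in> Mm \<Longrightarrow> - Re (form x x) \<ge> \<beta> * (nrm x)\<^sup>2"
    using Mm by (auto simp: maximal_wrt_def unif_j_positive_def)
  define \<gamma> where "\<gamma> = min \<alpha> \<beta>"
  have \<gamma>: "\<gamma> > 0" using \<alpha> \<beta> by (simp add: \<gamma>_def)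
  have "nrm m + nrm k \<le> (2 / \<gamma>) * nrm (m + k)" if m: "m \<in> Mp" and k: "k \<in> Mm" for m k
  proof -
    have V: "m \<in> V" "k \<in> V" using m k by (simp_all add: Mp_mem Mm_mem)
    define a where "a = nrm m + nrm k"
    have a0: "a \<ge> 0" using V by (simp add: a_def H.norm_ge_0)
    have "\<gamma> * ((nrm m)\<^sup>2 + (nrm k)\<^sup>2) \<le> \<alpha> * (nrm m)\<^sup>2 + \<beta> * (nrm k)\<^sup>2"
      unfolding distrib_left by (intro add_mono mult_right_mono) (auto simp: \<gamma>_def)
    also have "\<dots> \<le> Re (form m m) - Re (form k k)"
      using \<alpha>(2)[OF m] \<beta>(2)[OF k] by linarith
    also have "\<dots> = Re (form (m + k) (m - k))"
      using V F.sym[OF V] by (simp add: F.expand F.mem)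
    also have "\<dots> \<le> cmod (form (m + k) (m - k))" by (rule complex_Re_le_cmod)
    also have "\<dots> \<le> nrm (m + k) * nrm (m - k)"
      using V by (intro form_le) (simp_all add: F.mem)
    also have "\<dots> \<le> nrm (m + k) * a"
      unfolding a_def using V by (intro mult_left_mono H.norm_triangle4) (simp_all add: F.mem H.norm_ge_0)
    finally have "\<gamma> * ((nrm m)\<^sup>2 + (nrm k)\<^sup>2) \<le> nrm (m + k) * a" .
    moreover have "\<gamma> * a\<^sup>2 \<le> \<gamma> * (2 * ((nrm m)\<^sup>2 + (nrm k)\<^sup>2))"
      using \<gamma> sum_squares_bound[of "nrm m" "nrm k"]
      by (intro mult_left_mono) (simp_all add: a_def power2_sum)
    ultimately have "\<gamma> * a\<^sup>2 \<le> 2 * (nrm (m + k) * a)" by linarith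
    then have "a * (\<gamma> * a) \<le> a * (2 * nrm (m + k))" by (simp add: power2_eq_square mult_ac)
    then have "\<gamma> * a \<le> 2 * nrm (m + k)"
      using a0 V by (cases "a = 0") (auto simp: H.norm_ge_0 F.mem)
    then show ?thesis using \<gamma> by (simp add: a_def field_simps)
  qed
  then show ?thesis using that[of "2 / \<gamma>"] \<gamma> by simp
qed

text \<open>The angle bound is applied to \<open>x\<close> and \<open>- x\<close>, whose sum is
  0.\<close>

lemma Mp_Mm_eq_0:
  assumes "x \<in> Mp" "x \<in> Mm"
  shows "x = 0"
proof -
  obtain C where C: "\<And>m k. m \<in> Mp \<Longrightarrow> k \<in> Mm \<Longrightarrow> nrm m + nrm k \<le> C * nrm (m + k)"
    using angle by blast
  have "nrm x + nrm (- x) \<le> C * nrm (x + - x)"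
    using assms by (intro C) (simp_all add: Mm.mem)
  then have "nrm x \<le> 0" using assms by (simp add: H.norm_uminus Mp_mem)
  then show ?thesis using H.norm_eq_0[of x] H.norm_ge_0[of x] assms by (simp add: Mp_mem)
qed

lemma subspace_sum_Mp_Mm: "complex_vector.subspace {m + k |m k. m \<in> Mp \<and> k \<in> Mm}"
proof (rule complex_vector.subspaceI)
  show "0 \<in> {m + k |m k. m \<in> Mp \<and> k \<in> Mm}"
    using Mp.zero_mem Mm.zero_mem by force
next
  fix x y assume "x \<in> {m + k |m k. m \<in> Mp \<and> k \<in> Mm}" "y \<in> {m + k |m k. m \<in> Mp \<and> k \<in> Mm}"
  then obtain m k m' k' where "x = m + k" "y = m' + k'" "m \<in> Mp" "m' \<in> Mp" "k \<in> Mm" "k' \<in> Mm"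
    by blast
  then have "x + y = (m + m') + (k + k')" "m + m' \<in> Mp" "k + k' \<in> Mm"
    by (simp_all add: Mp.mem Mm.mem algebra_simps)
  then show "x + y \<in> {m + k |m k. m \<in> Mp \<and> k \<in> Mm}" by blast
next
  fix c x assume "x \<in> {m + k |m k. m \<in> Mp \<and> k \<in> Mm}"
  then obtain m k where "x = m + k" "m \<in> Mp" "k \<in> Mm" by blast
  then have "c *\<^sub>C x = c *\<^sub>C m + c *\<^sub>C k" "c *\<^sub>C m \<in> Mp" "c *\<^sub>C k \<in> Mm"
    by (simp_all add: Mp.mem Mm.mem scaleC_add_right)
  then show "c *\<^sub>C x \<in> {m + k |m k. m \<in> Mp \<and> k \<in> Mm}" by blast
qed

text \<open>For \<open>z\<close> orthogonal to the sum, \<open>J z\<close> is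
  \<open>[.,.]\<close>-orthogonal to \<open>Mp\<close> and \<open>Mm\<close>, and the sign of
  \<open>[J z, J z]\<close> decides whether maximality of \<open>Mp\<close> in \<open>K\<close> or
  of \<open>Mm\<close> in the anti-space makes it vanish. For closedness, the angle bound makes both
  components of a convergent sequence Cauchy, and \<open>Mp\<close> and \<open>Mm\<close> are
  closed.\<close>

lemma sum_Mp_Mm: "{m + k |m k. m \<in> Mp \<and> k \<in> Mm} = V"
proof (rule H.closed_subspace_eq_carrier)
  let ?W = "{m + k |m k. m \<in> Mp \<and> k \<in> Mm}"
  interpret anti: krein "anti_krein K" by (rule krein_anti_krein) (rule krein_axioms)
  show "complex_vector.subspace ?W" by (rule subspace_sum_Mp_Mm)
  show "?W \<subseteq> V" by (auto intro!: F.add_mem[OF Mp_mem Mm_mem])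
  show "z = 0" if z: "z \<in> V" and orth: "\<And>w. w \<in> ?W \<Longrightarrow> kinner K z w = 0" for z
  proof -
    have Jz: "J z \<in> V" using z by (rule J_mem)
    have 0: "form w (J z) = 0" if "w \<in> ?W" "w \<in> V" for w
      using orth[OF that(1)] H.sym[OF z that(2)] that z by (simp add: form_J_right)
    have p: "form m (J z) = 0" if m: "m \<in> Mp" for m
    proof (rule 0)
      have "m = m + 0" by simp
      then show "m \<in> ?W" using m Mm.zero_mem by blast
    qed (rule Mp_mem[OF m])
    have n: "form k (J z) = 0" if k: "k \<in> Mm" for k
    proof (rule 0)
      have "k = 0 + k" by simp
      then show "k \<in> ?W" using k Mp.zero_mem by blast
    qed (rule Mm_mem[OF k])
    have "J z = 0"
    proof (cases "Re (form (J z) (J z)) \<ge> 0")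
      case True
      then show ?thesis using maximal_pos_orthogonal[OF Mp Jz p] by blast
    next
      case False
      show ?thesis
        by (rule anti.maximal_pos_orthogonal[OF Mm]) (use Jz n False in simp_all)
    qed
    then show ?thesis using H.norm_eq_0[OF z] nrm_J[OF z] by simp
  qed
  fix u l assume u: "\<And>n::nat. u n \<in> ?W" and l: "l \<in> V" and lim: "(\<lambda>n. nrm (u n - l)) \<longlonglongrightarrow> 0"
  have "\<forall>n. \<exists>m k. u n = m + k \<and> m \<in> Mp \<and> k \<in> Mm" using u by blast
  then obtain m k where mk: "\<And>n. u n = m n + k n" "\<And>n. m n \<in> Mp" "\<And>n. k n \<in> Mm" by metis
  have V: "m n \<in> V" "k n \<in> V" "u n \<in> V" for n
    using mk by (simp_all add: Mp_mem Mm_mem F.mem)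
  obtain C where C: "C > 0" "\<And>m k. m \<in> Mp \<Longrightarrow> k \<in> Mm \<Longrightarrow> nrm m + nrm k \<le> C * nrm (m + k)"
    using angle by blast
  have le: "nrm (m i - m j) + nrm (k i - k j) \<le> C * nrm (u i - u j)" for i j
  proof -
    have "u i - u j = (m i - m j) + (k i - k j)" by (simp add: mk(1))
    then show ?thesis
      using C(2)[OF Mp.diff_mem[OF mk(2) mk(2)] Mm.diff_mem[OF mk(3) mk(3)], of i j i j] by (simp only:)
  qed
  have Cauchy: "\<exists>N. \<forall>i\<ge>N. \<forall>j\<ge>N. nrm (m i - m j) + nrm (k i - k j) < e" if e: "e > 0" for e
  proof -
    have "e / C > 0" using e C(1) by simp
    then obtain N where N: "\<forall>i\<ge>N. \<forall>j\<ge>N. nrm (u i - u j) < e / C"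
      using H.convergent_Cauchy[OF l V(3) lim] by blast
    have "nrm (m i - m j) + nrm (k i - k j) < e" if "i \<ge> N" "j \<ge> N" for i j
    proof -
      have "nrm (u i - u j) < e / C" using N that by blast
      then have "C * nrm (u i - u j) < e" using C(1) by (simp add: field_simps)
      then show ?thesis using le[of i j] by linarith
    qed
    then show ?thesis by blast
  qed
  have nonneg: "nrm (m i - m j) \<ge> 0" "nrm (k i - k j) \<ge> 0" for i j
    using V by (simp_all add: H.norm_ge_0 F.mem)
  have "\<exists>N. \<forall>i\<ge>N. \<forall>j\<ge>N. nrm (m i - m j) < e" if e: "e > 0" for e
  proof -
    obtain N where N: "\<And>i j. N \<le> i \<Longrightarrow> N \<le> j \<Longrightarrow> nrm (m i - m j) + nrm (k i - k j) < e"
      using Cauchy[OF e] by blast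
    have "nrm (m i - m j) < e" if "N \<le> i" "N \<le> j" for i j
      using N[OF that] nonneg(2)[where i = i and j = j] by linarith
    then show ?thesis by blast
  qed
  then obtain m' where m': "m' \<in> V" "(\<lambda>n. nrm (m n - m')) \<longlonglongrightarrow> 0"
    using H.complete[of m] V(1) by blast
  have "\<exists>N. \<forall>i\<ge>N. \<forall>j\<ge>N. nrm (k i - k j) < e" if e: "e > 0" for e
  proof -
    obtain N where N: "\<And>i j. N \<le> i \<Longrightarrow> N \<le> j \<Longrightarrow> nrm (m i - m j) + nrm (k i - k j) < e"
      using Cauchy[OF e] by blast
    have "nrm (k i - k j) < e" if "N \<le> i" "N \<le> j" for i j
      using N[OF that] nonneg(1)[where i = i and j = j] by linarith
    then show ?thesis by blast
  qed
  then obtain k' where k': "k' \<in> V" "(\<lambda>n. nrm (k n - k')) \<longlonglongrightarrow> 0"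
    using H.complete[of k] V(2) by blast
  have mem: "m' \<in> Mp" "k' \<in> Mm"
    using maximal_pos_closed[OF Mp mk(2) m'] anti.maximal_pos_closed[OF Mm mk(3)] k' by simp_all
  have lim_b: "(\<lambda>n. nrm (m n - m') + nrm (k n - k')) \<longlonglongrightarrow> 0"
    using tendsto_add[OF m'(2) k'(2)] by simp
  have mk': "m' + k' \<in> V" using m'(1) k'(1) by (rule F.add_mem)
  have le_b: "nrm (u n - (m' + k')) \<le> nrm (m n - m') + nrm (k n - k')" for n
  proof -
    have "u n - (m' + k') = (m n - m') + (k n - k')" by (simp add: mk(1))
    then show ?thesis
      using H.norm_triangle[OF F.diff_mem[OF V(1) m'(1)] F.diff_mem[OF V(2) k'(1)], of n n]
      by (simp only:)
  qed
  have "(\<lambda>n. nrm (u n - (m' + k'))) \<longlonglongrightarrow> 0"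
    by (rule H.tendsto_if_norm_diff_le[OF V(3) mk' le_b lim_b])
  then have "l = m' + k'"
    using V(3) by (intro H.tendsto_unique[OF l mk' _ _ lim]) auto
  then show "l \<in> ?W" using mem by blast
qed

text \<open>The vectors \<open>x\<close> with \<open>\<parallel>S x\<parallel> \<parallel>x\<parallel> \<le> 1\<close> are weakly bounded, because \<open>[S\<^sub>\<plusminus> x, x]\<close> is bounded on
  them; hence they are norm bounded.\<close>

lemma bounded_below:
  obtains C where "C > 0" "\<And>x. x \<in> V \<Longrightarrow> nrm x \<le> C * nrm (S x)"
proof -
  obtain C where C: "C > 0" "\<And>m k. m \<in> Mp \<Longrightarrow> k \<in> Mm \<Longrightarrow> nrm m + nrm k \<le> C * nrm (m + k)"
    using angle by blast
  let ?Y = "{x \<in> V. nrm (S x) * nrm x \<le> 1}"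
  have bd: "Re (form (Sp x) x) + Re (form (Sm x) x) \<le> C" if x: "x \<in> ?Y" for x
  proof -
    have xV: "x \<in> V" using x by simp
    have "Re (form (Sp x) x) + Re (form (Sm x) x) \<le> nrm (Sp x) * nrm x + nrm (Sm x) * nrm x"
      using form_le[OF Sp_mem xV] form_le[OF Sm_mem xV] xV
      by (intro add_mono order_trans[OF complex_Re_le_cmod]) auto
    \<comment> \<open>The sign moves inside so that the angle bound applies to \<open>Sp x\<close>
      and \<open>- Sm x\<close>, whose sum is \<open>S x\<close>.\<close>
    also have "\<dots> = (nrm (Sp x) + nrm (- Sm x)) * nrm x"
      using xV by (simp add: H.norm_uminus Sm_mem algebra_simps)
    also have "\<dots> \<le> (C * nrm (Sp x + - Sm x)) * nrm x"
      using xV by (intro mult_right_mono C(2)) (simp_all add: Sp_range Sm_range Mm.mem H.norm_ge_0)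
    also have "\<dots> = C * (nrm (S x) * nrm x)" by simp
    also have "\<dots> \<le> C * 1" using x C(1) by (intro mult_left_mono) auto
    finally show ?thesis by simp
  qed
  have "\<exists>B. \<forall>y\<in>?Y. nrm y \<le> B"
  proof (rule H.weakly_bounded_imp_bounded)
    fix v assume v: "v \<in> V"
    \<comment> \<open>\<open>kinner K v y\<close> is \<open>[J v, y]\<close>, so splitting
      \<open>J v\<close> along \<open>Mp\<close> and \<open>Mm\<close> reduces a general functional
      to two dominated ones.\<close>
    then have "J v \<in> {m + k |m k. m \<in> Mp \<and> k \<in> Mm}" by (simp only: sum_Mp_Mm J_mem)
    then obtain m k where mk: "J v = m + k" "m \<in> Mp" "k \<in> Mm" by blast
    obtain A B where A: "\<And>x. x \<in> V \<Longrightarrow> cmod (form m x) \<le> A + Re (form (Sp x) x)"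
      and B: "\<And>x. x \<in> V \<Longrightarrow> cmod (form k x) \<le> B + Re (form (Sm x) x)"
      using Mp_dominated[OF mk(2)] Mm_dominated[OF mk(3)] by blast
    have "cmod (kinner K v y) \<le> A + B + C" if y: "y \<in> ?Y" for y
    proof -
      have yV: "y \<in> V" using y by simp
      have "kinner K v y = form m y + form k y"
        using form_J_left[OF v yV] mk yV by (simp add: F.add_left Mp_mem Mm_mem)
      then have "cmod (kinner K v y) \<le> cmod (form m y) + cmod (form k y)"
        by (simp add: norm_triangle_ineq)
      then show ?thesis using A[OF yV] B[OF yV] bd[OF y] by linarith
    qed
    then show "\<exists>C. \<forall>y\<in>?Y. cmod (kinner K v y) \<le> C" by blast
  qed auto
  then obtain B where B: "\<And>y. y \<in> ?Y \<Longrightarrow> nrm y \<le> B" by blast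
  define D where "D = \<bar>B\<bar> + 1"
  have D: "D > 0" "B < D" by (simp_all add: D_def)
  have "nrm x \<le> D\<^sup>2 * nrm (S x)" if x: "x \<in> V" for x
  proof (rule ccontr)
    assume less: "\<not> nrm x \<le> D\<^sup>2 * nrm (S x)"
    have "nrm (S x) \<ge> 0" using x by (simp add: H.norm_ge_0 S_mem)
    then have pos: "nrm x > 0" using less
      by (meson le_less_trans mult_nonneg_nonneg not_le zero_le_power2)
    \<comment> \<open>Scaled to norm \<open>D\<close>, which exceeds the bound \<open>B\<close>, the
      vector would still lie in \<open>?Y\<close>: the product of norms becomes
      \<open>D^2 ||S x|| / ||x||\<close>, which is below 1 by assumption.\<close>
    define t where "t = D / nrm x"
    have t: "t > 0" using pos D by (simp add: t_def)
    have "S (of_real t *\<^sub>C x) = of_real t *\<^sub>C S x" using x by (rule S_scale)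
    then have "nrm (S (of_real t *\<^sub>C x)) * nrm (of_real t *\<^sub>C x) = t\<^sup>2 * nrm x * nrm (S x)"
      using x t by (simp add: H.norm_scale S_mem power2_eq_square)
    also have "t\<^sup>2 * nrm x * nrm (S x) = D\<^sup>2 * nrm (S x) / nrm x"
      using pos by (simp add: t_def field_simps power2_eq_square)
    also have "\<dots> \<le> 1" using less pos by simp
    finally have "of_real t *\<^sub>C x \<in> ?Y" using x by (simp add: F.mem)
    then have "nrm (of_real t *\<^sub>C x) \<le> B" by (rule B)
    moreover have "nrm (of_real t *\<^sub>C x) = t * nrm x" using x t by (simp add: H.norm_scale)
    moreover have "t * nrm x = D" using pos by (simp add: t_def)
    ultimately show False using D by simp
  qed
  then show ?thesis using that[of "D\<^sup>2"] D by simp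
qed

lemma S_inj:
  assumes "x \<in> V" "y \<in> V" "S x = S y"
  shows "x = y"
proof -
  obtain C where "\<And>x. x \<in> V \<Longrightarrow> nrm x \<le> C * nrm (S x)" using bounded_below by blast
  from this[of "x - y"] have "nrm (x - y) \<le> C * nrm (S x - S y)"
    using assms S_diff[OF assms(1,2)] by (simp add: F.mem)
  then have "nrm (x - y) \<le> 0" using assms(3) by simp
  then show ?thesis using H.norm_eq_0[of "x - y"] H.norm_ge_0[of "x - y"] assms by (simp add: F.mem)
qed

text \<open>The lower bound makes preimages of a convergent sequence Cauchy, so the range is closed.
  If \<open>z\<close> is orthogonal to it, symmetry gives \<open>[S (J z), y] = 0\<close> for all
  \<open>y\<close>, and injectivity gives \<open>z = 0\<close>.\<close>

lemma S_surj: "S ` V = V"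
proof (rule H.closed_subspace_eq_carrier)
  obtain C where C: "C > 0" "\<And>x. x \<in> V \<Longrightarrow> nrm x \<le> C * nrm (S x)" using bounded_below by blast
  have S0: "S 0 = 0" using S_scale[of 0 0] F.zero_mem by simp
  show "complex_vector.subspace (S ` V)"
  proof (rule complex_vector.subspaceI)
    show "0 \<in> S ` V" by (rule image_eqI[of _ _ 0]) (simp_all only: S0 F.zero_mem)
    show "x + y \<in> S ` V" if xy: "x \<in> S ` V" "y \<in> S ` V" for x y
    proof -
      obtain x' y' where "x = S x'" "y = S y'" "x' \<in> V" "y' \<in> V" using xy by (elim imageE)
      then show ?thesis
        by (intro image_eqI[of _ _ "x' + y'"]) (simp_all only: S_add F.add_mem)
    qed
    show "c *\<^sub>C x \<in> S ` V" if x: "x \<in> S ` V" for c x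
    proof -
      obtain x' where "x = S x'" "x' \<in> V" using x by (elim imageE)
      then show ?thesis
        by (intro image_eqI[of _ _ "c *\<^sub>C x'"]) (simp_all only: S_scale F.scale_mem)
    qed
  qed
  show "S ` V \<subseteq> V" using S_mem by (rule image_subsetI)
  show "z = 0" if z: "z \<in> V" and orth: "\<And>w. w \<in> S ` V \<Longrightarrow> kinner K z w = 0" for z
  proof -
    have Jz: "J z \<in> V" using z by (rule J_mem)
    have "form (S (J z)) y = 0" if y: "y \<in> V" for y
    proof -
      have "form (S (J z)) y = kinner K z (S y)"
        using S_sym[OF Jz y] form_J_left[OF z S_mem[OF y]] by simp
      then show ?thesis using orth y by simp
    qed
    then have "S (J z) = S 0" unfolding S0 by (rule eq_0I[OF S_mem[OF Jz]])
    then have "J z = 0" using S_inj[OF Jz F.zero_mem] by blast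
    then show ?thesis using H.norm_eq_0[OF z] nrm_J[OF z] by simp
  qed
  fix u l assume u: "\<And>n::nat. u n \<in> S ` V" and l: "l \<in> V" and lim: "(\<lambda>n. nrm (u n - l)) \<longlonglongrightarrow> 0"
  have "\<forall>n. \<exists>x\<in>V. u n = S x" using u by blast
  then obtain x where x: "\<And>n. x n \<in> V" "\<And>n. u n = S (x n)" by metis
  have uV: "u n \<in> V" for n using x by (simp add: S_mem)
  have le: "nrm (x i - x j) \<le> C * nrm (u i - u j)" for i j
    using C(2)[of "x i - x j"] x S_diff[OF x(1) x(1), of i j] by (simp add: F.mem)
  have "\<exists>N. \<forall>i\<ge>N. \<forall>j\<ge>N. nrm (x i - x j) < e" if e: "e > 0" for e
  proof -
    have "e / C > 0" using e C(1) by simp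
    then obtain N where N: "\<forall>i\<ge>N. \<forall>j\<ge>N. nrm (u i - u j) < e / C"
      using H.convergent_Cauchy[OF l uV lim] by blast
    have "nrm (x i - x j) < e" if "i \<ge> N" "j \<ge> N" for i j
    proof -
      have "nrm (u i - u j) < e / C" using N that by blast
      then have "C * nrm (u i - u j) < e" using C(1) by (simp add: field_simps)
      then show ?thesis using le[of i j] by linarith
    qed
    then show ?thesis by blast
  qed
  then obtain y where y: "y \<in> V" "(\<lambda>n. nrm (x n - y)) \<longlonglongrightarrow> 0"
    using H.complete[of x] x(1) by blast
  obtain D where D: "\<And>x. x \<in> V \<Longrightarrow> nrm (S x) \<le> D * nrm x"
    using bounded_S unfolding bounded_op_def carrier_khilbert by blast
  have "(\<lambda>n. nrm (u n - S y)) \<longlonglongrightarrow> 0"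
  proof (rule H.tendsto_if_norm_diff_le[OF uV S_mem[OF y(1)]])
    show "nrm (u n - S y) \<le> D * nrm (x n - y)" for n
      using D[of "x n - y"] S_diff[OF x(1) y(1), of n] x y by (simp add: F.mem)
    show "(\<lambda>n. D * nrm (x n - y)) \<longlonglongrightarrow> 0"
      using tendsto_mult[OF tendsto_const y(2), of D] by simp
  qed
  then have "l = S y"
    using uV by (intro H.tendsto_unique[OF l S_mem[OF y(1)] _ _ lim]) auto
  then show "l \<in> S ` V" using y by blast
qed

text \<open>The lower bound for \<open>S\<close> is the norm bound for the inverse, and injectivity
  makes the inverse linear.\<close>

lemma invertible_S: "invertible_op (khilbert K) S"
proof -
  define R where "R = inv_into V S"
  obtain C where C: "C > 0" "\<And>x. x \<in> V \<Longrightarrow> nrm x \<le> C * nrm (S x)" using bounded_below by blast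
  have R: "R y \<in> V" "S (R y) = y" if "y \<in> V" for y
    using that inv_into_into[of y S V] f_inv_into_f[of y S V] by (simp_all only: R_def S_surj)
  have RS: "R (S x) = x" if "x \<in> V" for x
    by (rule S_inj[OF R(1) that R(2)]) (simp_all only: S_mem that)
  have "R (x + y) = R x + R y" if "x \<in> V" "y \<in> V" for x y
    by (rule S_inj) (simp_all only: S_add R F.mem that)
  moreover have "R (a *\<^sub>C x) = a *\<^sub>C R x" if "x \<in> V" for a x
    by (rule S_inj) (simp_all only: S_scale R F.mem that)
  moreover have "nrm (R x) \<le> C * nrm x" if "x \<in> V" for x
    using C(2)[OF R(1)[OF that]] by (simp only: R(2)[OF that])
  ultimately have "bounded_op (khilbert K) (khilbert K) R"
    unfolding bounded_op_def carrier_khilbert using R(1) by blast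
  then show ?thesis
    unfolding invertible_op_def carrier_khilbert using bounded_S RS R by blast
qed

lemma ind_pos_S: "ind_pos K S = cdim (kpos K)"
proof -
  \<comment> \<open>\<open>G h\<close> is the preimage under \<open>S\<close> of the
    \<open>Mp\<close>-component of \<open>h\<close> along \<open>Mm\<close>; the uniqueness in
    \<open>uniq\<close> also yields its linearity.\<close>
  define G where "G h = (THE x. x \<in> V \<and> S x \<in> Mp \<and> h - S x \<in> Mm)" for h
  have uniq: "x = y" if "x \<in> V" "S x \<in> Mp" "h - S x \<in> Mm" "y \<in> V" "S y \<in> Mp" "h - S y \<in> Mm" for x y h
  proof -
    have "S x - S y \<in> Mp" using that(2,5) by (rule Mp.diff_mem)
    moreover have "S x - S y = (h - S y) - (h - S x)" by simp
    then have "S x - S y \<in> Mm" using Mm.diff_mem[OF that(6,3)] by (simp only:)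
    ultimately have "S x - S y = 0" by (rule Mp_Mm_eq_0)
    then show ?thesis using S_inj[OF that(1,4)] by simp
  qed
  have G: "G h \<in> V \<and> S (G h) \<in> Mp \<and> h - S (G h) \<in> Mm" if h: "h \<in> V" for h
    unfolding G_def
  proof (rule theI')
    have "h \<in> {m + k |m k. m \<in> Mp \<and> k \<in> Mm}" using h by (simp only: sum_Mp_Mm)
    then obtain m k where mk: "h = m + k" "m \<in> Mp" "k \<in> Mm" by blast
    have "m \<in> S ` V" using Mp_mem[OF mk(2)] by (simp only: S_surj)
    then obtain x where "x \<in> V" "m = S x" by blast
    then have "x \<in> V \<and> S x \<in> Mp \<and> h - S x \<in> Mm" using mk by (metis add_diff_cancel_left')
    then show "\<exists>!x. x \<in> V \<and> S x \<in> Mp \<and> h - S x \<in> Mm" using uniq by blast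
  qed
  obtain \<alpha> where \<alpha>: "\<alpha> > 0" "\<And>x. x \<in> Mp \<Longrightarrow> Re (form x x) \<ge> \<alpha> * (nrm x)\<^sup>2"
    using Mp by (auto simp: maximal_wrt_def unif_j_positive_def)
  obtain \<beta> where \<beta>: "\<beta> > 0" "\<And>x. x \<in> Mm \<Longrightarrow> - Re (form x x) \<ge> \<beta> * (nrm x)\<^sup>2"
    using Mm by (auto simp: maximal_wrt_def unif_j_positive_def)
  have herm: "hermitian_form V (\<lambda>x y. form (A x) y)"
    if A: "\<And>x. x \<in> V \<Longrightarrow> A x \<in> V" "\<And>x y. x \<in> V \<Longrightarrow> y \<in> V \<Longrightarrow> A (x + y) = A x + A y"
      "\<And>a x. x \<in> V \<Longrightarrow> A (a *\<^sub>C x) = a *\<^sub>C A x"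
      "\<And>x y. x \<in> V \<Longrightarrow> y \<in> V \<Longrightarrow> form (A x) y = form x (A y)" for A
    unfolding hermitian_form_def
  proof (intro conjI ballI allI)
    fix x y assume "x \<in> V" "y \<in> V"
    then show "form (A y) x = cnj (form (A x) y)" using F.sym[of "A x" y] A by simp
  qed (simp_all add: A(1-3) F.add_left F.scale_left)
  show ?thesis
  proof (rule ind_pos_eq_cdim[where L = "\<lambda>x. pp (Sp x)" and G = G])
    show "hermitian_form V (\<lambda>x y. form (S x) y)"
      by (rule herm) (simp_all only: S_mem S_add S_scale S_sym)
    show "complex_vector.subspace (kpos K)" by (rule P.sub)
    show "pp (Sp x) \<in> kpos K" if "x \<in> V" for x using that by (simp add: pp_mem Sp_mem)
    show "pp (Sp (x + y)) = pp (Sp x) + pp (Sp y)" if "x \<in> V" "y \<in> V" for x y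
      using that by (simp add: Sp_add pp_add Sp_mem)
    show "pp (Sp (a *\<^sub>C x)) = a *\<^sub>C pp (Sp x)" if "x \<in> V" for a x
      using that by (simp add: Sp_scale pp_scale Sp_mem)
    \<comment> \<open>If \<open>pp (Sp x) = 0\<close>, then \<open>Sp x\<close> lies in both
      \<open>Mp\<close> and \<open>kneg K\<close>, so it vanishes and
      \<open>[S x, x] = - [Sm x, x]\<close> is not positive.\<close>
    show "pp (Sp x) \<noteq> 0" if x: "x \<in> V" and pos: "0 < Re (form (S x) x)" for x
    proof
      assume p0: "pp (Sp x) = 0"
      have "Re (form (S x) x) = Re (form (Sp x) x) - Re (form (Sm x) x)"
        using x by (simp add: F.diff_left Sp_mem Sm_mem)
      then have "Re (form (Sp x) x) \<noteq> 0" using pos Sm_pos[OF x] by linarith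
      then have "Sp x \<noteq> 0" using F.zero_left[OF x] by auto
      then have "nrm (Sp x) \<noteq> 0" using H.norm_eq_0[of "Sp x"] x by (simp add: Sp_mem)
      then have "0 < \<alpha> * (nrm (Sp x))\<^sup>2" using \<alpha>(1) by simp
      moreover have "form (Sp x) (Sp x) = form (pn (Sp x)) (pn (Sp x))"
        using form_split[of "Sp x" "Sp x"] x p0 by (simp add: Sp_mem F.zero_left F.zero_mem)
      ultimately show False
        using \<alpha>(2)[OF Sp_range[OF x]] N.nonneg[of "pn (Sp x)"] x by (simp add: Sp_mem pn_mem)
    qed
    show "G x \<in> V" if "x \<in> kpos K" for x using G that by (simp add: kpos_mem)
    show "G (x + y) = G x + G y" if "x \<in> kpos K" "y \<in> kpos K" for x y
    proof -
      have V: "x \<in> V" "y \<in> V" "x + y \<in> V" using that by (simp_all add: kpos_mem F.mem)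
      have GV: "G x \<in> V" "G y \<in> V" using G V by simp_all
      have eq: "S (G x + G y) = S (G x) + S (G y)" using GV by (rule S_add)
      show ?thesis
      proof (rule uniq[where h = "x + y"])
        show "G x + G y \<in> V" using GV by (rule F.add_mem)
        show "S (G x + G y) \<in> Mp" unfolding eq using G V by (simp add: Mp.mem)
        have "x + y - S (G x + G y) = (x - S (G x)) + (y - S (G y))" unfolding eq by simp
        also have "\<dots> \<in> Mm" using G V by (intro Mm.add_mem) blast+
        finally show "x + y - S (G x + G y) \<in> Mm" .
      qed (use G[OF V(3)] in blast)+
    qed
    show "G (a *\<^sub>C x) = a *\<^sub>C G x" if "x \<in> kpos K" for a x
    proof -
      have V: "x \<in> V" "a *\<^sub>C x \<in> V" using that by (simp_all add: kpos_mem F.mem)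
      have GV: "G x \<in> V" using G V by simp
      have eq: "S (a *\<^sub>C G x) = a *\<^sub>C S (G x)" using GV by (rule S_scale)
      show ?thesis
      proof (rule uniq[where h = "a *\<^sub>C x"])
        show "a *\<^sub>C G x \<in> V" using GV by (rule F.scale_mem)
        show "S (a *\<^sub>C G x) \<in> Mp" unfolding eq using G V by (intro Mp.scale_mem) blast
        have "a *\<^sub>C x - S (a *\<^sub>C G x) = a *\<^sub>C (x - S (G x))"
          unfolding eq by (simp add: complex_vector.scale_right_diff_distrib)
        also have "\<dots> \<in> Mm" using G V by (intro Mm.scale_mem) blast
        finally show "a *\<^sub>C x - S (a *\<^sub>C G x) \<in> Mm" .
      qed (use G[OF V(2)] in blast)+
    qed
    \<comment> \<open>For \<open>x = G h\<close> both \<open>S x\<close> and \<open>Sp x\<close> are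
      in \<open>Mp\<close>, hence so is \<open>Sm x\<close>, which therefore vanishes, and
      \<open>[S x, x] = [Sp x, x]\<close>. If this were 0, then \<open>Sp x = 0\<close> and
      \<open>S x = 0\<close>, leaving \<open>h\<close> in both \<open>Mm\<close> and
      \<open>kpos K\<close>.\<close>
    show "0 < Re (form (S (G h)) (G h))" if h: "h \<in> kpos K" "h \<noteq> 0" for h
    proof (rule ccontr)
      assume np: "\<not> 0 < Re (form (S (G h)) (G h))"
      define x where "x = G h"
      have hV: "h \<in> V" using h by (simp add: kpos_mem)
      have x: "x \<in> V" "S x \<in> Mp" "h - S x \<in> Mm" using G[OF hV] by (simp_all add: x_def)
      have "Sp x - S x \<in> Mp" using Sp_range[OF x(1)] x(2) by (rule Mp.diff_mem)
      then have "Sm x \<in> Mp" by simp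
      then have "Sm x = 0" using Sm_range[OF x(1)] Mp_Mm_eq_0 by blast
      then have null: "Re (form (Sp x) x) = 0"
        using np Sp_pos[OF x(1)] by (simp add: x_def)
      interpret Sp: hermitian_space V "\<lambda>x y. form (Sp x) y"
        by unfold_locales (rule F.sub, rule herm, simp_all only: Sp_mem Sp_add Sp_scale Sp_sym)
      have "form (Sp w) x = 0" if "w \<in> V" for w
        using Sp.null_vector_orthogonal[OF F.sub subset_refl _ x(1) null that] Sp_pos by blast
      then have "form (Sp x) w = 0" if "w \<in> V" for w
        using that F.sym[OF Sp_mem[OF that] x(1)] Sp_sym[OF x(1) that] by simp
      then have "Sp x = 0" by (rule eq_0I[OF Sp_mem[OF x(1)]])
      then have "h \<in> Mm" using x(3) \<open>Sm x = 0\<close> by simp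
      then have "\<beta> * (nrm h)\<^sup>2 \<le> 0" using \<beta>(2)[of h] P.nonneg[OF h(1)] by linarith
      then have "nrm h = 0" using \<beta>(1) by (simp add: mult_le_0_iff)
      then show False using h(2) H.norm_eq_0[OF hV] by simp
    qed
  qed
qed

text \<open>In the anti-space \<open>- Sm\<close> and \<open>- Sp\<close> take the roles of
  \<open>Sp\<close> and \<open>Sm\<close>: the sign of the operator cancels that of the form, and
  the difference is again \<open>S\<close>. Moreover \<open>[- S x, y]\<close> in \<open>K\<close>
  is \<open>[S x, y]\<close> in the anti-space.\<close>

lemma ind_neg_S: "ind_neg K S = cdim (kneg K)"
proof -
  interpret anti: krein_splitting "anti_krein K" Mm Mp "\<lambda>x. - Sm x" "\<lambda>x. - Sp x"
  proof (rule krein_splitting.intro)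
    show "krein (anti_krein K)" by (rule krein_anti_krein) (rule krein_axioms)
    have neg: "bounded_op (khilbert K) (khilbert K) (\<lambda>x. - A x)"
      if A: "bounded_op (khilbert K) (khilbert K) A" for A
    proof -
      have "A x \<in> V" if "x \<in> V" for x using A that by (simp add: bounded_op_def)
      then show ?thesis
        using A by (auto simp: bounded_op_def F.mem H.norm_uminus complex_vector.scale_minus_right)
    qed
    show "krein_splitting_axioms (anti_krein K) Mm Mp (\<lambda>x. - Sm x) (\<lambda>x. - Sp x)"
      by unfold_locales
        (use Mp Mm neg[OF bounded_Sp] neg[OF bounded_Sm] Sp_range Sm_range Sp_sym Sm_sym
          Sp_pos Sm_pos Mp_dominated Mm_dominated
         in \<open>simp_all add: Mp.mem Mm.mem F.neg_left F.neg_right Sp_mem Sm_mem\<close>)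
  qed
  have "ind_pos K (\<lambda>x. - S x) = ind_pos (anti_krein K) (\<lambda>x. - Sm x - - Sp x)"
    by (rule ind_pos_cong) (simp_all add: F.neg_left F.diff_left F.mem Sp_mem Sm_mem)
  also have "\<dots> = cdim (kneg K)" using anti.ind_pos_S by simp
  finally show ?thesis by (simp add: ind_neg_def)
qed

end

section \<open>Bessel families\<close>

text \<open>Free of the frame property, so that it can be instantiated with the given synthesis
  operator and with the one whose existence \<open>j_frame\<close> asserts.\<close>

locale bessel_synthesis = krein K for K :: "'a::complex_vector krein" +
  fixes I :: "'i set" and f :: "'i \<Rightarrow> 'a" and T :: "('i \<Rightarrow> complex) \<Rightarrow> 'a"
  assumes bessel: "bessel_family K I f" and synthesis: "synthesis_op K I f T"
begin

abbreviation "seqs \<equiv> hcarrier (ell2 I)"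

lemma f_mem: "i \<in> I \<Longrightarrow> f i \<in> V"
  using bessel by (simp add: bessel_family_def)

lemma T_mem: "c \<in> seqs \<Longrightarrow> T c \<in> V"
  and T_add: "c \<in> seqs \<Longrightarrow> d \<in> seqs \<Longrightarrow> T (c + d) = T c + T d"
  and T_scale: "c \<in> seqs \<Longrightarrow> T (a *\<^sub>C c) = a *\<^sub>C T c"
  and T_unit_seq: "i \<in> I \<Longrightarrow> T (unit_seq i) = f i"
  using synthesis by (simp_all add: synthesis_op_def bounded_op_def)

lemma T_norm_le: obtains C where "C \<ge> 0" "\<And>c. c \<in> seqs \<Longrightarrow> nrm (T c) \<le> C * hnorm (ell2 I) c"
proof -
  obtain C where C: "\<And>c. c \<in> seqs \<Longrightarrow> nrm (T c) \<le> C * hnorm (ell2 I) c"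
    using synthesis unfolding synthesis_op_def bounded_op_def by blast
  have "nrm (T c) \<le> \<bar>C\<bar> * hnorm (ell2 I) c" if "c \<in> seqs" for c
  proof -
    have "C * hnorm (ell2 I) c \<le> \<bar>C\<bar> * hnorm (ell2 I) c"
      by (intro mult_right_mono) (auto simp: ell2_norm intro!: infsum_nonneg)
    then show ?thesis using C[OF that] by linarith
  qed
  then show ?thesis using that[of "\<bar>C\<bar>"] by simp
qed

lemma T_restr_finite:
  assumes "finite F" "F \<subseteq> I" and c: "c \<in> seqs"
  shows "T (restr F c) = (\<Sum>i\<in>F. c i *\<^sub>C f i)"
  using assms(1,2)
proof (induction F rule: finite_induct)
  case empty
  have "restr {} c = 0 *\<^sub>C c" by (auto simp: restr_def)
  then have "T (restr {} c) = 0 *\<^sub>C T c" using T_scale[OF c, of 0] by (simp only:)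
  then show ?case by simp
next
  case (insert i F)
  have "restr (insert i F) c = c i *\<^sub>C unit_seq i + restr F c"
    using insert(2) by (auto simp: restr_def unit_seq_def scaleC_fun_def scaleC_complex_def fun_eq_iff)
  then have "T (restr (insert i F) c) = c i *\<^sub>C f i + T (restr F c)"
    using insert(4) c by (simp add: T_add T_scale T_unit_seq ell2_scale unit_seq_mem restr_mem)
  then show ?case using insert by simp
qed

text \<open>\<open>T\<close> is bounded, so the error of a finite partial sum is at most a multiple
  of the \<open>ell2\<close> norm of the discarded coordinates, the tail of a convergent
  sum.\<close>

lemma T_has_hsum:
  assumes c: "c \<in> seqs"
  shows "has_hsum (khilbert K) (\<lambda>i. c i *\<^sub>C f i) I (T c)"
proof -
  obtain C where C: "C \<ge> 0" "\<And>c. c \<in> seqs \<Longrightarrow> nrm (T c) \<le> C * hnorm (ell2 I) c"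
    using T_norm_le by blast
  define q where "q i = (cmod (c i))\<^sup>2" for i
  have q: "q summable_on I" using c unfolding q_def[abs_def] by (simp add: ell2_mem)
  then have "(sum q \<longlongrightarrow> infsum q I) (finite_subsets_at_top I)" by (rule infsum_tendsto)
  then have "((\<lambda>F. C * sqrt (infsum q I - sum q F)) \<longlongrightarrow> C * sqrt (infsum q I - infsum q I))
      (finite_subsets_at_top I)"
    by (intro tendsto_intros)
  then have lim: "((\<lambda>F. C * sqrt (infsum q I - sum q F)) \<longlongrightarrow> 0) (finite_subsets_at_top I)"
    by simp
  have le: "nrm ((\<Sum>i\<in>F. c i *\<^sub>C f i) - T c) \<le> C * sqrt (infsum q I - sum q F)"
    if F: "finite F" "F \<subseteq> I" for F
  proof -
    have rest: "restr (- F) c \<in> seqs" "restr F c \<in> seqs" using c by (simp_all add: restr_mem)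
    have "c = restr F c + restr (- F) c" by (auto simp: restr_def)
    then have "T c = T (restr F c) + T (restr (- F) c)" using T_add[OF rest(2,1)] by simp
    then have "(\<Sum>i\<in>F. c i *\<^sub>C f i) - T c = - T (restr (- F) c)"
      using T_restr_finite[OF F c] by simp
    then have "nrm ((\<Sum>i\<in>F. c i *\<^sub>C f i) - T c) = nrm (T (restr (- F) c))"
      using T_mem[OF rest(1)] by (simp add: H.norm_uminus)
    also have "\<dots> \<le> C * hnorm (ell2 I) (restr (- F) c)" by (rule C(2)[OF rest(1)])
    also have "(\<Sum>\<^sub>\<infinity>i\<in>I. (cmod (restr (- F) c i))\<^sup>2) = infsum q (I - F)"
      by (intro infsum_cong_neutral) (auto simp: restr_def q_def)
    then have "hnorm (ell2 I) (restr (- F) c) = sqrt (infsum q I - sum q F)"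
      using infsum_Diff[OF q _ F(2)] F(1) by (simp add: ell2_norm)
    finally show ?thesis .
  qed
  have "((\<lambda>F. nrm ((\<Sum>i\<in>F. c i *\<^sub>C f i) - T c)) \<longlongrightarrow> 0) (finite_subsets_at_top I)"
  proof (rule tendsto_sandwich[OF _ _ tendsto_const lim])
    show "\<forall>\<^sub>F F in finite_subsets_at_top I. 0 \<le> nrm ((\<Sum>i\<in>F. c i *\<^sub>C f i) - T c)"
      by (intro eventually_finite_subsets_at_top_weakI H.norm_ge_0 F.diff_mem F.sum_mem F.scale_mem
          f_mem T_mem c) auto
    show "\<forall>\<^sub>F F in finite_subsets_at_top I.
        nrm ((\<Sum>i\<in>F. c i *\<^sub>C f i) - T c) \<le> C * sqrt (infsum q I - sum q F)"
      using le by (intro eventually_finite_subsets_at_top_weakI)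
  qed
  then show ?thesis using T_mem[OF c] by (simp add: has_hsum_def)
qed

lemma form_T:
  assumes c: "c \<in> seqs" and x: "x \<in> V"
  shows "((\<lambda>i. c i * form (f i) x) has_sum form (T c) x) I"
proof -
  have "((\<lambda>F. nrm ((\<Sum>i\<in>F. c i *\<^sub>C f i) - T c)) \<longlongrightarrow> 0) (finite_subsets_at_top I)"
    using T_has_hsum[OF c] by (simp add: has_hsum_def)
  then have "((\<lambda>F. (\<Sum>i\<in>F. c i * form (f i) x) - form (T c) x) \<longlongrightarrow> 0) (finite_subsets_at_top I)"
  proof (rule tendsto_0_le[where K = "nrm x"], intro eventually_finite_subsets_at_top_weakI)
    fix F assume F: "finite F" "F \<subseteq> I"
    have mem: "(\<Sum>i\<in>F. c i *\<^sub>C f i) \<in> V"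
      using F(2) by (intro F.sum_mem F.scale_mem f_mem) auto
    have "(\<Sum>i\<in>F. c i * form (f i) x) = form (\<Sum>i\<in>F. c i *\<^sub>C f i) x"
      using F(2) x by (subst F.sum_left) (auto simp: F.scale_left F.scale_mem f_mem intro!: sum.cong)
    then have "(\<Sum>i\<in>F. c i * form (f i) x) - form (T c) x = form ((\<Sum>i\<in>F. c i *\<^sub>C f i) - T c) x"
      using mem T_mem[OF c] x by (simp add: F.diff_left)
    then show "norm ((\<Sum>i\<in>F. c i * form (f i) x) - form (T c) x)
        \<le> norm (nrm ((\<Sum>i\<in>F. c i *\<^sub>C f i) - T c)) * nrm x"
      using form_le[OF F.diff_mem[OF mem T_mem[OF c]] x] H.norm_ge_0[OF F.diff_mem[OF mem T_mem[OF c]]]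
      by simp
  qed
  then show ?thesis unfolding has_sum_def by (rule LIM_zero_cancel)
qed

section \<open>The operators attached to a set of indices\<close>

text \<open>Coordinates of the \<open>J\<close>-adjoint of \<open>T\<close> cut down to
  \<open>D\<close>, before \<open>ell2_sym\<close> applies the signs.\<close>

definition pairing :: "'i set \<Rightarrow> 'a \<Rightarrow> 'i \<Rightarrow> complex"
  where "pairing D x = (\<lambda>i. if i \<in> D then form x (f i) else 0)"

text \<open>With \<open>D\<close> the positive or the negative indices this is \<open>S+\<close> or
  \<open>S-\<close>.\<close>

definition part :: "'i set \<Rightarrow> 'a \<Rightarrow> 'a"
  where "part D x = T (pairing D x)"

context
  fixes D assumes D: "D \<subseteq> I"
begin

text \<open>The Bessel inequality concerns \<open>kinner\<close>; applied to the isometric image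
  \<open>J x\<close> it bounds the coefficients \<open>[x, f i]\<close>.\<close>

lemma pairing_bound:
  obtains B where "B \<ge> 0" "\<And>x. x \<in> V \<Longrightarrow> pairing D x \<in> seqs \<and> hnorm (ell2 I) (pairing D x) \<le> B * nrm x"
proof -
  obtain B where B: "\<And>g. g \<in> V \<Longrightarrow> (\<lambda>i. (cmod (kinner K g (f i)))\<^sup>2) summable_on I \<and>
       (\<Sum>\<^sub>\<infinity>i\<in>I. (cmod (kinner K g (f i)))\<^sup>2) \<le> B * (nrm g)\<^sup>2"
    using bessel unfolding bessel_family_def by blast
  have *: "pairing D x \<in> seqs \<and> hnorm (ell2 I) (pairing D x) \<le> sqrt \<bar>B\<bar> * nrm x" if x: "x \<in> V" for x
  proof -
    have "(cmod (form x (f i)))\<^sup>2 = (cmod (kinner K (J x) (f i)))\<^sup>2" if "i \<in> I" for i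
      using kinner_J_left[OF x f_mem[OF that]] by simp
    then have sum: "(\<lambda>i. (cmod (form x (f i)))\<^sup>2) summable_on I"
      and le: "(\<Sum>\<^sub>\<infinity>i\<in>I. (cmod (form x (f i)))\<^sup>2) \<le> B * (nrm x)\<^sup>2"
      using B[OF J_mem[OF x]] nrm_J[OF x]
      by (simp_all cong: summable_on_cong infsum_cong)
    have sumD: "(\<lambda>i. (cmod (pairing D x i))\<^sup>2) summable_on I"
      by (rule summable_on_comparison_test[OF sum]) (auto simp: pairing_def)
    have "(\<Sum>\<^sub>\<infinity>i\<in>I. (cmod (pairing D x i))\<^sup>2) \<le> (\<Sum>\<^sub>\<infinity>i\<in>I. (cmod (form x (f i)))\<^sup>2)"
      by (rule infsum_mono[OF sumD sum]) (auto simp: pairing_def)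
    also have "\<dots> \<le> \<bar>B\<bar> * (nrm x)\<^sup>2"
      by (rule order_trans[OF le]) (intro mult_right_mono, auto)
    finally have "hnorm (ell2 I) (pairing D x) \<le> sqrt \<bar>B\<bar> * nrm x"
      using real_sqrt_le_mono H.norm_ge_0[OF x] by (fastforce simp: ell2_norm real_sqrt_mult)
    moreover have "pairing D x \<in> seqs" using sumD D by (auto simp: ell2_mem pairing_def)
    ultimately show ?thesis by blast
  qed
  show ?thesis by (rule that[of "sqrt \<bar>B\<bar>"]) (use * in auto)
qed

lemma pairing_mem: "x \<in> V \<Longrightarrow> pairing D x \<in> seqs"
  using pairing_bound by blast

lemma part_mem: "x \<in> V \<Longrightarrow> part D x \<in> V"
  unfolding part_def by (intro T_mem pairing_mem)

lemma part_range: "x \<in> V \<Longrightarrow> part D x \<in> T ` hcarrier (ell2 D)"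
  unfolding part_def
  by (intro imageI) (simp add: ell2_subset_iff[OF D] pairing_mem, simp add: pairing_def)

lemma bounded_part: "bounded_op (khilbert K) (khilbert K) (part D)"
proof -
  obtain C where C: "C \<ge> 0" "\<And>c. c \<in> seqs \<Longrightarrow> nrm (T c) \<le> C * hnorm (ell2 I) c"
    using T_norm_le by blast
  obtain B where B: "B \<ge> 0" "\<And>x. x \<in> V \<Longrightarrow> hnorm (ell2 I) (pairing D x) \<le> B * nrm x"
    using pairing_bound by metis
  have "nrm (part D x) \<le> C * B * nrm x" if x: "x \<in> V" for x
  proof -
    have "nrm (part D x) \<le> C * hnorm (ell2 I) (pairing D x)"
      unfolding part_def by (rule C(2)[OF pairing_mem[OF x]])
    also have "\<dots> \<le> C * (B * nrm x)" by (intro mult_left_mono B(2) C(1) x)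
    finally show ?thesis by (simp add: mult.assoc)
  qed
  moreover have "part D (x + y) = part D x + part D y" if "x \<in> V" "y \<in> V" for x y
  proof -
    have "pairing D (x + y) = pairing D x + pairing D y"
      using that D f_mem by (auto simp: pairing_def fun_eq_iff F.add_left subset_iff)
    then show ?thesis using that by (simp add: part_def T_add pairing_mem)
  qed
  moreover have "part D (a *\<^sub>C x) = a *\<^sub>C part D x" if "x \<in> V" for a x
  proof -
    have "pairing D (a *\<^sub>C x) = a *\<^sub>C pairing D x"
      using that D f_mem
      by (auto simp: pairing_def fun_eq_iff F.scale_left scaleC_fun_def scaleC_complex_def subset_iff)
    then show ?thesis using that by (simp add: part_def T_scale pairing_mem)
  qed
  ultimately show ?thesis
    unfolding bounded_op_def carrier_khilbert using part_mem by blast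
qed

text \<open>Both sides are the sum of \<open>[x, f i] [f i, y]\<close> over
  \<open>D\<close>.\<close>

lemma part_sym:
  assumes x: "x \<in> V" and y: "y \<in> V"
  shows "form (part D x) y = form x (part D y)"
proof -
  have "((\<lambda>i. cnj (pairing D y i * form (f i) x)) has_sum cnj (form (part D y) x)) I"
    unfolding part_def has_sum_cnj_iff by (rule form_T[OF pairing_mem[OF y] x])
  moreover have "cnj (pairing D y i * form (f i) x) = pairing D x i * form (f i) y" if i: "i \<in> I" for i
    using F.sym[OF x f_mem[OF i]] F.sym[OF y f_mem[OF i]] by (simp add: pairing_def)
  ultimately have "((\<lambda>i. pairing D x i * form (f i) y) has_sum cnj (form (part D y) x)) I"
    by (simp cong: has_sum_cong)
  moreover have "((\<lambda>i. pairing D x i * form (f i) y) has_sum form (part D x) y) I"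
    unfolding part_def by (rule form_T[OF pairing_mem[OF x] y])
  ultimately have "form (part D x) y = cnj (form (part D y) x)"
    by (metis has_sum_unique)
  then show ?thesis using F.sym[OF part_mem[OF y] x] by simp
qed

text \<open>The quadratic form is the squared \<open>ell2\<close> norm of the coefficients;
  positivity and the domination estimate both rest on this.\<close>

lemma part_self:
  assumes x: "x \<in> V"
  shows "form (part D x) x = of_real (\<Sum>\<^sub>\<infinity>i\<in>I. (cmod (pairing D x i))\<^sup>2)"
proof -
  have "((\<lambda>i. pairing D x i * form (f i) x) has_sum form (part D x) x) I"
    unfolding part_def by (rule form_T[OF pairing_mem[OF x] x])
  moreover have "pairing D x i * form (f i) x = of_real ((cmod (pairing D x i))\<^sup>2)" if i: "i \<in> I" for i
    using F.sym[OF x f_mem[OF i]] complex_norm_square[of "form x (f i)"] by (simp add: pairing_def)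
  ultimately have "((\<lambda>i. of_real ((cmod (pairing D x i))\<^sup>2)) has_sum form (part D x) x) I"
    by (simp cong: has_sum_cong)
  moreover have "((\<lambda>i. complex_of_real ((cmod (pairing D x i))\<^sup>2)) has_sum
      of_real (\<Sum>\<^sub>\<infinity>i\<in>I. (cmod (pairing D x i))\<^sup>2)) I"
    using pairing_mem[OF x] by (intro has_sum_of_real has_sum_infsum) (simp add: ell2_mem)
  ultimately show ?thesis by (rule has_sum_unique)
qed

lemma part_nonneg: "x \<in> V \<Longrightarrow> Re (form (part D x) x) \<ge> 0"
  by (simp add: part_self infsum_nonneg)

lemma part_j_positive: "j_positive K (part D)"
  unfolding j_positive_def
  by (auto simp: bounded_part part_self nonneg_Reals_of_real_iff infsum_nonneg)

text \<open>Termwise \<open>|c| |p| <= |c|^2 + |p|^2\<close> splits the pairing into a constant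
  depending on \<open>c\<close> only and, by \<open>part_self\<close>, the quadratic form.\<close>

lemma part_dominates:
  assumes y: "y \<in> T ` hcarrier (ell2 D)"
  shows "\<exists>C. \<forall>x\<in>V. cmod (form y x) \<le> C + Re (form (part D x) x)"
proof -
  obtain c where c: "y = T c" "c \<in> seqs" "\<And>i. i \<notin> D \<Longrightarrow> c i = 0"
    using y by (auto simp: ell2_subset_iff[OF D])
  let ?q = "\<lambda>i. (cmod (c i))\<^sup>2"
  have q: "?q summable_on I" using c(2) by (simp add: ell2_mem)
  have "cmod (form y x) \<le> infsum ?q I + Re (form (part D x) x)" if x: "x \<in> V" for x
  proof -
    let ?r = "\<lambda>i. (cmod (pairing D x i))\<^sup>2"
    have r: "?r summable_on I" using pairing_mem[OF x] by (simp add: ell2_mem)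
    have le: "norm (c i * form (f i) x) \<le> ?q i + ?r i" if i: "i \<in> I" for i
    proof (cases "i \<in> D")
      case True
      have "cmod (form (f i) x) = cmod (pairing D x i)"
        using True F.sym[OF x f_mem[OF i]] by (simp add: pairing_def)
      then have eq: "norm (c i * form (f i) x) = cmod (c i) * cmod (pairing D x i)"
        by (simp add: norm_mult)
      show ?thesis
        unfolding eq using sum_squares_bound[of "cmod (c i)" "cmod (pairing D x i)"]
          mult_nonneg_nonneg[OF norm_ge_zero[of "c i"] norm_ge_zero[of "pairing D x i"]]
        by linarith
    qed (simp add: c(3))
    have qr: "(\<lambda>i. ?q i + ?r i) summable_on I" using q r by (rule summable_on_add)
    have abs: "(\<lambda>i. norm (c i * form (f i) x)) summable_on I"
      by (rule abs_summable_on_comparison_test'[OF qr le])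
    have "form y x = (\<Sum>\<^sub>\<infinity>i\<in>I. c i * form (f i) x)"
      unfolding c(1) by (rule infsumI[symmetric, OF form_T[OF c(2) x]])
    also have "cmod \<dots> \<le> (\<Sum>\<^sub>\<infinity>i\<in>I. norm (c i * form (f i) x))"
      by (rule norm_infsum_bound[OF abs])
    also have "\<dots> \<le> (\<Sum>\<^sub>\<infinity>i\<in>I. ?q i + ?r i)" by (rule infsum_mono[OF abs qr le])
    also have "\<dots> = infsum ?q I + infsum ?r I" by (rule infsum_add[OF q r])
    also have "infsum ?r I = Re (form (part D x) x)" by (simp add: part_self[OF x])
    finally show ?thesis .
  qed
  then show ?thesis by blast
qed

text \<open>The \<open>J\<close> applied first in the adjoint turns \<open>kinner\<close> into
  \<open>form\<close>, and \<open>ell2_sym\<close> adds the signs. The hypothesis on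
  \<open>A\<close> covers \<open>T\<close> with \<open>D = I\<close> as well as \<open>Tp\<close>
  and \<open>Tm\<close>.\<close>

lemma jadjoint_eq:
  assumes A: "\<And>c. c \<in> seqs \<Longrightarrow> A c = T (restr D c)" and x: "x \<in> V"
  shows "ell2_jadjoint K I f A x = (\<lambda>i. sig K I f i * pairing D x i)"
proof -
  have "hadjoint (ell2 I) (khilbert K) A (J x) = pairing D x"
  proof (rule hadjoint_ell2[OF pairing_mem[OF x]])
    fix z assume z: "z \<in> seqs"
    have "kinner K (A z) (J x) = form (T (restr D z)) x"
      unfolding A[OF z] using T_mem[OF restr_mem[OF z]] x by (rule kinner_J_right)
    also have "\<dots> = (\<Sum>\<^sub>\<infinity>i\<in>I. restr D z i * form (f i) x)"
      by (rule infsumI[symmetric, OF form_T[OF restr_mem[OF z] x]])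
    also have "\<dots> = (\<Sum>\<^sub>\<infinity>i\<in>I. z i * cnj (pairing D x i))"
      using F.sym[OF x f_mem] by (intro infsum_cong) (simp add: restr_def pairing_def)
    finally show "hinner (khilbert K) (A z) (J x) = hinner (ell2 I) z (pairing D x)"
      by (simp add: ell2_inner)
  qed
  then show ?thesis by (simp add: ell2_jadjoint_def jadjoint_def ell2_sym_def)
qed

end

lemma synth_eq:
  assumes D: "D \<subseteq> I"
  shows "c \<in> seqs \<Longrightarrow> (T \<circ> orth_proj (ell2 I) (hcarrier (ell2 D))) c = T (restr D c)"
    and "(T \<circ> orth_proj (ell2 I) (hcarrier (ell2 D))) ` seqs = T ` hcarrier (ell2 D)"
proof -
  show *: "(T \<circ> orth_proj (ell2 I) (hcarrier (ell2 D))) c = T (restr D c)" if "c \<in> seqs" for c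
    by (simp add: orth_proj_ell2[OF D that])
  have "restr D c \<in> hcarrier (ell2 D)" if "c \<in> seqs" for c
    unfolding ell2_subset_iff[OF D] using restr_mem[OF that] by (simp add: restr_def)
  moreover have "c \<in> seqs" "restr D c = c" if "c \<in> hcarrier (ell2 D)" for c
    using that D by (auto simp: ell2_subset_iff restr_def)
  ultimately have "restr D ` seqs = hcarrier (ell2 D)"
    by (intro equalityI image_subsetI subsetI) (auto intro: image_eqI[OF sym])
  then show "(T \<circ> orth_proj (ell2 I) (hcarrier (ell2 D))) ` seqs = T ` hcarrier (ell2 D)"
    using * by (metis (no_types, lifting) image_cong image_image)
qed

text \<open>Both values are the same unconditional sum. Hence the ranges in the definition of
  \<open>j_frame\<close> are those of the given \<open>T\<close>.\<close>

lemma synthesis_unique: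
  assumes "synthesis_op K I f T'" "c \<in> seqs"
  shows "T' c = T c"
proof -
  interpret T': bessel_synthesis K I f T'
    using bessel assms(1) by unfold_locales
  have mem: "c i *\<^sub>C f i \<in> V" if "i \<in> I" for i using that by (intro F.scale_mem f_mem)
  show ?thesis
    using H.hsum_eqI[OF T_has_hsum[OF assms(2)] mem] H.hsum_eqI[OF T'.T_has_hsum[OF assms(2)] mem]
    by simp
qed

end

section \<open>The \<open>J\<close>-frame operator\<close>

theorem proposition5p1:
  fixes K :: "'a::complex_vector krein"
    and I :: "'i set"
    and f :: "'i \<Rightarrow> 'a"
    and T Tp Tm :: "('i \<Rightarrow> complex) \<Rightarrow> 'a"
    and S Sp Sm :: "'a \<Rightarrow> 'a"
  assumes "krein_space K"
    and "separable_space (khilbert K)"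
    and "j_frame K I f"
    and "synthesis_op K I f T"
    and "Tp = synth_pos K I f T"
    and "Tm = synth_neg K I f T"
    and "S = j_frame_op K I f"
    and "Sp = (\<lambda>x. Tp (ell2_jadjoint K I f Tp x))"
    and "Sm = (\<lambda>x. - Tm (ell2_jadjoint K I f Tm x))"
  shows "bounded_op (khilbert K) (khilbert K) S \<and>
    (\<forall>x\<in>kcarrier K. S x = T (ell2_jadjoint K I f T x)) \<and>
    ((\<forall>x\<in>kcarrier K. S x = Sp x - Sm x) \<and> j_positive K Sp \<and> j_positive K Sm) \<and>
    (invertible_op (khilbert K) S \<and> j_selfadjoint K S) \<and>
    (ind_pos K S = cdim (kpos K) \<and> ind_neg K S = cdim (kneg K))"
proof -
  interpret bessel_synthesis K I f T
    using assms(1,3,4) by unfold_locales (simp_all add: j_frame_def)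
  define Ip where "Ip = idx_pos K I f"
  define Im where "Im = idx_neg K I f"
  have Ip: "Ip \<subseteq> I" and Im: "Im \<subseteq> I" and I: "i \<in> I \<Longrightarrow> i \<in> Im \<longleftrightarrow> i \<notin> Ip" for i
    by (auto simp: Ip_def Im_def idx_pos_def idx_neg_def)
  have sig: "sig K I f i = (if i \<in> Ip then 1 else - 1)" for i
    by (simp add: sig_def Ip_def)
  have Tp: "Tp = T \<circ> orth_proj (ell2 I) (hcarrier (ell2 Ip))"
    and Tm: "Tm = T \<circ> orth_proj (ell2 I) (hcarrier (ell2 Im))"
    by (simp_all add: assms(5,6) synth_pos_def synth_neg_def Ip_def Im_def)
  have T_pairing: "T (restr D (pairing D' x)) = part (D \<inter> D') x" for D D' x
    unfolding part_def by (intro arg_cong[of _ _ T]) (auto simp: restr_def pairing_def)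
  have Sp: "Sp x = part Ip x" if x: "x \<in> V" for x
  proof -
    have "ell2_jadjoint K I f Tp x = pairing Ip x"
      unfolding Tp by (subst jadjoint_eq[OF Ip synth_eq(1)[OF Ip] x]) (auto simp: sig pairing_def)
    then show ?thesis
      using synth_eq(1)[OF Ip pairing_mem[OF Ip x]] by (simp add: assms(8) Tp T_pairing)
  qed
  \<comment> \<open>On \<open>Im\<close> the symmetry of the sequence space contributes -1, which
    cancels the minus sign in the definition of \<open>Sm\<close>.\<close>
  have Sm: "Sm x = part Im x" if x: "x \<in> V" for x
  proof -
    have "ell2_jadjoint K I f Tm x = (- 1) *\<^sub>C pairing Im x"
      unfolding Tm using Im I
      by (subst jadjoint_eq[OF Im synth_eq(1)[OF Im] x])
        (auto simp: sig pairing_def scaleC_fun_def scaleC_complex_def fun_eq_iff)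
    moreover have "Tm ((- 1) *\<^sub>C pairing Im x) = T ((- 1) *\<^sub>C pairing Im x)"
    proof -
      have "restr Im ((- 1) *\<^sub>C pairing Im x) = (- 1) *\<^sub>C pairing Im x"
        by (auto simp: restr_def pairing_def scaleC_fun_def scaleC_complex_def)
      then show ?thesis
        unfolding Tm using synth_eq(1)[OF Im ell2_scale[OF pairing_mem[OF Im x]]] by metis
    qed
    moreover have "T (- pairing Im x) = - part Im x"
      using T_scale[OF pairing_mem[OF Im x], of "- 1"] by (simp add: part_def)
    ultimately show ?thesis by (simp add: assms(9))
  qed
  have adj: "ell2_jadjoint K I f T x = pairing Ip x + (- 1) *\<^sub>C pairing Im x" if x: "x \<in> V" for x
  proof -
    have "T c = T (restr I c)" if "c \<in> seqs" for c
      using that by (intro arg_cong[of _ _ T]) (auto simp: restr_def ell2_mem)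
    then show ?thesis
      using Ip Im I by (subst jadjoint_eq[OF subset_refl _ x])
        (auto simp: sig pairing_def scaleC_fun_def scaleC_complex_def fun_eq_iff)
  qed
  have TT: "T (ell2_jadjoint K I f T x) = part Ip x - part Im x" if x: "x \<in> V" for x
    unfolding adj[OF x] part_def
      T_add[OF pairing_mem[OF Ip x] ell2_scale[OF pairing_mem[OF Im x]]]
      T_scale[OF pairing_mem[OF Im x]]
    by simp
  have S: "S x = part Ip x - part Im x" if x: "x \<in> V" for x
  proof -
    \<comment> \<open>These signed coefficients are \<open>ell2_jadjoint K I f T x\<close> by
      \<open>adj\<close>, so \<open>T_has_hsum\<close> identifies the frame sum with its image under
      \<open>T\<close>.\<close>
    let ?c = "pairing Ip x + (- 1) *\<^sub>C pairing Im x"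
    have c: "?c \<in> seqs" by (intro ell2_add ell2_scale pairing_mem[OF Ip x] pairing_mem[OF Im x])
    have "?c i *\<^sub>C f i = (sig K I f i * form x (f i)) *\<^sub>C f i" if "i \<in> I" for i
      using I[OF that] by (auto simp: sig pairing_def scaleC_fun_def scaleC_complex_def)
    then have sum_eq: "(\<Sum>i\<in>F. ?c i *\<^sub>C f i) = (\<Sum>i\<in>F. (sig K I f i * form x (f i)) *\<^sub>C f i)"
      if "F \<subseteq> I" for F
      using that by (intro sum.cong) auto
    have "has_hsum (khilbert K) (\<lambda>i. (sig K I f i * form x (f i)) *\<^sub>C f i) I (T ?c)"
      unfolding has_hsum_def
    proof
      show "T ?c \<in> hcarrier (khilbert K)" using T_mem[OF c] by simp
      show "((\<lambda>F. nrm ((\<Sum>i\<in>F. (sig K I f i * form x (f i)) *\<^sub>C f i) - T ?c)) \<longlongrightarrow> 0)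
          (finite_subsets_at_top I)"
      proof (rule Lim_transform_eventually)
        show "((\<lambda>F. nrm ((\<Sum>i\<in>F. ?c i *\<^sub>C f i) - T ?c)) \<longlongrightarrow> 0) (finite_subsets_at_top I)"
          using T_has_hsum[OF c] by (simp only: has_hsum_def)
      qed (intro eventually_finite_subsets_at_top_weakI, simp only: sum_eq)
    qed
    then have "S x = T ?c"
      unfolding assms(7) j_frame_op_def by (rule H.hsum_eqI) (simp add: F.scale_mem f_mem)
    then show ?thesis using TT[OF x] adj[OF x] by simp
  qed
  obtain T' where T': "synthesis_op K I f T'"
    "maximal_wrt (unif_j_positive K) (synth_pos K I f T' ` seqs)"
    "maximal_wrt (unif_j_negative K) (synth_neg K I f T' ` seqs)"
    using assms(3) by (auto simp: j_frame_def)
  interpret T': bessel_synthesis K I f T'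
    using bessel T'(1) by unfold_locales
  have T'_image: "T' ` hcarrier (ell2 D) = T ` hcarrier (ell2 D)" if "D \<subseteq> I" for D
    using that by (intro image_cong refl synthesis_unique[OF T'(1)]) (simp add: ell2_subset_iff)
  interpret split: krein_splitting K "T ` hcarrier (ell2 Ip)" "T ` hcarrier (ell2 Im)" "part Ip" "part Im"
  proof unfold_locales
    show "maximal_wrt (unif_j_positive K) (T ` hcarrier (ell2 Ip))"
      using T'(2) T'.synth_eq(2)[OF Ip] T'_image[OF Ip] by (simp add: synth_pos_def Ip_def)
    show "maximal_wrt (unif_j_positive (anti_krein K)) (T ` hcarrier (ell2 Im))"
      using T'(3) T'.synth_eq(2)[OF Im] T'_image[OF Im]
      by (simp add: synth_neg_def Im_def unif_j_positive_anti_krein)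
  qed (rule bounded_part[OF Ip] bounded_part[OF Im] part_range[OF Ip] part_range[OF Im]
      part_sym[OF Ip] part_sym[OF Im] part_nonneg[OF Ip] part_nonneg[OF Im]
      part_dominates[OF Ip] part_dominates[OF Im]; assumption)+
  \<comment> \<open>\<open>S\<close> and the difference of the two parts are known to agree only on
    the carrier, so each predicate is shown to be insensitive to values elsewhere.\<close>
  have cong: "bounded_op (khilbert K) (khilbert K) A \<longleftrightarrow> bounded_op (khilbert K) (khilbert K) B"
    if "\<And>x. x \<in> V \<Longrightarrow> A x = B x" for A B
    using that by (auto simp: bounded_op_def F.mem)
  have pos: "j_positive K A \<longleftrightarrow> j_positive K B" if "\<And>x. x \<in> V \<Longrightarrow> A x = B x" for A B
    using that cong[of A B] by (auto simp: j_positive_def)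
  have bounded: "bounded_op (khilbert K) (khilbert K) S"
    using split.bounded_S cong[OF S] by simp
  have "invertible_op (khilbert K) S"
  proof -
    obtain R where R: "bounded_op (khilbert K) (khilbert K) R"
      "\<And>x. x \<in> V \<Longrightarrow> R (part Ip x - part Im x) = x \<and> part Ip (R x) - part Im (R x) = x"
      using split.invertible_S unfolding invertible_op_def carrier_khilbert by blast
    have "R (S x) = x \<and> S (R x) = x" if x: "x \<in> V" for x
    proof -
      have "R x \<in> V" using R(1) x by (simp add: bounded_op_def)
      then show ?thesis using R(2)[OF x] by (simp only: S x)
    qed
    then show ?thesis
      unfolding invertible_op_def carrier_khilbert using bounded R(1) by blast
  qed
  moreover have "j_selfadjoint K S"
    by (rule j_selfadjointI[OF bounded]) (simp only: S split.S_sym)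
  moreover have "ind_pos K S = cdim (kpos K)"
    using ind_pos_cong[OF refl, of K S "\<lambda>x. part Ip x - part Im x"] S split.ind_pos_S by simp
  moreover have "ind_neg K S = cdim (kneg K)"
    using ind_pos_cong[OF refl, of K "\<lambda>x. - S x" "\<lambda>x. - (part Ip x - part Im x)"] S split.ind_neg_S
    by (simp add: ind_neg_def)
  moreover have "j_positive K Sp" "j_positive K Sm"
    using pos[OF Sp] pos[OF Sm] part_j_positive[OF Ip] part_j_positive[OF Im] by simp_all
  ultimately show ?thesis using bounded by (simp add: S Sp Sm TT)
qed

end
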